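(* Let $A=A(V,R)$ be a QLC algebra over a field $k$ of characteristic zero. Then $((qA)^{¡},\tilde\phi,\tilde\theta)$ is a curved DG coalgebra. (In particular, the coderivation $\tilde\phi$ of $T^c(sV)$ preserves $(qA)^{¡}$.)
   Context: Homological gradings, Koszul sign rule; $sV$ is the suspension, $(sV)_i=V_{i-1}$; $T^c(W)$ is the tensor coalgebra with deconcatenation. A curved DG coalgebra $(C,d,h)$ is a graded coassociative counital coalgebra with a coderivation $d$ of degree $-1$ and a linear map $h:C\to k$ of degree $-2$ such that $d^2=(h\otimes\mathrm{id}-\mathrm{id}\otimes h)\circ\Delta$ and $h\circ d=0$. A QLC datum is a non-negatively graded vector space $V$ with a degree-homogeneous subspace $R\subset k\oplus V\oplus V^{\otimes2}$. The QLC algebra is $A=A(V,R):=T(V)/(R)$. It is assumed throughout that $R\cap(k\oplus V)=\{0\}$ and $(R)\cap(k\oplus V\oplus V^{\otimes2})=R$, where $(R)$ is the two-sided ideal generated by $R$. Let $q:T(V)\to V^{\otimes2}$ be the projection, $qR:=q(R)$, and $\phi:qR\to V$, $\theta:qR\to k$ the unique degree $0$ linear maps with $R=\{x-\phi(x)+\theta(x)\mid x\in qR\}$. $qA:=T(V)/(qR)$. View $s^2qR\subset(sV)^{\otimes2}$ via $s^2(v\otimes w)=(-1)^{|v|}sv\otimes sw$. The Koszul dual coalgebra $(qA)^{¡}=C(sV,s^2qR)\subset T^c(sV)$ is the graded subcoalgebra $k\oplus sV\oplus s^2qR\oplus\cdots\oplus\bigcap_{i+2+j=n}(sV)^{\otimes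 i}\otimes s^2qR\otimes(sV)^{\otimes j}\oplus\cdots$. The map $\tilde\phi:(qA)^{¡}\twoheadrightarrow s^2qR\to sV$, $s^2x\mapsto s\phi(x)$, has degree $-1$; the coderivation of $(qA)^{¡}$ it determines (by the formula for coderivations into $T^c(sV)$, with corestriction to $sV$ equal to this map) is also denoted $\tilde\phi$. The map $\tilde\theta:(qA)^{¡}\twoheadrightarrow s^2qR\to k$, $s^2x\mapsto\theta(x)$, has degree $-2$. *)

theory Defs
  imports Complex_Main "HOL-Library.Function_Algebras"
begin

section \<open>Graded vector spaces\<close>

text \<open>
  A vector space over the field \<open>'k\<close> is a type \<open>'v\<close> with a scalar multiplication \<open>s\<close>
  satisfying \<^locale>\<open>vector_space\<close>; a subspace \<open>C\<close> of it serves as carrier where needed.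
  A grading is a family \<open>G :: int \<Rightarrow> 'v set\<close> of homogeneous parts.
\<close>

definition linear_on ::
  "('k::field \<Rightarrow> 'a::ab_group_add \<Rightarrow> 'a) \<Rightarrow> ('k \<Rightarrow> 'b::ab_group_add \<Rightarrow> 'b) \<Rightarrow> 'a set \<Rightarrow> ('a \<Rightarrow> 'b) \<Rightarrow> bool"
  where "linear_on s s' C f \<longleftrightarrow>
    (\<forall>x\<in>C. \<forall>y\<in>C. f (x + y) = f x + f y) \<and> (\<forall>c. \<forall>x\<in>C. f (s c x) = s' c (f x))"

definition is_grading ::
  "('k::field \<Rightarrow> 'v::ab_group_add \<Rightarrow> 'v) \<Rightarrow> 'v set \<Rightarrow> (int \<Rightarrow> 'v set) \<Rightarrow> bool"
  where "is_grading s C G \<longleftrightarrow>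
    (\<forall>i. module.subspace s (G i)) \<and>
    C = module.span s (\<Union>i. G i) \<and>
    (\<forall>I f. finite I \<longrightarrow> (\<forall>i\<in>I. f i \<in> G i) \<longrightarrow> (\<Sum>i\<in>I. f i) = 0 \<longrightarrow> (\<forall>i\<in>I. f i = 0))"

text \<open>\<open>(sV)\<^sub>i = V\<^sub>i\<^sub>-\<^sub>1\<close>: the vector space underlying \<open>sV\<close> is that of \<open>V\<close>, so \<open>v \<mapsto> sv\<close> is the identity
  and only the grading changes.\<close>

definition susp :: "(int \<Rightarrow> 'v set) \<Rightarrow> int \<Rightarrow> 'v set"
  where "susp G i = G (i - 1)"


section \<open>The tensor algebra\<close>

text \<open>
  Over a field, \<open>V\<^sup>\<otimes>\<^sup>n\<close> embeds into the dual of the space of \<open>n\<close>-linear forms on \<open>V\<close>, the tensor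
  \<open>v\<^sub>1 \<otimes> \<dots> \<otimes> v\<^sub>n\<close> being evaluation at \<open>(v\<^sub>1, \<dots>, v\<^sub>n)\<close>. A family of \<open>n\<close>-linear forms, one for each
  \<open>n\<close>, is a single function on words; \<open>T(V)\<close> is the span of the evaluations. The lemma
  \<open>tensor_alg_universal\<close> below is the universal property.
  The construction takes place in a function type, so \<open>T(V)\<close> is again a subspace of a vector space
  and the construction can be iterated. For subspaces \<open>C\<close>, \<open>D\<close> of \<open>W\<close> the space \<open>C \<otimes> D\<close> is the
  subspace of \<open>W \<otimes> W\<close> spanned by the \<open>c \<otimes> d\<close>.
\<close>

type_synonym ('v, 'k) tensor = "('v list \<Rightarrow> 'k) \<Rightarrow> 'k"

definition tscale :: "'k::field \<Rightarrow> ('v, 'k) tensor \<Rightarrow> ('v, 'k) tensor"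
  where "tscale c t = (\<lambda>\<beta>. c * t \<beta>)"

definition multilinear ::
  "('k::field \<Rightarrow> 'v::ab_group_add \<Rightarrow> 'v) \<Rightarrow> ('k \<Rightarrow> 'w::ab_group_add \<Rightarrow> 'w) \<Rightarrow> ('v list \<Rightarrow> 'w) \<Rightarrow> bool"
  where "multilinear s s' g \<longleftrightarrow> (\<forall>us ws. Vector_Spaces.linear s s' (\<lambda>v. g (us @ v # ws)))"

definition pure :: "('k::field \<Rightarrow> 'v::ab_group_add \<Rightarrow> 'v) \<Rightarrow> 'v list \<Rightarrow> ('v, 'k) tensor"
  where "pure s ws = (\<lambda>\<beta>. if multilinear s (*) \<beta> then \<beta> ws else 0)"

definition tensor_alg :: "('k::field \<Rightarrow> 'v::ab_group_add \<Rightarrow> 'v) \<Rightarrow> ('v, 'k) tensor set"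
  where "tensor_alg s = module.span tscale (range (pure s))"

definition tensor_power :: "('k::field \<Rightarrow> 'v::ab_group_add \<Rightarrow> 'v) \<Rightarrow> nat \<Rightarrow> ('v, 'k) tensor set"
  where "tensor_power s n = module.span tscale {pure s ws | ws. length ws = n}"

definition tensor_upto :: "('k::field \<Rightarrow> 'v::ab_group_add \<Rightarrow> 'v) \<Rightarrow> nat \<Rightarrow> ('v, 'k) tensor set"
  where "tensor_upto s n = module.span tscale (\<Union>m\<le>n. tensor_power s m)"

text \<open>The linear extension to \<open>T(V)\<close> of a multilinear map \<open>g\<close> on words with values in tensors:
  \<open>tlift g (pure s ws) = g ws\<close>.\<close>

definition tlift :: "('v list \<Rightarrow> ('w, 'k) tensor) \<Rightarrow> ('v, 'k) tensor \<Rightarrow> ('w, 'k) tensor"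
  where "tlift g t = (\<lambda>\<beta>. t (\<lambda>ws. g ws \<beta>))"

definition tmult ::
  "('k::field \<Rightarrow> 'v::ab_group_add \<Rightarrow> 'v) \<Rightarrow> ('v, 'k) tensor \<Rightarrow> ('v, 'k) tensor \<Rightarrow> ('v, 'k) tensor"
  where "tmult s x y = tlift (\<lambda>us. tlift (\<lambda>ws. pure s (us @ ws)) y) x"

definition tproj ::
  "('k::field \<Rightarrow> 'v::ab_group_add \<Rightarrow> 'v) \<Rightarrow> nat \<Rightarrow> ('v, 'k) tensor \<Rightarrow> ('v, 'k) tensor"
  where "tproj s n = tlift (\<lambda>ws. if length ws = n then pure s ws else 0)"

definition homogeneous_word :: "(int \<Rightarrow> 'v set) \<Rightarrow> int list \<Rightarrow> 'v list \<Rightarrow> bool"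
  where "homogeneous_word G es ws \<longleftrightarrow> list_all2 (\<lambda>e w. w \<in> G e) es ws"

definition tpower_grade ::
  "('k::field \<Rightarrow> 'v::ab_group_add \<Rightarrow> 'v) \<Rightarrow> (int \<Rightarrow> 'v set) \<Rightarrow> nat \<Rightarrow> int \<Rightarrow> ('v, 'k) tensor set"
  where "tpower_grade s G n i = module.span tscale
    {pure s ws | ws es. length ws = n \<and> homogeneous_word G es ws \<and> sum_list es = i}"

definition tensor_grade ::
  "('k::field \<Rightarrow> 'v::ab_group_add \<Rightarrow> 'v) \<Rightarrow> (int \<Rightarrow> 'v set) \<Rightarrow> int \<Rightarrow> ('v, 'k) tensor set"
  where "tensor_grade s G i = module.span tscale (\<Union>n. tpower_grade s G n i)"

definition two_sided_ideal ::
  "('k::field \<Rightarrow> 'v::ab_group_add \<Rightarrow> 'v) \<Rightarrow> ('v, 'k) tensor set \<Rightarrow> ('v, 'k) tensor set"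
  where "two_sided_ideal s R = module.span tscale
    {tmult s (tmult s x r) y | x r y. x \<in> tensor_alg s \<and> r \<in> R \<and> y \<in> tensor_alg s}"

text \<open>The linear map on \<open>C\<^sup>\<otimes>\<^sup>n\<close>, \<open>C = \<Oplus>\<^sub>i G i\<close>, with value \<open>B [e\<^sub>1, \<dots>, e\<^sub>n] [c\<^sub>1, \<dots>, c\<^sub>n]\<close> at
  \<open>c\<^sub>1 \<otimes> \<dots> \<otimes> c\<^sub>n\<close> for homogeneous \<open>c\<^sub>j\<close> of degree \<open>e\<^sub>j\<close>; the degrees are passed to \<open>B\<close> for the
  Koszul signs. It is determined on \<open>C\<^sup>\<otimes>\<^sup>n\<close> only, and is used there only.\<close>

definition homog_ext ::
  "('k::field \<Rightarrow> 'v::ab_group_add \<Rightarrow> 'v) \<Rightarrow> (int \<Rightarrow> 'v set) \<Rightarrow> nat \<Rightarrow> ('k \<Rightarrow> 'w::ab_group_add \<Rightarrow> 'w) \<Rightarrow>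
    (int list \<Rightarrow> 'v list \<Rightarrow> 'w) \<Rightarrow> ('v, 'k) tensor \<Rightarrow> 'w"
  where "homog_ext s G n s' B = (SOME L. Vector_Spaces.linear tscale s' L \<and>
    (\<forall>es ws. length ws = n \<longrightarrow> homogeneous_word G es ws \<longrightarrow> L (pure s ws) = B es ws))"

lemma vector_space_tscale: "vector_space (tscale :: 'k::field \<Rightarrow> ('v, 'k) tensor \<Rightarrow> _)"
  by unfold_locales (auto simp: tscale_def fun_eq_iff algebra_simps)

lemma tensor_alg_universal:
  fixes s :: "'k::field \<Rightarrow> 'v::ab_group_add \<Rightarrow> 'v"
    and s' :: "'k \<Rightarrow> 'w::ab_group_add \<Rightarrow> 'w"
  assumes s': "vector_space s'" and g: "multilinear s s' g"
  shows "\<exists>L. Vector_Spaces.linear tscale s' L \<and> (\<forall>ws. L (pure s ws) = g ws)"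
proof -
  interpret T: vector_space "tscale :: 'k \<Rightarrow> ('v, 'k) tensor \<Rightarrow> _" by (rule vector_space_tscale)
  interpret W: vector_space s' by (rule s')
  interpret K: vector_space "(*) :: 'k \<Rightarrow> 'k \<Rightarrow> 'k" by unfold_locales (auto simp: algebra_simps)
  interpret TW: vector_space_pair "tscale :: 'k \<Rightarrow> ('v, 'k) tensor \<Rightarrow> _" s' ..
  interpret WK: vector_space_pair s' "(*) :: 'k \<Rightarrow> 'k \<Rightarrow> 'k" ..
  obtain B where B: "B \<subseteq> range (pure s)" "T.independent B" "range (pure s) \<subseteq> T.span B"
    using T.maximal_independent_subset_extend[of "{}" "range (pure s)"] T.independent_empty by auto
  obtain L where L: "Vector_Spaces.linear tscale s' L"
    and LB: "\<forall>b\<in>B. L b = g (inv_into UNIV (pure s) b)"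
    using TW.linear_independent_extend[OF B(2), of "\<lambda>b. g (inv_into UNIV (pure s) b)"] by blast
  interpret L: Vector_Spaces.linear tscale s' L by (rule L)
  have eval: "f (L t) = t (f \<circ> g)"
    if f: "Vector_Spaces.linear s' (*) f" and t: "t \<in> T.span B" for f t
  proof -
    interpret f: Vector_Spaces.linear s' "(*)" f by (rule f)
    have fg: "multilinear s (*) (f \<circ> g)"
      using g Vector_Spaces.linear_compose[OF _ f]
      by (fastforce simp: multilinear_def comp_def)
    show ?thesis
      using t
    proof (induction t rule: T.span_induct_alt)
      case base
      show ?case using L.zero f.zero by (simp add: zero_fun_def)
    next
      case (step c b t)
      have "pure s (inv_into UNIV (pure s) b) = b"
        using step B(1) by (meson f_inv_into_f subsetD)
      hence "f (g (inv_into UNIV (pure s) b)) = b (f \<circ> g)"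
        using fg by (metis comp_apply pure_def)
      moreover have "f (L (tscale c b + t)) = c * f (L b) + f (L t)"
        by (simp only: L.add L.scale f.add f.scale)
      ultimately show ?case
        using step LB by (simp add: tscale_def comp_def plus_fun_def)
    qed
  qed
  have "L (pure s ws) = g ws" for ws
  proof (rule ccontr)
    assume "L (pure s ws) \<noteq> g ws"
    hence "W.independent {L (pure s ws) - g ws}" by simp
    then obtain f where f: "Vector_Spaces.linear s' (*) f"
      and f1: "f (L (pure s ws) - g ws) = (1::'k)"
      using WK.linear_independent_extend[of "{L (pure s ws) - g ws}" "\<lambda>_. 1"] by auto
    interpret f: Vector_Spaces.linear s' "(*)" f by (rule f)
    have fg: "multilinear s (*) (f \<circ> g)"
      using g Vector_Spaces.linear_compose[OF _ f]
      by (fastforce simp: multilinear_def comp_def)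
    have "f (L (pure s ws)) = pure s ws (f \<circ> g)"
      using eval[OF f] B(3) by auto
    also have "\<dots> = f (g ws)" using fg by (simp add: pure_def)
    finally show False using f1 by (simp add: f.diff)
  qed
  with L show ?thesis by blast
qed


section \<open>Curved DG coalgebras\<close>

text \<open>The carrier \<open>C\<close> is a subspace of the vector space with scalar multiplication \<open>s\<close>.\<close>

definition graded_coalgebra ::
  "('k::field \<Rightarrow> 'c::ab_group_add \<Rightarrow> 'c) \<Rightarrow> 'c set \<Rightarrow> (int \<Rightarrow> 'c set) \<Rightarrow>
    ('c \<Rightarrow> ('c, 'k) tensor) \<Rightarrow> ('c \<Rightarrow> 'k) \<Rightarrow> bool"
  where "graded_coalgebra s C G \<Delta> \<epsilon> \<longleftrightarrow>
    vector_space s \<and> is_grading s C G \<and>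
    linear_on s tscale C \<Delta> \<and> (\<forall>i. \<forall>x\<in>G i. \<Delta> x \<in> tpower_grade s G 2 i) \<and>
    linear_on s (*) C \<epsilon> \<and> (\<forall>i. \<forall>x\<in>G i. i \<noteq> 0 \<longrightarrow> \<epsilon> x = 0) \<and>
    (\<forall>x\<in>C. homog_ext s G 2 tscale (\<lambda>es ws. tmult s (\<Delta> (ws ! 0)) (pure s [ws ! 1])) (\<Delta> x)
          = homog_ext s G 2 tscale (\<lambda>es ws. tmult s (pure s [ws ! 0]) (\<Delta> (ws ! 1))) (\<Delta> x)) \<and>
    (\<forall>x\<in>C. homog_ext s G 2 s (\<lambda>es ws. s (\<epsilon> (ws ! 0)) (ws ! 1)) (\<Delta> x) = x) \<and>
    (\<forall>x\<in>C. homog_ext s G 2 s (\<lambda>es ws. s (\<epsilon> (ws ! 1)) (ws ! 0)) (\<Delta> x) = x)"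

text \<open>\<open>\<Delta> d = (d \<otimes> id + id \<otimes> d) \<Delta>\<close> for \<open>d\<close> of degree \<open>p\<close>, with
  \<open>(id \<otimes> d) (a \<otimes> b) = (-1)\<^sup>p\<^sup>|\<^sup>a\<^sup>| a \<otimes> d b\<close>.\<close>

definition coderivation ::
  "('k::field \<Rightarrow> 'c::ab_group_add \<Rightarrow> 'c) \<Rightarrow> 'c set \<Rightarrow> (int \<Rightarrow> 'c set) \<Rightarrow>
    ('c \<Rightarrow> ('c, 'k) tensor) \<Rightarrow> int \<Rightarrow> ('c \<Rightarrow> 'c) \<Rightarrow> bool"
  where "coderivation s C G \<Delta> p d \<longleftrightarrow>
    linear_on s s C d \<and> (\<forall>x\<in>C. d x \<in> C) \<and> (\<forall>i. \<forall>x\<in>G i. d x \<in> G (i + p)) \<and>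
    (\<forall>x\<in>C. \<Delta> (d x) =
      homog_ext s G 2 tscale (\<lambda>es ws. pure s [d (ws ! 0), ws ! 1]) (\<Delta> x) +
      homog_ext s G 2 tscale
        (\<lambda>es ws. tscale ((-1) powi (p * es ! 0)) (pure s [ws ! 0, d (ws ! 1)])) (\<Delta> x))"

text \<open>Since \<open>h\<close> has even degree, no sign appears in \<open>id \<otimes> h\<close>; \<open>k \<otimes> C\<close> and \<open>C \<otimes> k\<close> are identified
  with \<open>C\<close>.\<close>

definition curved_dg_coalgebra ::
  "('k::field \<Rightarrow> 'c::ab_group_add \<Rightarrow> 'c) \<Rightarrow> 'c set \<Rightarrow> (int \<Rightarrow> 'c set) \<Rightarrow>
    ('c \<Rightarrow> ('c, 'k) tensor) \<Rightarrow> ('c \<Rightarrow> 'k) \<Rightarrow> ('c \<Rightarrow> 'c) \<Rightarrow> ('c \<Rightarrow> 'k) \<Rightarrow> bool"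
  where "curved_dg_coalgebra s C G \<Delta> \<epsilon> d h \<longleftrightarrow>
    graded_coalgebra s C G \<Delta> \<epsilon> \<and>
    coderivation s C G \<Delta> (-1) d \<and>
    linear_on s (*) C h \<and> (\<forall>i. \<forall>x\<in>G i. i \<noteq> 2 \<longrightarrow> h x = 0) \<and>
    (\<forall>x\<in>C. d (d x) =
      homog_ext s G 2 s (\<lambda>es ws. s (h (ws ! 0)) (ws ! 1)) (\<Delta> x) -
      homog_ext s G 2 s (\<lambda>es ws. s (h (ws ! 1)) (ws ! 0)) (\<Delta> x)) \<and>
    (\<forall>x\<in>C. h (d x) = 0)"


section \<open>The tensor coalgebra\<close>

definition deconcat ::
  "('k::field \<Rightarrow> 'v::ab_group_add \<Rightarrow> 'v) \<Rightarrow> ('v, 'k) tensor \<Rightarrow> (('v, 'k) tensor, 'k) tensor"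
  where "deconcat s =
    tlift (\<lambda>ws. \<Sum>i\<le>length ws. pure tscale [pure s (take i ws), pure s (drop i ws)])"

definition deconcat3 ::
  "('k::field \<Rightarrow> 'v::ab_group_add \<Rightarrow> 'v) \<Rightarrow> ('v, 'k) tensor \<Rightarrow> (('v, 'k) tensor, 'k) tensor"
  where "deconcat3 s = tlift (\<lambda>ws. \<Sum>j\<le>length ws. \<Sum>i\<le>j.
    pure tscale [pure s (take i ws), pure s (drop i (take j ws)), pure s (drop j ws)])"

definition tcounit :: "('v, 'k::field) tensor \<Rightarrow> 'k"
  where "tcounit t = t (\<lambda>ws. if ws = [] then 1 else 0)"

text \<open>The coderivation into \<open>T\<^sup>c(W)\<close> determined by a linear map \<open>f : C \<rightarrow> W\<close> of degree \<open>p\<close>, where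
  \<open>C \<subseteq> T\<^sup>c(W)\<close> is a graded subcoalgebra and \<open>G\<close> is the grading of \<open>W\<close>: the composite of
  \<open>\<Delta>\<^sup>(\<^sup>3\<^sup>) : C \<rightarrow> C \<otimes> C \<otimes> C\<close>, \<open>id \<otimes> f \<otimes> id\<close> and concatenation.\<close>

definition coderivation_of ::
  "('k::field \<Rightarrow> 'v::ab_group_add \<Rightarrow> 'v) \<Rightarrow> (int \<Rightarrow> 'v set) \<Rightarrow> ('v, 'k) tensor set \<Rightarrow> int \<Rightarrow>
    (('v, 'k) tensor \<Rightarrow> 'v) \<Rightarrow> ('v, 'k) tensor \<Rightarrow> ('v, 'k) tensor"
  where "coderivation_of s G C p f c =
    homog_ext tscale (\<lambda>i. C \<inter> tensor_grade s G i) 3 tscale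
      (\<lambda>es ws. tscale ((-1) powi (p * es ! 0))
        (tmult s (tmult s (ws ! 0) (pure s [f (ws ! 1)])) (ws ! 2)))
      (deconcat3 s c)"

text \<open>The quadratic coalgebra \<open>C(W, S) = k \<oplus> W \<oplus> S \<oplus> \<dots>\<close> for \<open>S \<subseteq> W \<otimes> W\<close>. In weights 0 and 1 the
  intersection is empty, and the component is all of \<open>W\<^sup>\<otimes>\<^sup>n\<close>.\<close>

definition quadratic_coalgebra_weight ::
  "('k::field \<Rightarrow> 'v::ab_group_add \<Rightarrow> 'v) \<Rightarrow> ('v, 'k) tensor set \<Rightarrow> nat \<Rightarrow> ('v, 'k) tensor set"
  where "quadratic_coalgebra_weight s S n = tensor_power s n \<inter>
    (\<Inter>(i, j) \<in> {(i, j). i + 2 + j = n}. module.span tscale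
      {tmult s (tmult s x r) y | x r y. x \<in> tensor_power s i \<and> r \<in> S \<and> y \<in> tensor_power s j})"

definition quadratic_coalgebra ::
  "('k::field \<Rightarrow> 'v::ab_group_add \<Rightarrow> 'v) \<Rightarrow> ('v, 'k) tensor set \<Rightarrow> ('v, 'k) tensor set"
  where "quadratic_coalgebra s S = module.span tscale (\<Union>n. quadratic_coalgebra_weight s S n)"


section \<open>QLC data and the Koszul dual coalgebra\<close>

text \<open>\<open>k\<close> and \<open>V\<close> sit in \<open>T(V)\<close> as \<^term>\<open>tensor_power s 0\<close> and \<^term>\<open>tensor_power s 1\<close>.\<close>

definition qlc_datum ::
  "('k::field \<Rightarrow> 'v::ab_group_add \<Rightarrow> 'v) \<Rightarrow> (int \<Rightarrow> 'v set) \<Rightarrow> ('v, 'k) tensor set \<Rightarrow> bool"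
  where "qlc_datum s G R \<longleftrightarrow>
    vector_space s \<and> is_grading s UNIV G \<and> (\<forall>i<0. G i = {0}) \<and>
    module.subspace tscale R \<and> R \<subseteq> tensor_upto s 2 \<and>
    R = module.span tscale (\<Union>i. R \<inter> tensor_grade s G i) \<and>
    R \<inter> tensor_upto s 1 = {0} \<and>
    two_sided_ideal s R \<inter> tensor_upto s 2 = R"

definition quadratic_part ::
  "('k::field \<Rightarrow> 'v::ab_group_add \<Rightarrow> 'v) \<Rightarrow> ('v, 'k) tensor set \<Rightarrow> ('v, 'k) tensor set"
  where "quadratic_part s R = tproj s 2 ` R"

definition qlc_maps ::
  "('k::field \<Rightarrow> 'v::ab_group_add \<Rightarrow> 'v) \<Rightarrow> (int \<Rightarrow> 'v set) \<Rightarrow> ('v, 'k) tensor set \<Rightarrow>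
    (('v, 'k) tensor \<Rightarrow> 'v) \<Rightarrow> (('v, 'k) tensor \<Rightarrow> 'k) \<Rightarrow> bool"
  where "qlc_maps s G R \<phi> \<theta> \<longleftrightarrow>
    linear_on tscale s (quadratic_part s R) \<phi> \<and>
    linear_on tscale (*) (quadratic_part s R) \<theta> \<and>
    (\<forall>i. \<forall>x \<in> quadratic_part s R \<inter> tensor_grade s G i. \<phi> x \<in> G i) \<and>
    (\<forall>i. \<forall>x \<in> quadratic_part s R \<inter> tensor_grade s G i. i \<noteq> 0 \<longrightarrow> \<theta> x = 0) \<and>
    R = {x - pure s [\<phi> x] + tscale (\<theta> x) (pure s []) | x. x \<in> quadratic_part s R}"

text \<open>\<open>s\<^sup>2 : V\<^sup>\<otimes>\<^sup>2 \<rightarrow> (sV)\<^sup>\<otimes>\<^sup>2\<close>, \<open>v \<otimes> w \<mapsto> (-1)\<^sup>|\<^sup>v\<^sup>| sv \<otimes> sw\<close>.\<close>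

definition susp2 ::
  "('k::field \<Rightarrow> 'v::ab_group_add \<Rightarrow> 'v) \<Rightarrow> (int \<Rightarrow> 'v set) \<Rightarrow> ('v, 'k) tensor \<Rightarrow> ('v, 'k) tensor"
  where "susp2 s G =
    homog_ext s G 2 tscale (\<lambda>es ws. tscale ((-1) powi (es ! 0)) (pure s [ws ! 0, ws ! 1]))"

definition koszul_dual ::
  "('k::field \<Rightarrow> 'v::ab_group_add \<Rightarrow> 'v) \<Rightarrow> (int \<Rightarrow> 'v set) \<Rightarrow> ('v, 'k) tensor set \<Rightarrow> ('v, 'k) tensor set"
  where "koszul_dual s G R = quadratic_coalgebra s (susp2 s G ` quadratic_part s R)"

definition koszul_dual_grade ::
  "('k::field \<Rightarrow> 'v::ab_group_add \<Rightarrow> 'v) \<Rightarrow> (int \<Rightarrow> 'v set) \<Rightarrow> ('v, 'k) tensor set \<Rightarrow>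
    int \<Rightarrow> ('v, 'k) tensor set"
  where "koszul_dual_grade s G R i = koszul_dual s G R \<inter> tensor_grade s (susp G) i"

definition desusp2 ::
  "('k::field \<Rightarrow> 'v::ab_group_add \<Rightarrow> 'v) \<Rightarrow> (int \<Rightarrow> 'v set) \<Rightarrow> ('v, 'k) tensor set \<Rightarrow>
    ('v, 'k) tensor \<Rightarrow> ('v, 'k) tensor"
  where "desusp2 s G R = inv_into (quadratic_part s R) (susp2 s G)"

text \<open>\<open>\<phi>_corestr\<close> is the degree \<open>-1\<close> map to \<open>sV\<close>, \<open>\<phi>_tilde\<close> the coderivation it determines.\<close>

definition \<phi>_corestr ::
  "('k::field \<Rightarrow> 'v::ab_group_add \<Rightarrow> 'v) \<Rightarrow> (int \<Rightarrow> 'v set) \<Rightarrow> ('v, 'k) tensor set \<Rightarrow>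
    (('v, 'k) tensor \<Rightarrow> 'v) \<Rightarrow> ('v, 'k) tensor \<Rightarrow> 'v"
  where "\<phi>_corestr s G R \<phi> c = \<phi> (desusp2 s G R (tproj s 2 c))"

definition \<phi>_tilde ::
  "('k::field \<Rightarrow> 'v::ab_group_add \<Rightarrow> 'v) \<Rightarrow> (int \<Rightarrow> 'v set) \<Rightarrow> ('v, 'k) tensor set \<Rightarrow>
    (('v, 'k) tensor \<Rightarrow> 'v) \<Rightarrow> ('v, 'k) tensor \<Rightarrow> ('v, 'k) tensor"
  where "\<phi>_tilde s G R \<phi> =
    coderivation_of s (susp G) (koszul_dual s G R) (-1) (\<phi>_corestr s G R \<phi>)"

definition \<theta>_tilde ::
  "('k::field \<Rightarrow> 'v::ab_group_add \<Rightarrow> 'v) \<Rightarrow> (int \<Rightarrow> 'v set) \<Rightarrow> ('v, 'k) tensor set \<Rightarrow>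
    (('v, 'k) tensor \<Rightarrow> 'k) \<Rightarrow> ('v, 'k) tensor \<Rightarrow> 'k"
  where "\<theta>_tilde s G R \<theta> c = \<theta> (desusp2 s G R (tproj s 2 c))"

end

theory Submission
  imports Defs
begin

text \<open>
  Write \<open>S = s\<^sup>2 qR\<close> and \<open>C\<^sub>n\<close> for the weight \<open>n\<close> part of the Koszul dual coalgebra. A coderivation of
  \<open>T\<^sup>c(sV)\<close> with values determined in weight two inserts a map \<open>\<Phi> : (sV)\<^sup>\<otimes>\<^sup>2 \<rightarrow> sV\<close> at all pairs of
  neighbouring letters, so every assertion about it on \<open>C\<close> reduces to what happens on three consecutive
  letters, that is, on \<open>C\<^sub>3 = S \<otimes> sV \<inter> sV \<otimes> S\<close>.

  The condition on \<open>C\<^sub>3\<close> is the only place where the relations enter (\<open>overlap_relation\<close>). Up to signs an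
  element of \<open>C\<^sub>3\<close> is a \<open>y \<in> qR \<otimes> V \<inter> V \<otimes> qR\<close>. Rewriting \<open>y\<close> modulo \<open>R\<close> at its first two letters and at its
  last two letters gives two elements that are congruent to \<open>y\<close> modulo the ideal \<open>(R)\<close>. Their difference is
  \<open>-z + u\<close> up to sign, with \<open>z = (\<phi> \<otimes> id - id \<otimes> \<phi>) y\<close> and \<open>u = (\<theta> \<otimes> id - id \<otimes> \<theta>) y\<close>; it has length at
  most two and hence lies in \<open>R\<close>. Comparing with \<open>R = {x - \<phi>(x) + \<theta>(x)}\<close> yields \<open>z \<in> qR\<close>, \<open>\<phi>(z) = u\<close> and \<open>\<theta>(z) = 0\<close>. After
  suspension, \<open>d\<close> sends the element of \<open>C\<^sub>3\<close> to \<open>s\<^sup>2 z\<close> (\<open>d_overlap\<close>), and the three statements become: \<open>d\<close> maps \<open>C\<^sub>3\<close>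
  to \<open>S\<close>, there \<open>d\<^sup>2 = h \<otimes> id - id \<otimes> h\<close>, and \<open>h d = 0\<close>.

  The passage from \<open>C\<^sub>3\<close> to \<open>C\<close> holds for every quadratic coalgebra (\<open>curved_quadratic_coalgebra\<close>). Its basis is
  the inclusion \<open>C\<^sub>n \<subseteq> C\<^sub>i \<otimes> C\<^sub>n\<^sub>-\<^sub>i\<close> (\<open>cut_wt\<close>), obtained by testing with linear forms on either factor. It
  makes \<open>C\<close> a subcoalgebra, and it allows inductions on the weight: the first one, two or three letters of an
  element of \<open>C\<^sub>n\<close> may be assumed to lie in \<open>C\<^sub>1\<close>, \<open>C\<^sub>2\<close> or \<open>C\<^sub>3\<close>, with the rest in \<open>C\<close> as well. In \<open>d\<^sup>2\<close> the
  insertions at disjoint places cancel because \<open>\<Phi>\<close> is odd, the overlapping ones are governed by \<open>C\<^sub>3\<close>, and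
  the sum of \<open>\<theta> \<otimes> id - id \<otimes> \<theta>\<close> over all places telescopes to its two outermost terms.

  Gradings are handled through operators: multiplication by \<open>\<mu>\<^sup>i\<close> in degree \<open>i\<close> extends to an algebra endomorphism
  of \<open>T(V)\<close>. For \<open>\<mu> = 2\<close> its eigenspaces are the homogeneous parts, in characteristic zero; for \<open>\<mu> = -1\<close> it
  produces the Koszul signs.
\<close>

section \<open>Linear maps on subspaces\<close>

interpretation T: vector_space "tscale :: 'k::field \<Rightarrow> ('v, 'k) tensor \<Rightarrow> ('v, 'k) tensor"
  by (rule vector_space_tscale)

(* Sums of tensors are never to be evaluated pointwise, although tensors are functions. *)
declare plus_fun_apply [simp del] zero_fun_apply [simp del]

lemmas lin_id = T.linear_id[unfolded id_def]

abbreviation "lin \<equiv> Vector_Spaces.linear"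

lemmas lin_iff = Vector_Spaces.linear_iff

lemma vector_space_mult: "vector_space ((*) :: 'k::field \<Rightarrow> 'k \<Rightarrow> 'k)"
  by unfold_locales (auto simp: algebra_simps)

lemma (in vector_space) span_linear_induct [consumes 1, case_names zero gen add scale]:
  assumes "x \<in> span X"
    and "P 0" and "\<And>x. x \<in> X \<Longrightarrow> P x"
    and "\<And>x y. x \<in> span X \<Longrightarrow> y \<in> span X \<Longrightarrow> P x \<Longrightarrow> P y \<Longrightarrow> P (x + y)"
    and "\<And>c x. x \<in> span X \<Longrightarrow> P x \<Longrightarrow> P (scale c x)"
  shows "P x"
proof -
  have "x \<in> span X \<and> P x"
    using assms(1)
    by (induction rule: span_induct_alt) (auto intro: assms span_zero span_add span_scale span_base)
  thus ?thesis by simp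
qed

lemma linear_on_subset: "linear_on s s' C f \<Longrightarrow> D \<subseteq> C \<Longrightarrow> linear_on s s' D f"
  unfolding linear_on_def by blast

lemma lin_imp_on: "lin s s' f \<Longrightarrow> linear_on s s' C f"
  by (auto simp: linear_on_def lin_iff)

lemma lin_add: "lin s s' f \<Longrightarrow> f (x + y) = f x + f y"
  by (simp add: lin_iff)

lemma lin_scale: "lin s s' f \<Longrightarrow> f (s c x) = s' c (f x)"
  by (simp add: lin_iff)

lemma linear_on_zero:
  assumes "vector_space s" "vector_space s'" "linear_on s s' C f" "0 \<in> C"
  shows "f 0 = 0"
proof -
  interpret S: vector_space s by fact
  interpret S': vector_space s' by fact
  have "f (s 0 0) = s' 0 (f 0)" using assms(3,4) unfolding linear_on_def by blast
  thus ?thesis by simp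
qed

lemma lin_zero: "lin s s' f \<Longrightarrow> f 0 = 0"
  by (rule linear_on_zero[where C = UNIV]) (auto simp: lin_iff linear_on_def)

lemma lin_sum: "lin s s' f \<Longrightarrow> f (sum g I) = (\<Sum>i\<in>I. f (g i))"
  by (induction I rule: infinite_finite_induct) (auto simp: lin_zero lin_add)

lemma lin_diff: "lin s s' f \<Longrightarrow> f (x - y) = f x - f y"
  using lin_add[of s s' f "x - y" y] by simp

lemma lin_comp:
  "lin s s' f \<Longrightarrow> lin s' s'' g \<Longrightarrow> lin s s'' (\<lambda>x. g (f x))"
  by (auto simp: lin_iff)

lemma lin_const_zero:
  "vector_space s \<Longrightarrow> vector_space s' \<Longrightarrow> lin s s' (\<lambda>x. 0)"
  by (auto simp: lin_iff vector_space_def module_def)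
    (metis add.right_neutral add_cancel_right_right)

lemma lin_plus:
  assumes "lin s s' f" "lin s s' g"
  shows "lin s s' (\<lambda>x. f x + g x)"
proof -
  interpret S': vector_space s' using assms(1) by (simp add: lin_iff)
  show ?thesis using assms by (auto simp: lin_iff S'.scale_right_distrib)
qed

lemma lin_minus:
  assumes "lin s s' f" "lin s s' g"
  shows "lin s s' (\<lambda>x. f x - g x)"
proof -
  interpret S': vector_space s' using assms(1) by (simp add: lin_iff)
  show ?thesis using assms by (auto simp: lin_iff S'.scale_right_diff_distrib)
qed

lemma lin_smult:
  assumes "lin s s' f"
  shows "lin s s' (\<lambda>x. s' c (f x))"
proof -
  interpret S': vector_space s' using assms(1) by (simp add: lin_iff)
  show ?thesis using assms by (auto simp: lin_iff S'.scale_right_distrib mult.commute)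
qed

lemma lin_scalar_mult:
  assumes "lin s (*) f" "vector_space s'"
  shows "lin s s' (\<lambda>x. s' (f x) y)"
proof -
  interpret S': vector_space s' by fact
  show ?thesis using assms by (auto simp: lin_iff S'.scale_left_distrib)
qed

lemma lin_sum_fun:
  assumes "vector_space s" "vector_space s'" "\<And>i. i \<in> I \<Longrightarrow> lin s s' (f i)"
  shows "lin s s' (\<lambda>x. \<Sum>i\<in>I. f i x)"
  using assms(3)
  by (induction I rule: infinite_finite_induct)
    (auto intro!: lin_const_zero lin_plus assms(1,2))

lemma linear_eq_on_span:
  assumes "vector_space s" "vector_space s'"
    and "linear_on s s' (module.span s X) f" "linear_on s s' (module.span s X) g"
    and "\<And>x. x \<in> X \<Longrightarrow> f x = g x" "x \<in> module.span s X"
  shows "f x = g x"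
proof -
  interpret S: vector_space s by fact
  show ?thesis using assms(6)
  proof (induction rule: S.span_linear_induct)
    case zero
    show ?case using linear_on_zero[OF assms(1,2,3)] linear_on_zero[OF assms(1,2,4)]
      by (simp add: S.span_zero)
  qed (use assms(3-5) in \<open>auto simp: linear_on_def\<close>)
qed

lemma lin_eq_on_span:
  assumes "lin s s' f" "lin s s' g" "\<And>x. x \<in> X \<Longrightarrow> f x = g x" "x \<in> module.span s X"
  shows "f x = g x"
  using linear_eq_on_span[OF _ _ lin_imp_on[OF assms(1)] lin_imp_on[OF assms(2)] assms(3,4)]
    assms(1) by (auto simp: lin_iff)

lemma linear_on_span_image:
  assumes "vector_space s" "vector_space s'"
    and "linear_on s s' (module.span s X) f"
    and "\<And>x. x \<in> X \<Longrightarrow> f x \<in> U" "module.subspace s' U" "x \<in> module.span s X"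
  shows "f x \<in> U"
proof -
  interpret S: vector_space s by fact
  interpret S': vector_space s' by fact
  show ?thesis using assms(6)
  proof (induction rule: S.span_linear_induct)
    case zero
    show ?case using linear_on_zero[OF assms(1,2,3)] assms(5)
      by (simp add: S.span_zero S'.subspace_0)
  qed (use assms(3-5) in \<open>auto simp: linear_on_def S'.subspace_add S'.subspace_scale\<close>)
qed

lemma lin_span_image:
  assumes "lin s s' f"
    and "\<And>x. x \<in> X \<Longrightarrow> f x \<in> U" "module.subspace s' U" "x \<in> module.span s X"
  shows "f x \<in> U"
  using linear_on_span_image[OF _ _ lin_imp_on[OF assms(1)] assms(2-4)] assms(1)
  by (auto simp: lin_iff)

text \<open>The maps of interest are linear on subspaces such as \<open>qR\<close> or \<open>T(V)\<close> only. Total extensions of them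
  can be composed freely.\<close>

lemma linear_on_extend:
  assumes "vector_space s" "vector_space s'" "module.subspace s U" "linear_on s s' U f"
  obtains g where "lin s s' g" "\<And>x. x \<in> U \<Longrightarrow> g x = f x"
proof -
  interpret S: vector_space s by fact
  interpret S': vector_space s' by fact
  interpret P: vector_space_pair s s' ..
  obtain B where B: "B \<subseteq> U" "S.independent B" "U \<subseteq> S.span B"
    using S.basis_exists[of U] by metis
  have sp: "S.span B = U" using B assms(3) S.span_minimal by blast
  obtain g where g: "lin s s' g" "\<forall>x\<in>B. g x = f x"
    using P.linear_independent_extend[OF B(2)] by blast
  have "g x = f x" if "x \<in> U" for x
    by (rule linear_eq_on_span[OF assms(1,2), of B])
      (use g assms(4) that sp lin_imp_on in auto)
  thus ?thesis using that g(1) by blast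
qed

lemma subspace_projection:
  assumes "vector_space s" "module.subspace s U"
  obtains e where "lin s s e" "\<And>x. x \<in> U \<Longrightarrow> e x = x" "\<And>x. e x \<in> U"
proof -
  interpret S: vector_space s by fact
  interpret P: vector_space_pair s s ..
  obtain B where B: "B \<subseteq> U" "S.independent B" "U \<subseteq> S.span B"
    using S.basis_exists[of U] by metis
  have sp: "S.span B = U" using B assms(2) S.span_minimal by blast
  obtain g where g: "lin s s g" "\<forall>x\<in>B. g x = x" "range g = S.span ((\<lambda>x. x) ` B)"
    using P.linear_independent_extend_subspace[OF B(2), of "\<lambda>x. x"] by blast
  have "g x = x" if "x \<in> U" for x
    by (rule linear_eq_on_span[OF assms(1,1), of B])
      (use g(2) that sp lin_imp_on[OF g(1)] in \<open>auto simp: linear_on_def\<close>)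
  moreover have "g x \<in> U" for x using g(3) sp by auto
  ultimately show ?thesis using that g(1) by blast
qed


section \<open>Multilinear maps and tensors\<close>

lemma multilinearI:
  "(\<And>us ws. lin s s' (\<lambda>v. g (us @ v # ws))) \<Longrightarrow> multilinear s s' g"
  by (simp add: multilinear_def)

lemma multilinearD: "multilinear s s' g \<Longrightarrow> lin s s' (\<lambda>v. g (us @ v # ws))"
  by (simp add: multilinear_def)

lemma multilinear_compose:
  "multilinear s s' g \<Longrightarrow> lin s' s'' f \<Longrightarrow> multilinear s s'' (\<lambda>ws. f (g ws))"
  unfolding multilinear_def using lin_comp by blast

lemma multilinear_plus:
  "multilinear s s' f \<Longrightarrow> multilinear s s' g \<Longrightarrow> multilinear s s' (\<lambda>ws. f ws + g ws)"
  unfolding multilinear_def using lin_plus by blast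

lemma multilinear_smult: "multilinear s s' f \<Longrightarrow> multilinear s s' (\<lambda>ws. s' c (f ws))"
  unfolding multilinear_def using lin_smult by blast

lemma multilinear_zero:
  "vector_space s \<Longrightarrow> vector_space s' \<Longrightarrow> multilinear s s' (\<lambda>ws. 0)"
  unfolding multilinear_def using lin_const_zero by blast

lemma multilinear_sum:
  assumes "vector_space s" "vector_space s'" "\<And>i. i \<in> I \<Longrightarrow> multilinear s s' (f i)"
  shows "multilinear s s' (\<lambda>ws. \<Sum>i\<in>I. f i ws)"
  using assms unfolding multilinear_def by (auto intro!: lin_sum_fun)

lemma multilinear_length:
  "(\<And>n. multilinear s s' (g n)) \<Longrightarrow> multilinear s s' (\<lambda>ws. g (length ws) ws)"
  unfolding multilinear_def by auto

lemma multilinear_append_left: "multilinear s s' g \<Longrightarrow> multilinear s s' (\<lambda>ws. g (us @ ws))"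
  unfolding multilinear_def append_assoc[symmetric] by blast

lemma multilinear_append_right: "multilinear s s' g \<Longrightarrow> multilinear s s' (\<lambda>ws. g (ws @ us))"
  unfolding multilinear_def append_assoc append_Cons by blast

lemma multilinear_map:
  assumes "multilinear s' s'' g" "lin s s' a"
  shows "multilinear s s'' (\<lambda>ws. g (map a ws))"
  using assms lin_comp unfolding multilinear_def by fastforce

text \<open>Cutting a word at a fixed place puts each letter into exactly one of the two pieces, so
  multilinearity in the pieces is enough.\<close>

lemma multilinear_split:
  assumes "\<And>ys. multilinear s s' (\<lambda>xs. B xs ys)" "\<And>xs. multilinear s s' (\<lambda>ys. B xs ys)"
  shows "multilinear s s' (\<lambda>ws. B (take i ws) (drop i ws))"
proof (rule multilinearI)
  fix us ws
  show "lin s s' (\<lambda>v. B (take i (us @ v # ws)) (drop i (us @ v # ws)))"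
  proof (cases "length us < i")
    case True
    then obtain m where "i = length us + Suc m" using less_imp_Suc_add by auto
    thus ?thesis using multilinearD[OF assms(1)] by simp
  next
    case False
    thus ?thesis using multilinearD[OF assms(2)] by simp
  qed
qed

lemma multilinear_split3:
  assumes "\<And>ys zs. multilinear s s' (\<lambda>xs. B xs ys zs)" "\<And>xs zs. multilinear s s' (\<lambda>ys. B xs ys zs)"
    and "\<And>xs ys. multilinear s s' (\<lambda>zs. B xs ys zs)"
  shows "multilinear s s' (\<lambda>ws. B (take i (take j ws)) (drop i (take j ws)) (drop j ws))"
  by (rule multilinear_split[where B = "\<lambda>us zs. B (take i us) (drop i us) zs"])
    (auto intro!: multilinear_split assms)

lemma tlift_add: "tlift g (x + y) = tlift g x + tlift g y"
  by (simp add: tlift_def fun_eq_iff plus_fun_apply)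

lemma tlift_scale: "tlift g (tscale c x) = tscale c (tlift g x)"
  by (simp add: tlift_def tscale_def fun_eq_iff)

lemma tlift_linear: "lin tscale tscale (tlift g)"
  by (simp add: lin_iff vector_space_tscale tlift_add tlift_scale)

lemma tscale_apply_linear: "lin tscale (*) (\<lambda>t. t \<beta>)"
  by (auto simp: lin_iff vector_space_tscale vector_space_mult tscale_def plus_fun_apply)

lemma lin_tscaleI:
  assumes "vector_space s" "\<And>\<beta>. lin s (*) (\<lambda>x. f x \<beta>)"
  shows "lin s tscale f"
  using assms(2) by (auto simp: lin_iff assms(1) vector_space_tscale fun_eq_iff tscale_def plus_fun_apply)

locale tensors = vector_space s for s :: "'k::field \<Rightarrow> 'v::ab_group_add \<Rightarrow> 'v"
begin

lemma multilinear_pure: "multilinear s tscale (pure s)"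
proof (intro multilinearI lin_tscaleI vector_space_axioms)
  fix us ws and \<beta> :: "'v list \<Rightarrow> 'k"
  show "lin s (*) (\<lambda>v. pure s (us @ v # ws) \<beta>)"
  proof (cases "multilinear s (*) \<beta>")
    case True
    thus ?thesis using multilinearD[OF True] by (simp add: pure_def)
  next
    case False
    thus ?thesis using lin_const_zero[OF vector_space_axioms vector_space_mult]
      by (simp add: pure_def)
  qed
qed

lemma tlift_pure: "multilinear s tscale g \<Longrightarrow> tlift g (pure s ws) = g ws"
  using multilinear_compose[OF _ tscale_apply_linear]
  by (fastforce simp: tlift_def pure_def fun_eq_iff)

lemma subspace_alg: "T.subspace (tensor_alg s)"
  unfolding tensor_alg_def by simp

lemma alg_add: "x \<in> tensor_alg s \<Longrightarrow> y \<in> tensor_alg s \<Longrightarrow> x + y \<in> tensor_alg s"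
  using T.subspace_add subspace_alg by blast

lemma alg_scale: "x \<in> tensor_alg s \<Longrightarrow> tscale c x \<in> tensor_alg s"
  using T.subspace_scale subspace_alg by blast

lemma alg_zero: "0 \<in> tensor_alg s"
  using T.subspace_0 subspace_alg by blast

lemma pure_in_alg: "pure s ws \<in> tensor_alg s"
  unfolding tensor_alg_def by (simp add: T.span_base)

lemma alg_induct [consumes 1, case_names zero pure add scale]:
  assumes "x \<in> tensor_alg s" "P 0" "\<And>ws. P (pure s ws)"
    and "\<And>x y. x \<in> tensor_alg s \<Longrightarrow> y \<in> tensor_alg s \<Longrightarrow> P x \<Longrightarrow> P y \<Longrightarrow> P (x + y)"
    and "\<And>c x. x \<in> tensor_alg s \<Longrightarrow> P x \<Longrightarrow> P (tscale c x)"
  shows "P x"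
  using assms(1)[unfolded tensor_alg_def]
proof (induction rule: T.span_linear_induct)
  case (gen x)
  thus ?case using assms(3) by blast
next
  case zero
  show ?case by (rule assms(2))
next
  case (add x y)
  thus ?case using assms(4)[unfolded tensor_alg_def, of x y] by blast
next
  case (scale c x)
  thus ?case using assms(5)[unfolded tensor_alg_def, of x c] by blast
qed

lemma tensor_alg_eqI:
  assumes "linear_on tscale s' (tensor_alg s) f" "linear_on tscale s' (tensor_alg s) g" "vector_space s'"
    and "\<And>ws. f (pure s ws) = g (pure s ws)" "x \<in> tensor_alg s"
  shows "f x = g x"
  by (rule linear_eq_on_span[OF vector_space_tscale assms(3) assms(1,2)[unfolded tensor_alg_def] _
        assms(5)[unfolded tensor_alg_def]]) (use assms(4) in blast)

lemma lin_alg_eqI: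
  assumes "lin tscale s' f" "lin tscale s' g"
    and "\<And>ws. f (pure s ws) = g (pure s ws)" "x \<in> tensor_alg s"
  shows "f x = g x"
  by (rule lin_eq_on_span[OF assms(1,2) _ assms(4)[unfolded tensor_alg_def]]) (use assms(3) in blast)

lemma tmult_add_left: "tmult s (x + x') y = tmult s x y + tmult s x' y"
  by (simp add: tmult_def tlift_add)

lemma tmult_scale_left: "tmult s (tscale c x) y = tscale c (tmult s x y)"
  by (simp add: tmult_def tlift_scale)

lemma tmult_linear_left: "lin tscale tscale (\<lambda>x. tmult s x y)"
  by (simp add: lin_iff vector_space_tscale tmult_add_left tmult_scale_left)

text \<open>Multiplication is the bilinear extension of concatenation; this is the linearity in the left factor,
  the right one being fixed.\<close>

lemma multilinear_prepend:
  assumes "y \<in> tensor_alg s"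
  shows "multilinear s tscale (\<lambda>us. tlift (\<lambda>ws. pure s (us @ ws)) y)"
  using assms
proof (induction rule: alg_induct)
  case zero
  show ?case using multilinear_zero[OF vector_space_axioms vector_space_tscale]
    by (simp add: lin_zero[OF tlift_linear])
next
  case (pure ws)
  show ?case
    by (simp add: tlift_pure multilinear_append_left multilinear_append_right multilinear_pure)
next
  case (add x y)
  thus ?case using multilinear_plus by (simp add: tlift_add)
next
  case (scale c x)
  thus ?case using multilinear_smult[of s tscale _ c] by (simp add: tlift_scale)
qed

lemma tmult_pure_left:
  "y \<in> tensor_alg s \<Longrightarrow> tmult s (pure s us) y = tlift (\<lambda>ws. pure s (us @ ws)) y"
  by (simp add: tmult_def tlift_pure multilinear_prepend)

lemma tmult_pure: "tmult s (pure s us) (pure s ws) = pure s (us @ ws)"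
  by (simp add: tmult_pure_left pure_in_alg tlift_pure multilinear_append_left multilinear_pure)

lemma tmult_add_right:
  assumes "x \<in> tensor_alg s" "y \<in> tensor_alg s" "y' \<in> tensor_alg s"
  shows "tmult s x (y + y') = tmult s x y + tmult s x y'"
  by (rule lin_alg_eqI[OF tmult_linear_left lin_plus[OF tmult_linear_left tmult_linear_left] _ assms(1)])
    (simp add: tmult_pure_left assms alg_add tlift_add)

lemma tmult_scale_right:
  assumes "x \<in> tensor_alg s" "y \<in> tensor_alg s"
  shows "tmult s x (tscale c y) = tscale c (tmult s x y)"
  by (rule lin_alg_eqI[OF tmult_linear_left lin_smult[OF tmult_linear_left] _ assms(1)])
    (simp add: tmult_pure_left assms alg_scale tlift_scale)

lemma tmult_linear_right: "x \<in> tensor_alg s \<Longrightarrow> linear_on tscale tscale (tensor_alg s) (tmult s x)"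
  by (simp add: linear_on_def tmult_add_right tmult_scale_right)

lemma tmult_zero_left: "tmult s 0 y = 0"
  by (rule lin_zero[OF tmult_linear_left])

lemma tmult_zero_right: "x \<in> tensor_alg s \<Longrightarrow> tmult s x 0 = 0"
  by (rule linear_on_zero[OF vector_space_tscale vector_space_tscale tmult_linear_right alg_zero])

lemma tmult_in_alg:
  assumes "x \<in> tensor_alg s" "y \<in> tensor_alg s" shows "tmult s x y \<in> tensor_alg s"
  using assms(1)
proof (induction rule: alg_induct)
  case (pure us)
  show ?case using assms(2)
    by (induction rule: alg_induct)
      (auto simp: tmult_pure tmult_add_right tmult_scale_right pure_in_alg
        tmult_zero_right alg_add alg_scale alg_zero)
qed (auto simp: tmult_zero_left tmult_add_left tmult_scale_left alg_add alg_scale alg_zero)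

lemma tmult_assoc:
  assumes "x \<in> tensor_alg s" "y \<in> tensor_alg s" "z \<in> tensor_alg s"
  shows "tmult s (tmult s x y) z = tmult s x (tmult s y z)"
  using assms(1)
proof (induction rule: alg_induct)
  case (pure us)
  show ?case using assms(2)
  proof (induction rule: alg_induct)
    case (pure vs)
    show ?case using assms(3)
      by (induction rule: alg_induct)
        (auto simp: tmult_pure tmult_add_right tmult_scale_right pure_in_alg
          tmult_zero_right tmult_in_alg)
  qed (auto simp: tmult_add_right tmult_scale_right pure_in_alg tmult_zero_left
          tmult_zero_right tmult_in_alg tmult_add_left tmult_scale_left assms)
qed (auto simp: tmult_zero_left tmult_add_left tmult_scale_left)

lemma tmult_unit_left: "x \<in> tensor_alg s \<Longrightarrow> tmult s (pure s []) x = x"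
  by (induction rule: alg_induct)
    (auto simp: tmult_pure tmult_zero_right tmult_add_right tmult_scale_right pure_in_alg)

lemma tmult_unit_right: "x \<in> tensor_alg s \<Longrightarrow> tmult s x (pure s []) = x"
  by (induction rule: alg_induct)
    (auto simp: tmult_pure tmult_zero_left tmult_add_left tmult_scale_left pure_in_alg)

lemma pure_Cons: "pure s (w # ws) = tmult s (pure s [w]) (pure s ws)"
  by (simp add: tmult_pure)

lemma pure_singleton_add: "pure s [v + w] = pure s [v] + pure s [w]"
  using lin_add[OF multilinearD[OF multilinear_pure, of "[]" "[]"]] by simp

lemma pure_singleton_scale: "pure s [s c v] = tscale c (pure s [v])"
  using lin_scale[OF multilinearD[OF multilinear_pure, of "[]" "[]"]] by simp

lemma pure_singleton_linear: "lin s tscale (\<lambda>v. pure s [v])"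
  using multilinearD[OF multilinear_pure, of "[]" "[]"] by simp

lemma pure_singleton_zero: "pure s [0] = 0"
  using lin_zero[OF pure_singleton_linear] .

text \<open>Composition with a projection onto \<open>U\<close> turns a map that is multilinear on \<open>U\<close> into one that is
  multilinear everywhere, to which the universal property applies.\<close>

lemma multilinear_on_lift:
  assumes s': "vector_space s'" and U: "subspace U"
    and g: "\<And>us ws. length us + Suc (length ws) = n \<Longrightarrow> set us \<subseteq> U \<Longrightarrow> set ws \<subseteq> U \<Longrightarrow>
      linear_on s s' U (\<lambda>v. g (us @ v # ws))"
  shows "\<exists>L. lin tscale s' L \<and>
    (\<forall>ws. length ws = n \<longrightarrow> set ws \<subseteq> U \<longrightarrow> L (pure s ws) = g ws)"
proof -
  obtain e where e: "lin s s e" "\<And>x. x \<in> U \<Longrightarrow> e x = x" "\<And>x. e x \<in> U"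
    using subspace_projection[OF vector_space_axioms U] by blast
  define g' where "g' = (\<lambda>ws. if length ws = n then g (map e ws) else 0)"
  have "multilinear s s' g'"
  proof (rule multilinearI)
    fix us ws
    show "lin s s' (\<lambda>v. g' (us @ v # ws))"
    proof (cases "length us + Suc (length ws) = n")
      case True
      hence "linear_on s s' U (\<lambda>v. g (map e us @ v # map e ws))"
        by (intro g) (use e in auto)
      hence "lin s s' (\<lambda>v. g (map e us @ e v # map e ws))"
        using e(1,3) s' vector_space_axioms by (simp add: lin_iff linear_on_def)
      thus ?thesis using True by (simp add: g'_def)
    next
      case False
      thus ?thesis
        using lin_const_zero[OF vector_space_axioms s'] by (simp add: g'_def)
    qed
  qed
  then obtain L where "lin tscale s' L" "\<And>ws. L (pure s ws) = g' ws"
    using tensor_alg_universal[OF s', of s g'] by blast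
  moreover have "g' ws = g ws" if "length ws = n" "set ws \<subseteq> U" for ws
  proof -
    have "map e ws = ws" using that(2) e(2) by (intro map_idI) auto
    thus ?thesis using that(1) by (simp add: g'_def)
  qed
  ultimately show ?thesis by (intro exI[of _ L]) simp
qed

lemma bilinear_on_lift:
  assumes s': "vector_space s'" and U: "subspace U"
    and "\<And>b. b \<in> U \<Longrightarrow> linear_on s s' U (\<lambda>a. h a b)" "\<And>a. a \<in> U \<Longrightarrow> linear_on s s' U (\<lambda>b. h a b)"
  obtains L where "lin tscale s' L"
    "\<And>a b. a \<in> U \<Longrightarrow> b \<in> U \<Longrightarrow> L (pure s [a, b]) = h a b"
proof -
  have "linear_on s s' U (\<lambda>v. h ((us @ v # ws) ! 0) ((us @ v # ws) ! 1))"
    if *: "length us + Suc (length ws) = 2" "set us \<subseteq> U" "set ws \<subseteq> U" for us ws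
  proof (cases us)
    case Nil
    then obtain b where "ws = [b]" using *(1) Nil by (auto simp: length_Suc_conv numeral_2_eq_2)
    thus ?thesis using Nil assms(3)[of b] * by simp
  next
    case (Cons a us')
    thus ?thesis using assms(4)[of a] * by simp
  qed
  then obtain L where L: "lin tscale s' L"
    "\<And>ws. length ws = 2 \<Longrightarrow> set ws \<subseteq> U \<Longrightarrow> L (pure s ws) = h (ws ! 0) (ws ! 1)"
    using multilinear_on_lift[OF s' U, where n = 2 and g = "\<lambda>ws. h (ws ! 0) (ws ! 1)"] by blast
  have "L (pure s [a, b]) = h a b" if "a \<in> U" "b \<in> U" for a b
    using L(2)[of "[a, b]"] that by simp
  with L(1) show ?thesis using that by blast
qed

lemma trilinear_on_lift:
  assumes s': "vector_space s'" and U: "subspace U"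
    and "\<And>b c. b \<in> U \<Longrightarrow> c \<in> U \<Longrightarrow> linear_on s s' U (\<lambda>a. h a b c)"
      "\<And>a c. a \<in> U \<Longrightarrow> c \<in> U \<Longrightarrow> linear_on s s' U (\<lambda>b. h a b c)"
      "\<And>a b. a \<in> U \<Longrightarrow> b \<in> U \<Longrightarrow> linear_on s s' U (\<lambda>c. h a b c)"
  obtains L where "lin tscale s' L"
    "\<And>a b c. a \<in> U \<Longrightarrow> b \<in> U \<Longrightarrow> c \<in> U \<Longrightarrow> L (pure s [a, b, c]) = h a b c"
proof -
  have "linear_on s s' U (\<lambda>v. h ((us @ v # ws) ! 0) ((us @ v # ws) ! 1) ((us @ v # ws) ! 2))"
    if *: "length us + Suc (length ws) = 3" "set us \<subseteq> U" "set ws \<subseteq> U" for us ws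
  proof -
    have "length us = 0 \<or> length us = 1 \<or> length us = 2" using *(1) by arith
    then consider b c where "us = []" "ws = [b, c]" | a c where "us = [a]" "ws = [c]"
      | a b where "us = [a, b]" "ws = []"
      using *(1) by (auto simp: length_Suc_conv numeral_2_eq_2 numeral_3_eq_3)
    thus ?thesis
    proof cases
      case 1
      thus ?thesis using assms(3)[of b c] *(2,3) by simp
    next
      case 2
      thus ?thesis using assms(4)[of a c] *(2,3) by simp
    next
      case 3
      thus ?thesis using assms(5)[of a b] *(2,3) by simp
    qed
  qed
  then obtain L where L: "lin tscale s' L"
    "\<And>ws. length ws = 3 \<Longrightarrow> set ws \<subseteq> U \<Longrightarrow> L (pure s ws) = h (ws ! 0) (ws ! 1) (ws ! 2)"
    using multilinear_on_lift[OF s' U, where n = 3 and g = "\<lambda>ws. h (ws ! 0) (ws ! 1) (ws ! 2)"] by blast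
  have "L (pure s [a, b, c]) = h a b c" if "a \<in> U" "b \<in> U" "c \<in> U" for a b c
    using L(2)[of "[a, b, c]"] that by simp
  with L(1) show ?thesis using that by blast
qed

text \<open>Words with letters in a graded subspace are sums of homogeneous words, so they see the value of
  \<^const>\<open>homog_ext\<close>.\<close>

definition homogeneous_span where
  "homogeneous_span G n = T.span {pure s ws | ws es. length ws = n \<and> homogeneous_word G es ws}"

lemma pure_in_homogeneous_span:
  assumes "set ws \<subseteq> span (\<Union>i. G i)"
  shows "pure s ws \<in> homogeneous_span G (length ws)"
proof -
  have "pure s (us @ ws) \<in> homogeneous_span G (length us + length ws)"
    if "homogeneous_word G es us" "set ws \<subseteq> span (\<Union>i. G i)" for es us ws
    using that
  proof (induction ws arbitrary: us es)
    case Nil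
    thus ?case unfolding homogeneous_span_def by (intro T.span_base) auto
  next
    case (Cons w ws)
    have "w \<in> span (\<Union>i. G i)" using Cons.prems by simp
    moreover have "pure s (us @ w # ws) \<in> homogeneous_span G (length us + length (w # ws))"
      if "w \<in> (\<Union>i. G i)" for w
    proof -
      from that obtain i where "w \<in> G i" by (rule UN_E)
      hence "homogeneous_word G (es @ [i]) (us @ [w])"
        using Cons.prems by (simp add: homogeneous_word_def list_all2_appendI)
      from Cons.IH[OF this] show ?thesis using Cons.prems by simp
    qed
    moreover have "T.subspace (homogeneous_span G (length us + length (w # ws)))"
      by (simp add: homogeneous_span_def)
    ultimately show ?case
      using lin_span_image[OF multilinearD[OF multilinear_pure], of "\<Union>i. G i" us ws _ w]
      by (metis (no_types, lifting) length_Cons)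
  qed
  from this[of "[]" "[]"] assms show ?thesis by (simp add: homogeneous_word_def)
qed

lemma homog_ext_eq:
  assumes L: "lin tscale s' L"
    and "\<And>es ws. length ws = n \<Longrightarrow> homogeneous_word G es ws \<Longrightarrow> L (pure s ws) = B es ws"
    and x: "x \<in> homogeneous_span G n"
  shows "homog_ext s G n s' B x = L x"
proof -
  let ?P = "\<lambda>L. lin tscale s' L \<and>
    (\<forall>es ws. length ws = n \<longrightarrow> homogeneous_word G es ws \<longrightarrow> L (pure s ws) = B es ws)"
  have "?P (homog_ext s G n s' B)" unfolding homog_ext_def
    by (rule someI[of ?P L]) (use assms(1,2) in blast)
  hence h: "lin tscale s' (homog_ext s G n s' B)"
    "\<And>es ws. length ws = n \<Longrightarrow> homogeneous_word G es ws \<Longrightarrow> homog_ext s G n s' B (pure s ws) = B es ws"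
    by blast+
  show ?thesis
    by (rule lin_eq_on_span[OF h(1) L _ x[unfolded homogeneous_span_def]]) (use h(2) assms(2) in force)
qed

lemma homog_ext_linear:
  assumes L: "lin tscale s' L"
    and "\<And>es ws. length ws = n \<Longrightarrow> homogeneous_word G es ws \<Longrightarrow> L (pure s ws) = B es ws"
  shows "lin tscale s' (homog_ext s G n s' B)"
proof -
  let ?P = "\<lambda>L. lin tscale s' L \<and>
    (\<forall>es ws. length ws = n \<longrightarrow> homogeneous_word G es ws \<longrightarrow> L (pure s ws) = B es ws)"
  have "?P (homog_ext s G n s' B)" unfolding homog_ext_def
    by (rule someI[of ?P L]) (use assms(1,2) in blast)
  thus ?thesis by blast
qed

end

text \<open>The comultiplication has values in the tensor algebra of the vector space of tensors.\<close>

interpretation TT: tensors "tscale :: 'k::field \<Rightarrow> ('v, 'k) tensor \<Rightarrow> ('v, 'k) tensor"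
  by unfold_locales


section \<open>Gradings as eigenspace decompositions\<close>

text \<open>Eigenvectors for distinct eigenvalues can be separated inside any stable subspace \<open>U\<close>. For
  \<open>U = {0}\<close> this says that eigenspaces are independent.\<close>

lemma eigenvectors_in_stable_subspace:
  assumes vs: "vector_space s" and A: "lin s s A"
    and U: "module.subspace s U" "\<And>x. x \<in> U \<Longrightarrow> A x \<in> U"
    and "finite I" "inj_on \<mu> I" "\<And>i. i \<in> I \<Longrightarrow> A (f i) = s (\<mu> i) (f i)" "sum f I \<in> U"
  shows "\<forall>i\<in>I. f i \<in> U"
proof -
  interpret S: vector_space s by (rule vs)
  show ?thesis using assms(5-8)
  proof (induction I arbitrary: f rule: finite_induct)
    case (insert j I)
    (* Applying A - \<mu> j removes the j-th term and multiplies the others by \<mu> i - \<mu> j. *)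
    let ?g = "\<lambda>i. s (\<mu> i - \<mu> j) (f i)"
    have "sum ?g I = A (sum f (insert j I)) - s (\<mu> j) (sum f (insert j I))"
      using insert.hyps insert.prems(2)
      by (simp add: lin_sum[OF A] lin_add[OF A] S.scale_left_diff_distrib sum_subtractf
          S.scale_sum_right S.scale_right_distrib)
    also have "\<dots> \<in> U"
      using insert.prems(3) U by (simp add: S.subspace_diff S.subspace_scale)
    finally have "\<forall>i\<in>I. ?g i \<in> U"
      using insert.prems by (intro insert.IH) (auto simp: lin_scale[OF A] mult.commute)
    have *: "f i \<in> U" if "i \<in> I" for i
    proof -
      have "s (inverse (\<mu> i - \<mu> j)) (?g i) \<in> U"
        using \<open>\<forall>i\<in>I. ?g i \<in> U\<close> that U(1) by (simp only: S.subspace_scale)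
      moreover have "\<mu> i \<noteq> \<mu> j" using insert.prems(1) insert.hyps that by (auto simp: inj_on_def)
      ultimately show ?thesis by simp
    qed
    have "sum f I \<in> U" using * U(1) by (simp add: S.subspace_sum)
    hence "sum f (insert j I) - sum f I \<in> U"
      using insert.prems(3) U(1) S.subspace_diff by blast
    with * insert.hyps show ?case by simp
  qed simp
qed

lemma (in vector_space) span_Union_decomposition:
  assumes "x \<in> span (\<Union>i. G i)" "\<And>i. subspace (G i)"
  shows "\<exists>I f. finite I \<and> (\<forall>i. f i \<in> G i) \<and> (\<forall>i. i \<notin> I \<longrightarrow> f i = 0) \<and> x = sum f I"
  using assms(1)
proof (induction rule: span_linear_induct)
  case zero
  show ?case by (rule exI[of _ "{}"], rule exI[of _ "\<lambda>_. 0"]) (simp add: assms(2) subspace_0)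
next
  case (gen x)
  then obtain j where "x \<in> G j" by auto
  thus ?case
    by (intro exI[of _ "{j}"] exI[of _ "\<lambda>i. if i = j then x else 0"]) (simp add: assms(2) subspace_0)
next
  case (add x y)
  then obtain I f J g where *: "finite I" "\<forall>i. f i \<in> G i" "\<forall>i. i \<notin> I \<longrightarrow> f i = 0" "x = sum f I"
    "finite J" "\<forall>i. g i \<in> G i" "\<forall>i. i \<notin> J \<longrightarrow> g i = 0" "y = sum g J" by blast
  have "x = sum f (I \<union> J)" "y = sum g (I \<union> J)"
    unfolding * by (rule sum.mono_neutral_left; use * in auto)+
  thus ?case using *
    by (intro exI[of _ "I \<union> J"] exI[of _ "\<lambda>i. f i + g i"])
      (auto simp: assms(2) subspace_add sum.distrib)
next
  case (scale c x)
  then obtain I f where *: "finite I" "\<forall>i. f i \<in> G i" "\<forall>i. i \<notin> I \<longrightarrow> f i = 0" "x = sum f I" by blast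
  thus ?case
    by (intro exI[of _ I] exI[of _ "\<lambda>i. scale c (f i)"])
      (auto simp: assms(2) subspace_scale scale_sum_right)
qed

text \<open>Every vector has a unique finite decomposition into homogeneous components, and the operator
  multiplies the component of degree \<open>i\<close> by \<open>\<mu> i\<close>.\<close>

lemma grading_operator_exists:
  assumes vs: "vector_space s" and G: "is_grading s UNIV G"
  shows "\<exists>a. lin s s a \<and> (\<forall>i. \<forall>v\<in>G i. a v = s (\<mu> i) v)"
proof -
  interpret S: vector_space s by (rule vs)
  let ?D = "\<lambda>f x I. finite I \<and> (\<forall>i. f i \<in> G i) \<and> (\<forall>i. i \<notin> I \<longrightarrow> f i = 0) \<and> x = sum f I"
  have sub: "S.subspace (G i)" for i using G by (simp add: is_grading_def)
  have direct: "\<forall>i\<in>I. f i = 0" if "finite I" "\<forall>i\<in>I. f i \<in> G i" "sum f I = 0" for I f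
    using G that unfolding is_grading_def by blast
  have ex: "\<exists>f I. ?D f x I" for x
  proof -
    have "x \<in> S.span (\<Union>i. G i)" using G by (auto simp: is_grading_def)
    from S.span_Union_decomposition[OF this sub] show ?thesis by blast
  qed
  have uniq: "f = g" if f: "?D f x I" and g: "?D g x J" for f g x I J
  proof
    fix i
    let ?K = "insert i (I \<union> J)"
    have "sum f I = sum f ?K" "sum g J = sum g ?K"
      by (rule sum.mono_neutral_left; use f g in auto)+
    hence "(\<Sum>k\<in>?K. f k - g k) = 0" using f g by (simp only: sum_subtractf) simp
    moreover have "\<forall>k\<in>?K. f k - g k \<in> G k" using f g sub S.subspace_diff by blast
    ultimately have "f i - g i = 0" using direct[of ?K "\<lambda>k. f k - g k"] f g by blast
    thus "f i = g i" by simp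
  qed
  define D where "D = (\<lambda>x. SOME f. \<exists>I. ?D f x I)"
  have D: "\<exists>I. ?D (D x) x I" for x unfolding D_def by (rule someI_ex[OF ex])
  have D_eq: "D x = f" if "?D f x I" for x f I using D that uniq by blast
  define a where "a = (\<lambda>x. \<Sum>i | D x i \<noteq> 0. s (\<mu> i) (D x i))"
  have a_eq: "a x = (\<Sum>i\<in>I. s (\<mu> i) (f i))" if "?D f x I" for x f I
    unfolding a_def D_eq[OF that] by (rule sum.mono_neutral_left) (use that in auto)
  have "a (x + y) = a x + a y" for x y
  proof -
    obtain I J where *: "?D (D x) x I" "?D (D y) y J"
      using D[of x] D[of y] by blast
    let ?K = "I \<union> J"
    have "sum (D x) I = sum (D x) ?K" "sum (D y) J = sum (D y) ?K"
      by (rule sum.mono_neutral_left; use * in auto)+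
    with * have **: "?D (D x) x ?K" "?D (D y) y ?K" by auto
    have "?D (\<lambda>i. D x i + D y i) (x + y) ?K"
      using ** by (auto simp: sub S.subspace_add sum.distrib)
    from a_eq[OF this] a_eq[OF **(1)] a_eq[OF **(2)]
    show ?thesis by (simp add: S.scale_right_distrib sum.distrib)
  qed
  moreover have "a (s c x) = s c (a x)" for c x
  proof -
    obtain I where *: "?D (D x) x I" using D[of x] by blast
    have "s c x = (\<Sum>i\<in>I. s c (D x i))" using * S.scale_sum_right[of c "D x" I] by metis
    hence "?D (\<lambda>i. s c (D x i)) (s c x) I"
      using * by (simp add: sub S.subspace_scale)
    from a_eq[OF this] a_eq[OF *] show ?thesis by (simp add: S.scale_sum_right mult.commute)
  qed
  moreover have "a v = s (\<mu> i) v" if "v \<in> G i" for v i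
  proof -
    have "?D (\<lambda>j. if j = i then v else 0) v {i}" using that by (simp add: sub S.subspace_0)
    from a_eq[OF this] show ?thesis by simp
  qed
  ultimately show ?thesis using vs
    by (intro exI[of _ a]) (simp add: lin_iff)
qed

lemma inj_two_powi: "inj (\<lambda>i::int. (2::'k::field_char_0) powi i)"
proof -
  have pos: "n = 0" if "(2::'k) ^ n = 1" for n :: nat
  proof -
    have "of_nat (2 ^ n) = (of_nat 1 :: 'k)" using that by simp
    hence "(2::nat) ^ n = 1" by (simp only: of_nat_eq_iff)
    thus ?thesis by simp
  qed
  have le: "i = j" if *: "i \<le> j" "(2::'k) powi i = 2 powi j" for i j :: int
  proof -
    obtain n where n: "j = i + int n" using *(1) zle_iff_zadd by blast
    have "(2::'k) powi (i + int n) = 2 powi i * 2 powi (int n)" by (rule power_int_add) simp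
    hence "(2::'k) powi i = 2 powi i * 2 ^ n" using that(2) n by (simp only: power_int_of_nat)
    hence "(2::'k) ^ n = 1" by (metis mult_cancel_left1 power_int_eq_0_iff zero_neq_numeral)
    hence "n = 0" by (rule pos)
    thus ?thesis using n by simp
  qed
  show ?thesis
  proof (rule injI)
    fix i j :: int assume "(2::'k) powi i = 2 powi j"
    thus "i = j" by (metis le linear)
  qed
qed


section \<open>Induced operators and weights\<close>

context tensors
begin

lemma subspace_power: "T.subspace (tensor_power s n)"
  by (simp add: tensor_power_def)

lemma pure_in_power: "pure s ws \<in> tensor_power s (length ws)"
  unfolding tensor_power_def by (rule T.span_base) auto

lemma pure_in_power': "length ws = n \<Longrightarrow> pure s ws \<in> tensor_power s n"
  using pure_in_power by blast

lemma power_induct [consumes 1, case_names zero pure add scale]: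
  assumes "x \<in> tensor_power s n" "P 0" "\<And>ws. length ws = n \<Longrightarrow> P (pure s ws)"
    and "\<And>x y. x \<in> tensor_power s n \<Longrightarrow> y \<in> tensor_power s n \<Longrightarrow> P x \<Longrightarrow> P y \<Longrightarrow> P (x + y)"
    and "\<And>c x. x \<in> tensor_power s n \<Longrightarrow> P x \<Longrightarrow> P (tscale c x)"
  shows "P x"
  using assms(1)[unfolded tensor_power_def]
proof (induction rule: T.span_linear_induct)
  case (gen x)
  thus ?case using assms(3) by blast
next
  case zero
  show ?case by (rule assms(2))
next
  case (add x y)
  thus ?case using assms(4)[unfolded tensor_power_def, of x y] by blast
next
  case (scale c x)
  thus ?case using assms(5)[unfolded tensor_power_def, of x c] by blast
qed

lemma power_subset: "tensor_power s n \<subseteq> tensor_alg s"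
  unfolding tensor_power_def tensor_alg_def by (rule T.span_mono) auto

lemma power_in_alg: "x \<in> tensor_power s n \<Longrightarrow> x \<in> tensor_alg s"
  using power_subset by blast

lemma lin_power_eqI:
  assumes "lin tscale s' f" "lin tscale s' g"
    and "\<And>ws. length ws = n \<Longrightarrow> f (pure s ws) = g (pure s ws)" "x \<in> tensor_power s n"
  shows "f x = g x"
  by (rule lin_eq_on_span[OF assms(1,2) _ assms(4)[unfolded tensor_power_def]]) (use assms(3) in blast)

lemma lin_power_image:
  assumes "lin tscale s' f" "\<And>ws. length ws = n \<Longrightarrow> f (pure s ws) \<in> U"
    "module.subspace s' U" "x \<in> tensor_power s n"
  shows "f x \<in> U"
  by (rule lin_span_image[OF assms(1) _ assms(3) assms(4)[unfolded tensor_power_def]])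
    (use assms(2) in blast)

lemma tmult_in_power:
  assumes "x \<in> tensor_power s m" "y \<in> tensor_power s n"
  shows "tmult s x y \<in> tensor_power s (m + n)"
proof (rule lin_power_image[OF tmult_linear_left _ subspace_power assms(1)])
  fix us :: "'v list" assume us: "length us = m"
  have "linear_on tscale tscale (tensor_power s n) (tmult s (pure s us))"
    by (rule linear_on_subset[OF tmult_linear_right power_subset]) (rule pure_in_alg)
  thus "tmult s (pure s us) y \<in> tensor_power s (m + n)"
    unfolding tensor_power_def[of s n]
    by (rule linear_on_span_image[OF vector_space_tscale vector_space_tscale _ _ subspace_power
          assms(2)[unfolded tensor_power_def]])
      (use us in \<open>auto simp: tmult_pure intro!: pure_in_power'\<close>)
qed

lemma power_one: "x \<in> tensor_power s 1 \<longleftrightarrow> (\<exists>v. x = pure s [v])"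
proof
  assume "x \<in> tensor_power s 1"
  thus "\<exists>v. x = pure s [v]"
  proof (induction rule: power_induct)
    case zero
    show ?case by (rule exI[of _ 0]) (simp add: pure_singleton_zero)
  next
    case (pure ws)
    thus ?case by (auto simp: length_Suc_conv)
  next
    case (add x y)
    thus ?case by (metis pure_singleton_add)
  next
    case (scale c x)
    thus ?case by (metis pure_singleton_scale)
  qed
qed (auto intro: pure_in_power')

lemma power_zero: "x \<in> tensor_power s 0 \<longleftrightarrow> (\<exists>c. x = tscale c (pure s []))"
  by (simp add: tensor_power_def T.span_singleton image_iff)

lemma multilinear_if_length: "multilinear s tscale (\<lambda>ws. if length ws = n then pure s ws else 0)"
proof (rule multilinear_length[of s tscale "\<lambda>m ws. if m = n then pure s ws else 0"])
  show "multilinear s tscale (\<lambda>ws. if m = n then pure s ws else 0)" for m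
    using multilinear_pure multilinear_zero[OF vector_space_axioms vector_space_tscale]
    by (cases "m = n") simp_all
qed

lemma tproj_pure: "tproj s n (pure s ws) = (if length ws = n then pure s ws else 0)"
  unfolding tproj_def by (simp add: tlift_pure multilinear_if_length)

lemma tproj_linear: "lin tscale tscale (tproj s n)"
  unfolding tproj_def by (rule tlift_linear)

lemma tproj_power: "x \<in> tensor_power s m \<Longrightarrow> tproj s n x = (if m = n then x else 0)"
  by (induction rule: power_induct)
    (auto simp: tproj_pure lin_zero[OF tproj_linear] lin_add[OF tproj_linear] lin_scale[OF tproj_linear])

lemma tproj_in_power: "x \<in> tensor_alg s \<Longrightarrow> tproj s n x \<in> tensor_power s n"
  by (induction rule: alg_induct)
    (auto simp: tproj_pure lin_zero[OF tproj_linear] lin_add[OF tproj_linear] lin_scale[OF tproj_linear]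
      T.subspace_0 T.subspace_add T.subspace_scale subspace_power pure_in_power)

definition tmap :: "('v \<Rightarrow> 'v) \<Rightarrow> ('v, 'k) tensor \<Rightarrow> ('v, 'k) tensor"
  where "tmap a = tlift (\<lambda>ws. pure s (map a ws))"

lemma tmap_linear: "lin tscale tscale (tmap a)"
  unfolding tmap_def by (rule tlift_linear)

lemma tmap_pure: "lin s s a \<Longrightarrow> tmap a (pure s ws) = pure s (map a ws)"
  unfolding tmap_def by (rule tlift_pure[OF multilinear_map[OF multilinear_pure]])

lemma tmap_in_power:
  "lin s s a \<Longrightarrow> x \<in> tensor_power s n \<Longrightarrow> tmap a x \<in> tensor_power s n"
  by (rule lin_power_image[OF tmap_linear])
    (auto simp: tmap_pure subspace_power intro: pure_in_power')

lemma tmap_in_alg: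
  "lin s s a \<Longrightarrow> x \<in> tensor_alg s \<Longrightarrow> tmap a x \<in> tensor_alg s"
  unfolding tensor_alg_def
  by (rule lin_span_image[OF tmap_linear])
    (auto simp: tmap_pure intro: T.span_base)

lemma tmap_tmult:
  assumes a: "lin s s a" and "x \<in> tensor_alg s" "y \<in> tensor_alg s"
  shows "tmap a (tmult s x y) = tmult s (tmap a x) (tmap a y)"
  using assms(2)
proof (induction rule: alg_induct)
  case (pure us)
  show ?case using assms(3)
    by (induction rule: alg_induct)
      (simp_all add: tmap_pure a tmult_pure tmult_zero_right pure_in_alg lin_zero[OF tmap_linear]
        lin_add[OF tmap_linear] lin_scale[OF tmap_linear] tmult_add_right tmult_scale_right tmap_in_alg)
qed (simp_all add: lin_zero[OF tmap_linear] lin_add[OF tmap_linear] lin_scale[OF tmap_linear]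
      tmult_zero_left tmult_add_left tmult_scale_left)

lemma pure_map_homogeneous:
  assumes a: "\<And>i v. v \<in> G i \<Longrightarrow> a v = s (\<mu> powi i) v" and "\<mu> \<noteq> 0" "homogeneous_word G es ws"
  shows "pure s (map a ws) = tscale (\<mu> powi sum_list es) (pure s ws)"
  using assms(3) unfolding homogeneous_word_def
proof (induction rule: list_all2_induct)
  case (Cons e es w ws)
  have "pure s (map a (w # ws)) = tmult s (pure s [a w]) (pure s (map a ws))"
    by (simp add: tmult_pure)
  also have "\<dots> = tscale (\<mu> powi e * \<mu> powi sum_list es) (pure s (w # ws))"
    using Cons by (simp add: a pure_singleton_scale tmult_scale_left tmult_scale_right
        pure_in_alg pure_Cons[of w ws])
  finally show ?case using assms(2) by (simp add: power_int_add)
qed simp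

lemma subspace_tpower_grade: "T.subspace (tpower_grade s G n i)"
  by (simp add: tpower_grade_def)

lemma tmap_tpower_grade:
  assumes a: "lin s s a" "\<And>i v. v \<in> G i \<Longrightarrow> a v = s (\<mu> powi i) v"
    and "\<mu> \<noteq> 0" "x \<in> tpower_grade s G n i"
  shows "tmap a x = tscale (\<mu> powi i) x"
  by (rule lin_eq_on_span[OF tmap_linear lin_smult[OF lin_id] _ assms(4)[unfolded tpower_grade_def]])
    (auto simp: tmap_pure a pure_map_homogeneous[OF a(2)] assms(3))

lemma homogeneous_span_eq: "homogeneous_span G n = T.span (\<Union>i. tpower_grade s G n i)"
proof
  show "homogeneous_span G n \<subseteq> T.span (\<Union>i. tpower_grade s G n i)"
    unfolding homogeneous_span_def
    by (rule T.span_mono) (auto simp: tpower_grade_def intro!: T.span_base)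
  have "tpower_grade s G n i \<subseteq> homogeneous_span G n" for i
    unfolding homogeneous_span_def tpower_grade_def by (rule T.span_mono) auto
  thus "T.span (\<Union>i. tpower_grade s G n i) \<subseteq> homogeneous_span G n"
    by (intro T.span_minimal) (auto simp: homogeneous_span_def)
qed

text \<open>The components \<open>f i\<close> of \<open>x\<close> satisfy \<open>A (f i) = \<mu> i \<cdot> f i\<close>. Subtracting \<open>x\<close> from the \<open>j\<close>-th one gives a
  vanishing sum of eigenvectors for distinct eigenvalues.\<close>

lemma eigen_imp_graded:
  assumes A: "lin tscale tscale A" and H: "\<And>i. T.subspace (H i)"
    and AH: "\<And>i y. y \<in> H i \<Longrightarrow> A y = tscale (\<mu> i) y" and "inj \<mu>"
    and x: "x \<in> T.span (\<Union>i. H i)" "A x = tscale (\<mu> j) x"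
  shows "x \<in> H j"
proof -
  obtain I f where *: "finite I" "\<forall>i. f i \<in> H i" "\<forall>i. i \<notin> I \<longrightarrow> f i = 0" "x = sum f I"
    using T.span_Union_decomposition[OF x(1) H] by blast
  let ?g = "\<lambda>i. f i - (if i = j then x else 0)" and ?I = "insert j I"
  have "x = sum f ?I" using * by (auto intro: sum.mono_neutral_left)
  hence "sum ?g ?I \<in> {0}" using *(1) by (simp only: sum_subtractf) (simp add: sum.delta)
  have "\<forall>i\<in>?I. ?g i \<in> {0}"
    by (rule eigenvectors_in_stable_subspace[OF vector_space_tscale A _ _ _ _ _ \<open>sum ?g ?I \<in> {0}\<close>, of \<mu>])
      (use * assms(4) x(2) in \<open>auto simp: lin_zero[OF A] lin_diff[OF A] AH inj_on_def inj_def T.scale_right_diff_distrib\<close>)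
  hence "f j = x" by simp
  thus ?thesis using * by metis
qed

end

text \<open>In characteristic zero the powers of 2 are distinct, so the algebra endomorphism multiplying degree
  \<open>i\<close> by \<open>2\<^sup>i\<close> has the homogeneous parts as its eigenspaces.\<close>

lemma (in tensors) tmap_eigen_tpower_grade:
  fixes H :: "int \<Rightarrow> 'v set"
  assumes a: "lin s s a" "\<And>i v. v \<in> H i \<Longrightarrow> a v = s (2 powi i) v"
    and "inj (\<lambda>i::int. (2::'k) powi i)" "(2::'k) \<noteq> 0"
    and "x \<in> homogeneous_span H n" "tmap a x = tscale (2 powi j) x"
  shows "x \<in> tpower_grade s H n j"
  by (rule eigen_imp_graded[OF tmap_linear subspace_tpower_grade tmap_tpower_grade[OF a assms(4)] assms(3) _ assms(6)])
    (use assms(5) in \<open>auto simp: homogeneous_span_eq\<close>)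

locale graded_space = tensors s for s :: "'k::field_char_0 \<Rightarrow> 'v::ab_group_add \<Rightarrow> 'v" +
  fixes G :: "int \<Rightarrow> 'v set"
  assumes grading: "is_grading s UNIV G"
begin

text \<open>Multiplication by \<open>\<mu>\<^sup>i\<close> in degree \<open>i\<close>: degrees are read off from \<open>\<mu> = 2\<close>, and \<open>\<mu> = -1\<close> is the Koszul
  sign of passing an odd map.\<close>

definition degree_op :: "'k \<Rightarrow> 'v \<Rightarrow> 'v"
  where "degree_op \<mu> = (SOME a. lin s s a \<and> (\<forall>i. \<forall>v\<in>G i. a v = s (\<mu> powi i) v))"

lemma degree_op: "lin s s (degree_op \<mu>)" "v \<in> G i \<Longrightarrow> degree_op \<mu> v = s (\<mu> powi i) v"
  unfolding degree_op_def
  using someI_ex[OF grading_operator_exists[OF vector_space_axioms grading, of "\<lambda>i. \<mu> powi i"]] by blast+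

lemma span_G: "v \<in> span (\<Union>i. G i)"
  using grading by (auto simp: is_grading_def)

lemma degree_op_comp: "\<mu> \<noteq> 0 \<Longrightarrow> \<nu> \<noteq> 0 \<Longrightarrow> degree_op \<mu> (degree_op \<nu> v) = degree_op (\<mu> * \<nu>) v"
  by (rule lin_eq_on_span[OF lin_comp[OF degree_op(1) degree_op(1)] degree_op(1) _ span_G])
    (auto simp: degree_op(2) lin_scale[OF degree_op(1)] power_int_mult_distrib mult.commute)

lemma degree_op_one: "degree_op 1 v = v"
  by (rule lin_eq_on_span[OF degree_op(1) linear_id[unfolded id_def] _ span_G]) (auto simp: degree_op(2))

lemma tmap_tensor_grade:
  assumes "\<mu> \<noteq> 0" "x \<in> tensor_grade s G i"
  shows "tmap (degree_op \<mu>) x = tscale (\<mu> powi i) x"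
  by (rule lin_eq_on_span[OF tmap_linear lin_smult[OF lin_id] _ assms(2)[unfolded tensor_grade_def]])
    (auto intro!: tmap_tpower_grade[OF degree_op assms(1)])

lemma tpower_grade_subset: "tpower_grade s G n i \<subseteq> tensor_power s n"
  unfolding tpower_grade_def tensor_power_def by (rule T.span_mono) auto

lemma tensor_grade_in_alg: "x \<in> tensor_grade s G i \<Longrightarrow> x \<in> tensor_alg s"
  using tpower_grade_subset power_subset subspace_alg
  by (metis (no_types, lifting) T.span_minimal UN_least subset_eq tensor_grade_def)

lemma subspace_tensor_grade: "T.subspace (tensor_grade s G i)"
  by (simp add: tensor_grade_def)

lemma tensor_alg_graded: "x \<in> tensor_alg s \<Longrightarrow> x \<in> T.span (\<Union>i. tensor_grade s G i)"
proof (induction rule: alg_induct)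
  case (pure ws)
  have "pure s ws \<in> homogeneous_span G (length ws)"
    using pure_in_homogeneous_span span_G by blast
  also have "\<dots> \<subseteq> T.span (\<Union>i. tensor_grade s G i)"
    unfolding homogeneous_span_eq
    by (rule T.span_mono) (auto simp: tensor_grade_def intro!: T.span_base)
  finally show ?case .
qed (auto intro: T.span_zero T.span_add T.span_scale)

lemma tensor_grade_iff:
  "x \<in> tensor_grade s G i \<longleftrightarrow> x \<in> tensor_alg s \<and> tmap (degree_op 2) x = tscale (2 powi i) x"
proof
  assume *: "x \<in> tensor_alg s \<and> tmap (degree_op 2) x = tscale (2 powi i) x"
  have eig: "tmap (degree_op 2) y = tscale (2 powi j) y" if "y \<in> tensor_grade s G j" for y j
    using that by (rule tmap_tensor_grade[rotated]) simp
  show "x \<in> tensor_grade s G i"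
    by (rule eigen_imp_graded[where H = "tensor_grade s G", OF tmap_linear subspace_tensor_grade eig inj_two_powi])
      (use * tensor_alg_graded in auto)
qed (auto simp: tmap_tensor_grade tensor_grade_in_alg)

text \<open>A subspace stable under the operator with eigenvalues \<open>2\<^sup>i\<close> contains the homogeneous components of its
  elements.\<close>

lemma stable_subspace_graded:
  assumes "T.subspace U" "U \<subseteq> tensor_alg s" "\<And>x. x \<in> U \<Longrightarrow> tmap (degree_op 2) x \<in> U"
  shows "is_grading tscale U (\<lambda>i. U \<inter> tensor_grade s G i)"
proof -
  have eig: "tmap (degree_op 2) y = tscale (2 powi j) y" if "y \<in> tensor_grade s G j" for y j
    using that by (rule tmap_tensor_grade[rotated]) simp
  have inj: "inj_on (\<lambda>i::int. (2::'k) powi i) I" for I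
    using inj_two_powi by (rule inj_on_subset) simp
  have "x \<in> T.span (\<Union>i. U \<inter> tensor_grade s G i)" if "x \<in> U" for x
  proof -
    have "x \<in> T.span (\<Union>i. tensor_grade s G i)" using tensor_alg_graded that assms(2) by blast
    from T.span_Union_decomposition[where G = "tensor_grade s G", OF this subspace_tensor_grade]
    obtain I f where *: "finite I" "\<forall>i. f i \<in> tensor_grade s G i" "x = sum f I"
      by blast
    have "\<forall>i\<in>I. f i \<in> U"
      by (rule eigenvectors_in_stable_subspace[OF vector_space_tscale tmap_linear assms(1,3) *(1) inj])
        (use * that eig in auto)
    hence "f i \<in> T.span (\<Union>i. U \<inter> tensor_grade s G i)" if "i \<in> I" for i
      using * that by (intro T.span_base) blast
    thus ?thesis unfolding *(3) by (rule T.span_sum)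
  qed
  moreover have "T.span (\<Union>i. U \<inter> tensor_grade s G i) \<subseteq> U"
    by (rule T.span_minimal) (use assms(1) in auto)
  moreover have "\<forall>i\<in>I. f i = 0"
    if *: "finite I" "\<forall>i\<in>I. f i \<in> U \<inter> tensor_grade s G i" "sum f I = 0" for I f
  proof -
    have "\<forall>i\<in>I. f i \<in> {0}"
      by (rule eigenvectors_in_stable_subspace[OF vector_space_tscale tmap_linear T.subspace_single_0 _ *(1) inj])
        (use * eig in \<open>auto simp: lin_zero[OF tmap_linear]\<close>)
    thus ?thesis by simp
  qed
  ultimately show ?thesis unfolding is_grading_def
    using T.subspace_inter[OF assms(1) subspace_tensor_grade] by blast
qed

end


section \<open>Membership in a tensor product through slices\<close>

text \<open>Stated for an arbitrary bilinear map \<open>m\<close>, so that it applies to \<open>a \<otimes> b\<close> both as a function of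
  \<open>(a, b)\<close> and as a function of \<open>(b, a)\<close>.\<close>

lemma bilinear_span_in_basis:
  assumes vs: "vector_space s" and vs': "vector_space s'"
    and m: "\<And>b. lin s s' (\<lambda>a. m a b)" "\<And>a. lin s s' (\<lambda>b. m a b)"
    and B: "\<not> module.dependent s B" "module.span s B = UNIV"
    and x: "x \<in> module.span s' {m a b | a b. True}"
  shows "\<exists>F \<alpha>. finite F \<and> F \<subseteq> B \<and> x = (\<Sum>b\<in>F. m (\<alpha> b) b)"
proof -
  interpret S: vector_space s by (rule vs)
  interpret S': vector_space s' by (rule vs')
  have "\<exists>F \<alpha>. finite F \<and> F \<subseteq> B \<and> (\<forall>b. b \<notin> F \<longrightarrow> \<alpha> b = 0) \<and> x = (\<Sum>b\<in>F. m (\<alpha> b) b)"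
    using x
  proof (induction rule: S'.span_linear_induct)
    case zero
    show ?case by (intro exI[of _ "{}"] exI[of _ "\<lambda>_. 0"]) simp
  next
    case (gen x)
    then obtain a b where ab: "x = m a b" by blast
    let ?F = "{e. S.representation B b e \<noteq> 0}" and ?\<alpha> = "\<lambda>e. s (S.representation B b e) a"
    have "b = (\<Sum>e\<in>?F. s (S.representation B b e) e)"
      using S.sum_nonzero_representation_eq[OF B(1), of b] B(2) by simp
    hence "m a b = (\<Sum>e\<in>?F. m a (s (S.representation B b e) e))"
      using lin_sum[OF m(2)] by metis
    also have "\<dots> = (\<Sum>e\<in>?F. m (?\<alpha> e) e)"
      by (intro sum.cong refl) (simp only: lin_scale[OF m(1)] lin_scale[OF m(2)])
    finally have "x = (\<Sum>e\<in>?F. m (?\<alpha> e) e)" using ab by simp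
    moreover have "finite ?F" by (rule S.finite_representation)
    moreover have "?F \<subseteq> B" using S.representation_ne_zero by blast
    ultimately show ?case by (intro exI[of _ ?F] exI[of _ ?\<alpha>]) simp
  next
    case (add x y)
    then obtain F \<alpha> K \<beta> where *: "finite F" "F \<subseteq> B" "\<forall>b. b \<notin> F \<longrightarrow> \<alpha> b = 0" "x = (\<Sum>b\<in>F. m (\<alpha> b) b)"
      "finite K" "K \<subseteq> B" "\<forall>b. b \<notin> K \<longrightarrow> \<beta> b = 0" "y = (\<Sum>b\<in>K. m (\<beta> b) b)" by blast
    have "x = (\<Sum>b\<in>F \<union> K. m (\<alpha> b) b)" "y = (\<Sum>b\<in>F \<union> K. m (\<beta> b) b)"
      unfolding * by (rule sum.mono_neutral_left; use * lin_zero[OF m(1)] in auto)+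
    hence "x + y = (\<Sum>b\<in>F \<union> K. m (\<alpha> b + \<beta> b) b)"
      by (simp add: lin_add[OF m(1)] sum.distrib)
    thus ?case using * by (intro exI[of _ "F \<union> K"] exI[of _ "\<lambda>b. \<alpha> b + \<beta> b"]) auto
  next
    case (scale c x)
    then obtain F \<alpha> where *: "finite F" "F \<subseteq> B" "\<forall>b. b \<notin> F \<longrightarrow> \<alpha> b = 0" "x = (\<Sum>b\<in>F. m (\<alpha> b) b)"
      by blast
    thus ?case
      by (intro exI[of _ F] exI[of _ "\<lambda>b. s c (\<alpha> b)"]) (auto simp: lin_scale[OF m(1)] S'.scale_sum_right)
  qed
  thus ?thesis by blast
qed

text \<open>With the right factors expanded in a basis, the dual basis functionals recover the left factors as
  slices.\<close>

lemma zero_of_slices: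
  assumes vs: "vector_space s" and vs': "vector_space s'"
    and m: "\<And>b. lin s s' (\<lambda>a. m a b)" "\<And>a. lin s s' (\<lambda>b. m a b)"
    and x: "x \<in> module.span s' {m a b | a b. True}"
    and slice: "\<And>f. lin s (*) f \<Longrightarrow>
      \<exists>L. lin s' s L \<and> (\<forall>a b. L (m a b) = s (f b) a) \<and> L x = 0"
  shows "x = 0"
proof -
  interpret S: vector_space s by (rule vs)
  interpret K: vector_space "(*) :: 'a \<Rightarrow> 'a \<Rightarrow> 'a" by (rule vector_space_mult)
  interpret P: vector_space_pair s "(*) :: 'a \<Rightarrow> 'a \<Rightarrow> 'a" ..
  obtain B where B: "S.independent B" "UNIV \<subseteq> S.span B"
    using S.basis_exists[of UNIV] by metis
  obtain F \<alpha> where F: "finite F" "F \<subseteq> B" "x = (\<Sum>b\<in>F. m (\<alpha> b) b)"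
    using bilinear_span_in_basis[OF vs vs' m B(1) _ x] B(2) by blast
  have "\<alpha> b = 0" if b: "b \<in> F" for b
  proof -
    obtain f where f: "lin s (*) f" "\<forall>e\<in>B. f e = (if e = b then 1 else 0)"
      using P.linear_independent_extend[OF B(1), of "\<lambda>e. if e = b then 1 else 0"] by blast
    obtain L where L: "lin s' s L" "\<And>a b. L (m a b) = s (f b) a" "L x = 0"
      using slice[OF f(1)] by blast
    have "L x = (\<Sum>e\<in>F. s (f e) (\<alpha> e))" unfolding F(3) by (simp add: lin_sum[OF L(1)] L(2))
    also have "\<dots> = (\<Sum>e\<in>F. if e = b then \<alpha> e else 0)"
      by (intro sum.cong refl) (use f(2) F(2) in auto)
    also have "\<dots> = \<alpha> b" using F(1) b by simp
    finally show ?thesis using L(3) by simp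
  qed
  thus ?thesis unfolding F(3) using lin_zero[OF m(1)] by (intro sum.neutral) simp
qed

context tensors
begin

lemma tensor_square_eq: "tensor_power s 2 = T.span {pure s [a, b] | a b. True}"
proof -
  have "{pure s ws | ws. length ws = 2} = {pure s [a, b] | a b. True}"
    by (auto simp: length_Suc_conv numeral_2_eq_2 intro: exI[of _ "[_, _]"])
  thus ?thesis by (simp add: tensor_power_def)
qed

lemma pure2_linear: "lin s tscale (\<lambda>a. pure s [a, b])"
  "lin s tscale (\<lambda>b. pure s [a, b])"
  using multilinearD[OF multilinear_pure, of "[]" "[b]"] multilinearD[OF multilinear_pure, of "[a]" "[]"]
  by simp_all

lemma pure3_linear: "lin s tscale (\<lambda>a. pure s [a, b, c])"
  "lin s tscale (\<lambda>b. pure s [a, b, c])" "lin s tscale (\<lambda>c. pure s [a, b, c])"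
  using multilinearD[OF multilinear_pure, of "[]" "[b, c]"] multilinearD[OF multilinear_pure, of "[a]" "[c]"]
    multilinearD[OF multilinear_pure, of "[a, b]" "[]"] by simp_all

text \<open>\<open>L\<close> is \<open>id \<otimes> f\<close> or \<open>f \<otimes> id\<close> on \<open>V \<otimes> V\<close>. These are relations because only the values on \<open>V \<otimes> V\<close>
  matter, and a linear map on all functionals is not determined by them.\<close>

definition right_slice where
  "right_slice f L \<longleftrightarrow> lin tscale s L \<and> (\<forall>a b. L (pure s [a, b]) = s (f b) a)"

definition left_slice where
  "left_slice f L \<longleftrightarrow> lin tscale s L \<and> (\<forall>a b. L (pure s [a, b]) = s (f a) b)"

lemma slices_exist:
  assumes "lin s (*) f"
  shows "\<exists>L. right_slice f L" "\<exists>L. left_slice f L"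
proof -
  have 1: "linear_on s s UNIV (\<lambda>b. s (f b) a)" "linear_on s s UNIV (\<lambda>a. s (f b) a)" for a b
    by (auto intro!: lin_imp_on lin_smult lin_scalar_mult assms vector_space_axioms
        linear_id[unfolded id_def])
  show "\<exists>L. right_slice f L"
    using bilinear_on_lift[OF vector_space_axioms subspace_UNIV, of "\<lambda>a b. s (f b) a"] 1
    unfolding right_slice_def by (metis UNIV_I)
  show "\<exists>L. left_slice f L"
    using bilinear_on_lift[OF vector_space_axioms subspace_UNIV, of "\<lambda>a b. s (f a) b"] 1
    unfolding left_slice_def by (metis UNIV_I)
qed

lemma lin_square_eqI:
  assumes "lin tscale s' f" "lin tscale s' g"
    and "\<And>a b. f (pure s [a, b]) = g (pure s [a, b])" "x \<in> tensor_power s 2"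
  shows "f x = g x"
proof (rule lin_power_eqI[OF assms(1,2) _ assms(4)])
  fix ws :: "'v list" assume "length ws = 2"
  then obtain a b where "ws = [a, b]" by (auto simp: length_Suc_conv numeral_2_eq_2)
  thus "f (pure s ws) = g (pure s ws)" using assms(3) by simp
qed

text \<open>A tensor lies in \<open>P \<otimes> Q\<close> as soon as all its slices lie in \<open>P\<close> and \<open>Q\<close>: projections onto \<open>P\<close> and
  \<open>Q\<close>, applied to the two factors, then do not change any slice.\<close>

lemma tensor_square_mem_of_slices:
  assumes P: "subspace P" and Q: "subspace Q" and x: "x \<in> tensor_power s 2"
    and right: "\<And>f L. lin s (*) f \<Longrightarrow> right_slice f L \<Longrightarrow> L x \<in> P"
    and left: "\<And>f L. lin s (*) f \<Longrightarrow> left_slice f L \<Longrightarrow> L x \<in> Q"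
  shows "x \<in> T.span {pure s [a, b] | a b. a \<in> P \<and> b \<in> Q}"
proof -
  obtain e where e: "lin s s e" "\<And>x. x \<in> P \<Longrightarrow> e x = x" "\<And>x. e x \<in> P"
    using subspace_projection[OF vector_space_axioms P] by blast
  obtain e' where e': "lin s s e'" "\<And>x. x \<in> Q \<Longrightarrow> e' x = x" "\<And>x. e' x \<in> Q"
    using subspace_projection[OF vector_space_axioms Q] by blast
  obtain M where M: "lin tscale tscale M" "\<And>a b. M (pure s [a, b]) = pure s [e a, b]"
  proof (rule bilinear_on_lift[OF vector_space_tscale subspace_UNIV, of "\<lambda>a b. pure s [e a, b]"])
    show "linear_on s tscale UNIV (\<lambda>a. pure s [e a, b])" for b
      by (rule lin_imp_on[OF lin_comp[OF e(1) pure2_linear(1)]])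
    show "linear_on s tscale UNIV (\<lambda>b. pure s [e a, b])" for a
      by (rule lin_imp_on[OF pure2_linear(2)])
  qed blast
  obtain M' where M': "lin tscale tscale M'" "\<And>a b. M' (pure s [a, b]) = pure s [a, e' b]"
  proof (rule bilinear_on_lift[OF vector_space_tscale subspace_UNIV, of "\<lambda>a b. pure s [a, e' b]"])
    show "linear_on s tscale UNIV (\<lambda>b. pure s [a, e' b])" for a
      by (rule lin_imp_on[OF lin_comp[OF e'(1) pure2_linear(2)]])
    show "linear_on s tscale UNIV (\<lambda>a. pure s [a, e' b])" for b
      by (rule lin_imp_on[OF pure2_linear(1)])
  qed blast
  have M_in: "M x \<in> tensor_power s 2" "M' x \<in> tensor_power s 2"
    by (rule lin_span_image[OF M(1) _ subspace_power x[unfolded tensor_square_eq]],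
        auto simp: M(2) intro!: pure_in_power')
      (rule lin_span_image[OF M'(1) _ subspace_power x[unfolded tensor_square_eq]],
        auto simp: M'(2) intro!: pure_in_power')
  have in2: "M x - x \<in> tensor_power s 2" "M' x - x \<in> tensor_power s 2"
    using M_in x by (auto intro: T.subspace_diff subspace_power)
  have "M x - x = 0"
  proof (rule zero_of_slices[OF vector_space_axioms vector_space_tscale pure2_linear in2(1)[unfolded tensor_square_eq]])
    fix f :: "'v \<Rightarrow> 'k" assume f: "lin s (*) f"
    obtain L where L: "right_slice f L" using slices_exist(1)[OF f] by blast
    have L': "lin tscale s L" "\<And>a b. L (pure s [a, b]) = s (f b) a"
      using L unfolding right_slice_def by blast+
    have "L (M x) = e (L x)"
      by (rule lin_square_eqI[OF lin_comp[OF M(1) L'(1)] lin_comp[OF L'(1) e(1)] _ x])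
        (simp add: M(2) L'(2) lin_scale[OF e(1)])
    hence "L (M x - x) = 0" using right[OF f L] e(2) by (simp add: lin_diff[OF L'(1)])
    thus "\<exists>L. lin tscale s L \<and> (\<forall>a b. L (pure s [a, b]) = s (f b) a) \<and> L (M x - x) = 0"
      using L' by blast
  qed
  moreover have "M' x - x = 0"
  proof (rule zero_of_slices[where m = "\<lambda>b a. pure s [a, b]", OF vector_space_axioms vector_space_tscale
        pure2_linear(2) pure2_linear(1)])
    have "{pure s [a, b] | a b. True} = {pure s [b, a] | a b. True}" by blast
    thus "M' x - x \<in> T.span {pure s [b, a] | a b. True}"
      using in2(2) unfolding tensor_square_eq by simp
    fix f :: "'v \<Rightarrow> 'k" assume f: "lin s (*) f"
    obtain L where L: "left_slice f L" using slices_exist(2)[OF f] by blast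
    have L': "lin tscale s L" "\<And>a b. L (pure s [a, b]) = s (f a) b"
      using L unfolding left_slice_def by blast+
    have "L (M' x) = e' (L x)"
      by (rule lin_square_eqI[OF lin_comp[OF M'(1) L'(1)] lin_comp[OF L'(1) e'(1)] _ x])
        (simp add: M'(2) L'(2) lin_scale[OF e'(1)])
    hence "L (M' x - x) = 0" using left[OF f L] e'(2) by (simp add: lin_diff[OF L'(1)])
    thus "\<exists>L. lin tscale s L \<and> (\<forall>a b. L (pure s [b, a]) = s (f b) a) \<and> L (M' x - x) = 0"
      using L' by blast
  qed
  ultimately have "M' (M x) = x" by simp
  have gen: "M' (M (pure s [a, b])) \<in> T.span {pure s [a, b] | a b. a \<in> P \<and> b \<in> Q}" for a b
    unfolding M(2) M'(2) using e(3) e'(3) by (intro T.span_base) blast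
  have "M' (M x) \<in> T.span {pure s [a, b] | a b. a \<in> P \<and> b \<in> Q}"
    by (rule lin_span_image[OF lin_comp[OF M(1) M'(1)] _ _ x[unfolded tensor_square_eq]])
      (use gen in auto)
  with \<open>M' (M x) = x\<close> show ?thesis by simp
qed

end


section \<open>Deconcatenation\<close>

context tensors
begin

text \<open>The component of the deconcatenation that cuts after the \<open>i\<close>-th letter.\<close>

definition cut :: "nat \<Rightarrow> ('v, 'k) tensor \<Rightarrow> (('v, 'k) tensor, 'k) tensor"
  where "cut i = tlift (\<lambda>ws. pure tscale [pure s (take i ws), pure s (drop i ws)])"

lemma cut_linear: "lin tscale tscale (cut i)"
  unfolding cut_def by (rule tlift_linear)

lemma multilinear_cut: "multilinear s tscale (\<lambda>ws. pure tscale [pure s (take i ws), pure s (drop i ws)])"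
  by (rule multilinear_split[where B = "\<lambda>xs ys. pure tscale [pure s xs, pure s ys]"])
    (auto intro: multilinear_compose[OF multilinear_pure] TT.pure2_linear)

lemma cut_pure: "cut i (pure s ws) = pure tscale [pure s (take i ws), pure s (drop i ws)]"
  unfolding cut_def by (rule tlift_pure[OF multilinear_cut])

lemma deconcat_linear: "lin tscale tscale (deconcat s)"
  unfolding deconcat_def by (rule tlift_linear)

lemma deconcat_pure:
  "deconcat s (pure s ws) = (\<Sum>i\<le>length ws. pure tscale [pure s (take i ws), pure s (drop i ws)])"
  unfolding deconcat_def
  by (intro tlift_pure multilinear_length[of s tscale "\<lambda>n ws. \<Sum>i\<le>n. pure tscale [pure s (take i ws), pure s (drop i ws)]"]
      multilinear_sum vector_space_axioms vector_space_tscale multilinear_cut)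

lemma deconcat3_pure:
  "deconcat3 s (pure s ws) = (\<Sum>j\<le>length ws. \<Sum>i\<le>j.
    pure tscale [pure s (take i ws), pure s (drop i (take j ws)), pure s (drop j ws)])"
proof -
  have *: "(\<Sum>i\<le>j. pure tscale [pure s (take i ws), pure s (drop i (take j ws)), pure s (drop j ws)])
    = (\<Sum>i\<le>j. pure tscale [pure s (take i (take j ws)), pure s (drop i (take j ws)), pure s (drop j ws)])"
    for j ws by (intro sum.cong refl) (simp add: min_absorb1)
  have "multilinear s tscale (\<lambda>ws. pure tscale [pure s (take i (take j ws)), pure s (drop i (take j ws)), pure s (drop j ws)])"
    for i j
    by (rule multilinear_split3[where B = "\<lambda>xs ys zs. pure tscale [pure s xs, pure s ys, pure s zs]"])
      (auto intro: multilinear_compose[OF multilinear_pure] TT.pure3_linear)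
  hence "multilinear s tscale (\<lambda>ws. \<Sum>j\<le>length ws. \<Sum>i\<le>j.
      pure tscale [pure s (take i (take j ws)), pure s (drop i (take j ws)), pure s (drop j ws)])"
    by (intro multilinear_length[of s tscale "\<lambda>n ws. \<Sum>j\<le>n. \<Sum>i\<le>j.
        pure tscale [pure s (take i (take j ws)), pure s (drop i (take j ws)), pure s (drop j ws)]"]
      multilinear_sum vector_space_axioms vector_space_tscale)
  from tlift_pure[OF this, of ws] show ?thesis unfolding deconcat3_def * by simp
qed

lemma deconcat3_linear: "lin tscale tscale (deconcat3 s)"
  unfolding deconcat3_def by (rule tlift_linear)

lemma deconcat_tensor_power: "x \<in> tensor_power s n \<Longrightarrow> deconcat s x = (\<Sum>i\<le>n. cut i x)"
  by (rule lin_power_eqI[OF deconcat_linear lin_sum_fun])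
    (auto simp: deconcat_pure cut_pure vector_space_tscale cut_linear)

lemma cut_in_square: "x \<in> tensor_alg s \<Longrightarrow> cut i x \<in> tensor_power tscale 2"
  unfolding tensor_alg_def
  by (rule lin_span_image[OF cut_linear _ TT.subspace_power])
    (auto simp: cut_pure intro!: TT.pure_in_power')

lemma deconcat_in_alg: "x \<in> tensor_alg s \<Longrightarrow> deconcat s x \<in> tensor_alg tscale"
  unfolding tensor_alg_def[of s]
  by (rule lin_span_image[OF deconcat_linear _ TT.subspace_alg])
    (auto simp: deconcat_pure intro!: T.subspace_sum TT.subspace_alg TT.pure_in_alg)

lemma right_slice_cut:
  assumes L: "TT.right_slice f L"
  shows "lin tscale tscale (\<lambda>x. L (cut i x))"
    and "L (cut i (pure s ws)) = tscale (f (pure s (drop i ws))) (pure s (take i ws))"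
  using L unfolding TT.right_slice_def by (auto simp: cut_pure intro: lin_comp[OF cut_linear])

lemma left_slice_cut:
  assumes L: "TT.left_slice f L"
  shows "lin tscale tscale (\<lambda>x. L (cut i x))"
    and "L (cut i (pure s ws)) = tscale (f (pure s (take i ws))) (pure s (drop i ws))"
  using L unfolding TT.left_slice_def by (auto simp: cut_pure intro: lin_comp[OF cut_linear])

lemma right_slice_cut_power:
  assumes L: "TT.right_slice f L" and "x \<in> tensor_power s n" "i \<le> n"
  shows "L (cut i x) \<in> tensor_power s i"
  by (rule lin_power_image[OF right_slice_cut(1)[OF L] _ subspace_power assms(2)])
    (use assms(3) in \<open>auto simp: right_slice_cut(2)[OF L] intro!: T.subspace_scale subspace_power pure_in_power'\<close>)

lemma left_slice_cut_power:
  assumes L: "TT.left_slice f L" and "x \<in> tensor_power s n" "i \<le> n"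
  shows "L (cut i x) \<in> tensor_power s (n - i)"
  by (rule lin_power_image[OF left_slice_cut(1)[OF L] _ subspace_power assms(2)])
    (use assms(3) in \<open>auto simp: left_slice_cut(2)[OF L] intro!: T.subspace_scale subspace_power pure_in_power'\<close>)

lemma right_slice_cut_tmult:
  assumes L: "TT.right_slice f L" and x: "x \<in> tensor_power s p" and y: "y \<in> tensor_power s q" and "p \<le> i" "i \<le> p + q"
  shows "L (cut i (tmult s x y)) = tmult s x (L (cut (i - p) y))"
proof (rule lin_power_eqI[OF lin_comp[OF tmult_linear_left right_slice_cut(1)[OF L]] tmult_linear_left _ x])
  fix us :: "'v list" assume us: "length us = p"
  have T: "L (cut (i - p) y) \<in> tensor_alg s" if "y \<in> tensor_power s q" for y
    by (rule power_in_alg[OF right_slice_cut_power[OF L that]]) (use assms(5) in simp)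
  show "L (cut i (tmult s (pure s us) y)) = tmult s (pure s us) (L (cut (i - p) y))"
    using y
  proof (induction rule: power_induct)
    case zero
    show ?case by (simp add: tmult_zero_right pure_in_alg lin_zero[OF right_slice_cut(1)[OF L]])
  next
    case (pure ws)
    thus ?case using us assms(4)
      by (simp add: tmult_pure right_slice_cut(2)[OF L] tmult_scale_right pure_in_alg)
  next
    case (add y z)
    thus ?case
      by (simp add: tmult_add_right pure_in_alg power_in_alg lin_add[OF right_slice_cut(1)[OF L]] T)
  next
    case (scale c y)
    thus ?case
      by (simp add: tmult_scale_right pure_in_alg power_in_alg lin_scale[OF right_slice_cut(1)[OF L]] T)
  qed
qed

lemma left_slice_cut_tmult:
  assumes L: "TT.left_slice f L" and x: "x \<in> tensor_power s p" and y: "y \<in> tensor_alg s" and "i \<le> p"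
  shows "L (cut i (tmult s x y)) = tmult s (L (cut i x)) y"
proof (rule lin_power_eqI[OF lin_comp[OF tmult_linear_left left_slice_cut(1)[OF L]]
      lin_comp[OF left_slice_cut(1)[OF L] tmult_linear_left] _ x])
  fix us :: "'v list" assume us: "length us = p"
  have T: "L (cut i (pure s us)) \<in> tensor_alg s"
    by (simp add: left_slice_cut(2)[OF L] alg_scale pure_in_alg)
  show "L (cut i (tmult s (pure s us) y)) = tmult s (L (cut i (pure s us))) y"
    using y
  proof (induction rule: alg_induct)
    case zero
    show ?case by (simp add: tmult_zero_right pure_in_alg lin_zero[OF left_slice_cut(1)[OF L]] T)
  next
    case (pure ws)
    thus ?case using us assms(4)
      by (simp add: tmult_pure left_slice_cut(2)[OF L] tmult_scale_left pure_in_alg)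
  next
    case (add y z)
    thus ?case
      by (simp add: tmult_add_right pure_in_alg lin_add[OF left_slice_cut(1)[OF L]] T)
  next
    case (scale c y)
    thus ?case
      by (simp add: tmult_scale_right pure_in_alg lin_scale[OF left_slice_cut(1)[OF L]] T)
  qed
qed

end


section \<open>Quadratic coalgebras are subcoalgebras of the tensor coalgebra\<close>

context tensors
begin

definition tensor_prod :: "('v, 'k) tensor set \<Rightarrow> ('v, 'k) tensor set \<Rightarrow> ('v, 'k) tensor set"
  where "tensor_prod P Q = T.span {tmult s a b | a b. a \<in> P \<and> b \<in> Q}"

lemma lin_prod_eqI:
  assumes "lin tscale s' f" "lin tscale s' g"
    and "\<And>a b. a \<in> P \<Longrightarrow> b \<in> Q \<Longrightarrow> f (tmult s a b) = g (tmult s a b)" "x \<in> tensor_prod P Q"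
  shows "f x = g x"
  by (rule lin_eq_on_span[OF assms(1,2) _ assms(4)[unfolded tensor_prod_def]]) (use assms(3) in blast)

lemma lin_prod_image:
  assumes "lin tscale s' f" "\<And>a b. a \<in> P \<Longrightarrow> b \<in> Q \<Longrightarrow> f (tmult s a b) \<in> U"
    and "module.subspace s' U" "x \<in> tensor_prod P Q"
  shows "f x \<in> U"
  by (rule lin_span_image[OF assms(1) _ assms(3) assms(4)[unfolded tensor_prod_def]])
    (use assms(2) in blast)

text \<open>\<open>C \<otimes> C\<close>, as a subspace of \<open>T(V) \<otimes> T(V)\<close>.\<close>

definition tensor_two :: "('v, 'k) tensor set \<Rightarrow> (('v, 'k) tensor, 'k) tensor set"
  where "tensor_two C = T.span {pure tscale [a, b] | a b. a \<in> C \<and> b \<in> C}"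

end

locale quadratic = tensors s for s :: "'k::field \<Rightarrow> 'v::ab_group_add \<Rightarrow> 'v" +
  fixes S :: "('v, 'k) tensor set"
  assumes S_sub: "T.subspace S" and S_square: "S \<subseteq> tensor_power s 2"
begin

abbreviation "wt \<equiv> quadratic_coalgebra_weight s S"
abbreviation "C \<equiv> quadratic_coalgebra s S"

text \<open>\<open>V\<^sup>\<otimes>\<^sup>i \<otimes> S \<otimes> V\<^sup>\<otimes>\<^sup>j\<close>, one of the spaces whose intersection is the weight \<open>i + 2 + j\<close> part.\<close>

definition slab :: "nat \<Rightarrow> nat \<Rightarrow> ('v, 'k) tensor set"
  where "slab i j = T.span {tmult s (tmult s x r) y | x r y. x \<in> tensor_power s i \<and> r \<in> S \<and> y \<in> tensor_power s j}"

lemma wt_iff: "x \<in> wt n \<longleftrightarrow> x \<in> tensor_power s n \<and> (\<forall>i j. i + 2 + j = n \<longrightarrow> x \<in> slab i j)"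
  by (auto simp: quadratic_coalgebra_weight_def slab_def)

lemma subspace_slab: "T.subspace (slab i j)"
  by (simp add: slab_def)

lemma subspace_wt: "T.subspace (wt n)"
  by (rule T.subspaceI)
    (auto simp: wt_iff T.subspace_0 T.subspace_add T.subspace_scale subspace_slab subspace_power)

lemma subspace_C: "T.subspace C"
  by (simp add: quadratic_coalgebra_def)

lemma wt_in_power: "x \<in> wt n \<Longrightarrow> x \<in> tensor_power s n"
  by (simp add: wt_iff)

lemma wt_in_alg: "x \<in> wt n \<Longrightarrow> x \<in> tensor_alg s"
  using wt_in_power power_in_alg by blast

lemma wt_subset_C: "x \<in> wt n \<Longrightarrow> x \<in> C"
  unfolding quadratic_coalgebra_def by (intro T.span_base) blast

lemma C_in_alg: "x \<in> C \<Longrightarrow> x \<in> tensor_alg s"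
  unfolding quadratic_coalgebra_def
  by (rule T.span_minimal[THEN subsetD, rotated 2]) (auto simp: wt_in_alg subspace_alg)

lemma lin_C_eqI:
  assumes "lin tscale s' f" "lin tscale s' g"
    and "\<And>n x. x \<in> wt n \<Longrightarrow> f x = g x" "x \<in> C"
  shows "f x = g x"
  by (rule lin_eq_on_span[OF assms(1,2) _ assms(4)[unfolded quadratic_coalgebra_def]]) (use assms(3) in blast)

lemma lin_C_image:
  assumes "lin tscale s' f" "\<And>n x. x \<in> wt n \<Longrightarrow> f x \<in> U"
    and "module.subspace s' U" "x \<in> C"
  shows "f x \<in> U"
  by (rule lin_span_image[OF assms(1) _ assms(3) assms(4)[unfolded quadratic_coalgebra_def]])
    (use assms(2) in blast)

lemma S_in_alg: "r \<in> S \<Longrightarrow> r \<in> tensor_alg s"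
  using S_square power_in_alg by blast

lemma slabI:
  "x \<in> tensor_power s i \<Longrightarrow> r \<in> S \<Longrightarrow> y \<in> tensor_power s j \<Longrightarrow> tmult s (tmult s x r) y \<in> slab i j"
  unfolding slab_def by (intro T.span_base) blast

lemma lin_slab_image:
  assumes "lin tscale s' f"
    and "\<And>x r y. x \<in> tensor_power s i \<Longrightarrow> r \<in> S \<Longrightarrow> y \<in> tensor_power s j \<Longrightarrow> f (tmult s (tmult s x r) y) \<in> U"
    and "module.subspace s' U" "z \<in> slab i j"
  shows "f z \<in> U"
  by (rule lin_span_image[OF assms(1) _ assms(3) assms(4)[unfolded slab_def]])
    (use assms(2) in blast)

lemma slab_mult_right:
  assumes "z \<in> slab i j" "y \<in> tensor_power s m"
  shows "tmult s z y \<in> slab i (j + m)"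
proof (rule lin_slab_image[OF tmult_linear_left _ subspace_slab assms(1)])
  fix x r w assume *: "x \<in> tensor_power s i" "r \<in> S" "w \<in> tensor_power s j"
  have "tmult s (tmult s (tmult s x r) w) y = tmult s (tmult s x r) (tmult s w y)"
    using * assms(2) by (intro tmult_assoc tmult_in_alg) (auto simp: power_in_alg S_in_alg)
  thus "tmult s (tmult s (tmult s x r) w) y \<in> slab i (j + m)"
    using * assms(2) by (simp add: slabI tmult_in_power)
qed

lemma slab_mult_left:
  assumes "z \<in> slab i j" "x \<in> tensor_power s m"
  shows "tmult s x z \<in> slab (m + i) j"
proof (rule linear_on_span_image[OF vector_space_tscale vector_space_tscale _ _ subspace_slab assms(1)[unfolded slab_def]])
  have "slab i j \<subseteq> tensor_alg s"
    unfolding slab_def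
    by (rule T.span_minimal)
      (auto intro!: tmult_in_alg simp: power_in_alg S_in_alg subspace_alg)
  thus "linear_on tscale tscale (T.span {tmult s (tmult s x r) y |x r y.
      x \<in> tensor_power s i \<and> r \<in> S \<and> y \<in> tensor_power s j}) (tmult s x)"
    using linear_on_subset[OF tmult_linear_right[OF power_in_alg[OF assms(2)]]]
    unfolding slab_def by blast
  fix z assume "z \<in> {tmult s (tmult s x r) y |x r y. x \<in> tensor_power s i \<and> r \<in> S \<and> y \<in> tensor_power s j}"
  then obtain w r y where *: "w \<in> tensor_power s i" "r \<in> S" "y \<in> tensor_power s j"
    and z: "z = tmult s (tmult s w r) y" by blast
  have "tmult s x z = tmult s (tmult s (tmult s x w) r) y"
    using * assms(2) unfolding z by (simp add: tmult_assoc tmult_in_alg power_in_alg S_in_alg)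
  thus "tmult s x z \<in> slab (m + i) j"
    using * assms(2) by (simp add: slabI tmult_in_power)
qed

lemma wt_1: "wt (Suc 0) = tensor_power s (Suc 0)"
  by (auto simp: wt_iff)

text \<open>The outer factors are scalars.\<close>

lemma slab_0_0: "slab 0 0 = S"
proof
  have "tmult s (tmult s x r) y \<in> S" if "x \<in> tensor_power s 0" "r \<in> S" "y \<in> tensor_power s 0" for x r y
    using that S_sub
    by (auto simp: power_zero tmult_scale_left tmult_scale_right tmult_unit_left tmult_unit_right
        S_in_alg alg_scale pure_in_alg T.subspace_scale)
  thus "slab 0 0 \<subseteq> S" unfolding slab_def by (intro T.span_minimal S_sub) blast
  show "S \<subseteq> slab 0 0"
  proof
    fix r assume r: "r \<in> S"
    have "tmult s (tmult s (pure s []) r) (pure s []) \<in> slab 0 0"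
      using r by (intro slabI pure_in_power') auto
    thus "r \<in> slab 0 0" using r by (simp add: tmult_unit_left tmult_unit_right S_in_alg)
  qed
qed

lemma wt_2: "wt 2 = S"
proof -
  have "i + 2 + j = 2 \<longleftrightarrow> i = 0 \<and> j = 0" for i j :: nat by auto
  thus ?thesis using S_square by (auto simp: wt_iff slab_0_0)
qed

text \<open>A slice of a cut acts on the letters of one side of the cut only, so it preserves every slab
  that lies on the other side.\<close>

lemma right_slice_cut_wt:
  assumes L: "TT.right_slice f L" and x: "x \<in> wt n" and i: "i \<le> n"
  shows "L (cut i x) \<in> wt i"
proof -
  have "L (cut i x) \<in> slab p q" if pq: "p + 2 + q = i" for p q
  proof -
    have xs: "x \<in> slab p (n - p - 2)" using x i pq by (auto simp: wt_iff)
    show ?thesis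
    proof (rule lin_slab_image[OF right_slice_cut(1)[OF L] _ subspace_slab xs])
      fix u r y assume *: "u \<in> tensor_power s p" "r \<in> S" "y \<in> tensor_power s (n - p - 2)"
      have "L (cut i (tmult s (tmult s u r) y)) = tmult s (tmult s u r) (L (cut (i - (p + 2)) y))"
        by (rule right_slice_cut_tmult[OF L tmult_in_power *(3)])
          (use * i pq S_square in auto)
      moreover have "L (cut (i - (p + 2)) y) \<in> tensor_power s q"
        using right_slice_cut_power[OF L *(3), of q] i pq by auto
      ultimately show "L (cut i (tmult s (tmult s u r) y)) \<in> slab p q"
        using * by (simp add: slabI)
    qed
  qed
  thus ?thesis using right_slice_cut_power[OF L wt_in_power[OF x] i] by (simp add: wt_iff)
qed

lemma left_slice_cut_wt:
  assumes L: "TT.left_slice f L" and x: "x \<in> wt n" and i: "i \<le> n"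
  shows "L (cut i x) \<in> wt (n - i)"
proof -
  have "L (cut i x) \<in> slab p q" if pq: "p + 2 + q = n - i" for p q
  proof -
    have xs: "x \<in> slab (i + p) q" using x i pq by (auto simp: wt_iff)
    show ?thesis
    proof (rule lin_slab_image[OF left_slice_cut(1)[OF L] _ subspace_slab xs])
      fix u r y assume *: "u \<in> tensor_power s (i + p)" "r \<in> S" "y \<in> tensor_power s q"
      have ur: "tmult s u r \<in> tensor_power s (i + p + 2)"
        by (rule tmult_in_power[OF *(1)]) (use *(2) S_square in blast)
      have "L (cut i (tmult s (tmult s u r) y)) = tmult s (tmult s (L (cut i u)) r) y"
        using * left_slice_cut_tmult[OF L ur power_in_alg[OF *(3)], of i]
          left_slice_cut_tmult[OF L *(1) S_in_alg[OF *(2)], of i] by simp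
      moreover have "L (cut i u) \<in> tensor_power s p"
        using left_slice_cut_power[OF L *(1), of i] by simp
      ultimately show "L (cut i (tmult s (tmult s u r) y)) \<in> slab p q"
        using * by (simp add: slabI)
    qed
  qed
  thus ?thesis using left_slice_cut_power[OF L wt_in_power[OF x] i] by (simp add: wt_iff)
qed

lemma cut_wt:
  assumes "x \<in> wt n" "i \<le> n"
  shows "cut i x \<in> T.span {pure tscale [a, b] | a b. a \<in> wt i \<and> b \<in> wt (n - i)}"
  by (rule TT.tensor_square_mem_of_slices[OF subspace_wt subspace_wt cut_in_square[OF wt_in_alg[OF assms(1)]]])
    (use assms right_slice_cut_wt left_slice_cut_wt in blast)+

text \<open>Concatenation inverts a cut, so every element of weight \<open>n\<close> is a sum of products of elements of
  weights \<open>i\<close> and \<open>n - i\<close>. All later inductions on the weight rest on this.\<close>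

lemma wt_factor:
  assumes x: "x \<in> wt n" and i: "i \<le> n"
  shows "x \<in> tensor_prod (wt i) (wt (n - i))"
proof -
  obtain M where M: "lin tscale tscale M"
    "\<And>a b. a \<in> tensor_alg s \<Longrightarrow> b \<in> tensor_alg s \<Longrightarrow> M (pure tscale [a, b]) = tmult s a b"
    by (rule TT.bilinear_on_lift[OF vector_space_tscale subspace_alg, where h = "tmult s"])
      (auto intro: tmult_linear_right lin_imp_on[OF tmult_linear_left])
  have id: "M (cut i x) = x"
    by (rule lin_power_eqI[OF lin_comp[OF cut_linear M(1)] lin_id _ wt_in_power[OF x]])
      (simp add: cut_pure M(2) pure_in_alg tmult_pure)
  have gen: "M (pure tscale [a, b]) \<in> tensor_prod (wt i) (wt (n - i))"
    if "a \<in> wt i" "b \<in> wt (n - i)" for a b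
    using that M(2)[OF wt_in_alg wt_in_alg, OF that] unfolding tensor_prod_def
    by (auto intro!: T.span_base)
  have "M (cut i x) \<in> tensor_prod (wt i) (wt (n - i))"
    by (rule lin_span_image[OF M(1) _ _ cut_wt[OF x i]])
      (use gen in \<open>auto simp: tensor_prod_def\<close>)
  thus ?thesis by (simp add: id)
qed

lemma deconcat_C:
  assumes "x \<in> C"
  shows "deconcat s x \<in> tensor_two C"
proof (rule lin_C_image[OF deconcat_linear _ _ assms])
  show "T.subspace (tensor_two C)" by (simp add: tensor_two_def)
  fix n x assume x: "x \<in> wt n"
  have "cut i x \<in> tensor_two C" if "i \<le> n" for i
    using cut_wt[OF x that] unfolding tensor_two_def
    by (rule T.span_mono[THEN subsetD, rotated]) (use wt_subset_C in blast)
  thus "deconcat s x \<in> tensor_two C"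
    unfolding deconcat_tensor_power[OF wt_in_power[OF x]] tensor_two_def by (intro T.span_sum) simp
qed

lemma tmap_C:
  assumes a: "lin s s a" and S: "\<And>r. r \<in> S \<Longrightarrow> tmap a r \<in> S"
  shows "x \<in> wt n \<Longrightarrow> tmap a x \<in> wt n" "x \<in> C \<Longrightarrow> tmap a x \<in> C"
proof -
  have slab: "tmap a z \<in> slab i j" if "z \<in> slab i j" for z i j
  proof (rule lin_slab_image[OF tmap_linear _ subspace_slab that])
    fix x r y assume *: "x \<in> tensor_power s i" "r \<in> S" "y \<in> tensor_power s j"
    have "tmap a (tmult s (tmult s x r) y) = tmult s (tmult s (tmap a x) (tmap a r)) (tmap a y)"
      using * by (simp add: tmap_tmult a tmult_in_alg power_in_alg S_in_alg)
    thus "tmap a (tmult s (tmult s x r) y) \<in> slab i j"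
      using * by (simp add: slabI tmap_in_power a S)
  qed
  show wt: "tmap a x \<in> wt n" if "x \<in> wt n" for x n
    using that slab by (auto simp: wt_iff tmap_in_power a)
  show "tmap a x \<in> C" if "x \<in> C"
    by (rule lin_C_image[OF tmap_linear _ subspace_C that]) (use wt wt_subset_C in blast)
qed

end


section \<open>The coalgebra structure\<close>

lemma subspace_zero_field: "module.subspace ((*) :: 'k::field \<Rightarrow> 'k \<Rightarrow> 'k) {0}"
proof -
  interpret K: vector_space "(*) :: 'k \<Rightarrow> 'k \<Rightarrow> 'k" by (rule vector_space_mult)
  show ?thesis by (rule K.subspace_single_0)
qed

lemma tcounit_linear: "lin tscale (*) (tcounit :: ('v, 'k::field) tensor \<Rightarrow> 'k)"
  unfolding tcounit_def by (rule tscale_apply_linear)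

context tensors
begin

lemma tcounit_pure: "tcounit (pure s ws) = (if ws = [] then 1 else 0)"
proof -
  have "multilinear s (*) (\<lambda>ws :: 'v list. if ws = [] then 1 else (0::'k))"
    using lin_const_zero[OF vector_space_axioms vector_space_mult] by (intro multilinearI) simp
  thus ?thesis by (simp add: tcounit_def pure_def)
qed

lemma deconcat_lift_left:
  "\<exists>L. lin tscale tscale L \<and> (\<forall>a\<in>tensor_alg s. \<forall>b\<in>tensor_alg s.
    L (pure tscale [a, b]) = tmult tscale (deconcat s a) (pure tscale [b]))"
proof -
  have "linear_on tscale tscale (tensor_alg s) (\<lambda>a. tmult tscale (deconcat s a) (pure tscale [b]))"
    for b :: "('v, 'k) tensor"
    by (rule lin_imp_on[OF lin_comp[OF deconcat_linear TT.tmult_linear_left]])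
  moreover have "linear_on tscale tscale (tensor_alg s) (\<lambda>b. tmult tscale (deconcat s a) (pure tscale [b]))"
    if "a \<in> tensor_alg s" for a
    using that by (simp add: linear_on_def TT.pure_singleton_add TT.pure_singleton_scale TT.tmult_add_right
        TT.tmult_scale_right TT.pure_in_alg deconcat_in_alg)
  ultimately show ?thesis
    using TT.bilinear_on_lift[OF vector_space_tscale subspace_alg,
        where h = "\<lambda>a b. tmult tscale (deconcat s a) (pure tscale [b])"] by metis
qed

lemma deconcat_lift_right:
  "\<exists>L. lin tscale tscale L \<and> (\<forall>a\<in>tensor_alg s. \<forall>b\<in>tensor_alg s.
    L (pure tscale [a, b]) = tmult tscale (pure tscale [a]) (deconcat s b))"
proof -
  have "linear_on tscale tscale (tensor_alg s) (\<lambda>a. tmult tscale (pure tscale [a]) (deconcat s b))" for b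
    by (rule lin_imp_on[OF lin_comp[OF TT.pure_singleton_linear TT.tmult_linear_left]])
  moreover have "linear_on tscale tscale (tensor_alg s) (\<lambda>b. tmult tscale (pure tscale [a]) (deconcat s b))"
    for a :: "('v, 'k) tensor"
    by (simp add: linear_on_def lin_add[OF deconcat_linear] lin_scale[OF deconcat_linear] TT.tmult_add_right
        TT.tmult_scale_right TT.pure_in_alg deconcat_in_alg)
  ultimately show ?thesis
    using TT.bilinear_on_lift[OF vector_space_tscale subspace_alg,
        where h = "\<lambda>a b. tmult tscale (pure tscale [a]) (deconcat s b)"] by metis
qed

end

lemma (in tensors) deconcat_counit_left:
  assumes L: "lin tscale tscale L" "\<And>a b. L (pure tscale [a, b]) = tscale (tcounit a) b"
    and x: "x \<in> tensor_alg s"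
  shows "L (deconcat s x) = x"
proof (rule lin_alg_eqI[OF lin_comp[OF deconcat_linear L(1)] lin_id _ x])
  fix ws :: "'v list"
  have "L (deconcat s (pure s ws)) = (\<Sum>i\<le>length ws. if i = 0 then pure s ws else 0)"
    unfolding deconcat_pure lin_sum[OF L(1)]
    by (intro sum.cong refl) (auto simp: L(2) tcounit_pure)
  thus "L (deconcat s (pure s ws)) = pure s ws" by simp
qed

lemma (in tensors) deconcat_counit_right:
  assumes L: "lin tscale tscale L" "\<And>a b. L (pure tscale [a, b]) = tscale (tcounit b) a"
    and x: "x \<in> tensor_alg s"
  shows "L (deconcat s x) = x"
proof (rule lin_alg_eqI[OF lin_comp[OF deconcat_linear L(1)] lin_id _ x])
  fix ws :: "'v list"
  have "L (deconcat s (pure s ws)) = (\<Sum>i\<le>length ws. if i = length ws then pure s ws else 0)"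
    unfolding deconcat_pure lin_sum[OF L(1)]
    by (intro sum.cong refl) (auto simp: L(2) tcounit_pure)
  thus "L (deconcat s (pure s ws)) = pure s ws" by simp
qed

lemma (in tensors) deconcat_coassoc_left:
  assumes L: "lin tscale tscale L"
      "\<And>a b. a \<in> tensor_alg s \<Longrightarrow> b \<in> tensor_alg s \<Longrightarrow> L (pure tscale [a, b]) = tmult tscale (deconcat s a) (pure tscale [b])"
    and x: "x \<in> tensor_alg s"
  shows "L (deconcat s x) = deconcat3 s x"
proof (rule lin_alg_eqI[OF lin_comp[OF deconcat_linear L(1)] deconcat3_linear _ x])
  fix ws :: "'v list"
  have "L (pure tscale [pure s (take j ws), pure s (drop j ws)]) =
      (\<Sum>i\<le>j. pure tscale [pure s (take i ws), pure s (drop i (take j ws)), pure s (drop j ws)])"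
    if "j \<le> length ws" for j
  proof -
    have "L (pure tscale [pure s (take j ws), pure s (drop j ws)]) =
      (\<Sum>i\<le>j. pure tscale [pure s (take i (take j ws)), pure s (drop i (take j ws)), pure s (drop j ws)])"
      using that by (simp add: L(2) pure_in_alg deconcat_pure lin_sum[OF TT.tmult_linear_left]
          TT.tmult_pure min_absorb2)
    also have "\<dots> = (\<Sum>i\<le>j. pure tscale [pure s (take i ws), pure s (drop i (take j ws)), pure s (drop j ws)])"
      by (intro sum.cong refl) (simp add: min_absorb1)
    finally show ?thesis .
  qed
  thus "L (deconcat s (pure s ws)) = deconcat3 s (pure s ws)"
    unfolding deconcat_pure deconcat3_pure lin_sum[OF L(1)] by (intro sum.cong refl) simp
qed

lemma (in tensors) deconcat_coassoc_right:
  assumes L: "lin tscale tscale L"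
      "\<And>a b. a \<in> tensor_alg s \<Longrightarrow> b \<in> tensor_alg s \<Longrightarrow> L (pure tscale [a, b]) = tmult tscale (pure tscale [a]) (deconcat s b)"
    and x: "x \<in> tensor_alg s"
  shows "L (deconcat s x) = deconcat3 s x"
proof (rule lin_alg_eqI[OF lin_comp[OF deconcat_linear L(1)] deconcat3_linear _ x])
  fix ws :: "'v list"
  let ?p = "\<lambda>i j. pure tscale [pure s (take i ws), pure s (drop i (take j ws)), pure s (drop j ws)]"
  have *: "tmult tscale (pure tscale [a]) (\<Sum>k\<in>K. pure tscale (f k)) = (\<Sum>k\<in>K. pure tscale (a # f k))"
    for a :: "('v, 'k) tensor" and f and K :: "nat set"
    by (induction K rule: infinite_finite_induct)
      (auto simp: TT.tmult_zero_right TT.pure_in_alg TT.tmult_add_right TT.tmult_pure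
        T.subspace_sum TT.subspace_alg)
  have "L (pure tscale [pure s (take i ws), pure s (drop i ws)]) = (\<Sum>k\<le>length ws - i. ?p i (i + k))" for i
    by (simp add: L(2) pure_in_alg deconcat_pure * take_drop add.commute)
  from this have "L (deconcat s (pure s ws)) = (\<Sum>i\<le>length ws. \<Sum>k\<le>length ws - i. ?p i (i + k))"
    unfolding deconcat_pure lin_sum[OF L(1)] by simp
  also have "\<dots> = (\<Sum>j\<le>length ws. \<Sum>i\<le>j. ?p i j)"
    unfolding sum.Sigma[OF finite_atMost ballI[OF finite_atMost]]
    by (rule sum.reindex_bij_witness[where i = "\<lambda>(j, i). (i, j - i)" and j = "\<lambda>(i, k). (i + k, i)"]) auto
  also have "\<dots> = deconcat3 s (pure s ws)" by (simp only: deconcat3_pure)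
  finally show "L (deconcat s (pure s ws)) = deconcat3 s (pure s ws)" .
qed

locale graded_quadratic = graded_space s G + quadratic s S
  for s :: "'k::field_char_0 \<Rightarrow> 'v::ab_group_add \<Rightarrow> 'v" and G and S +
  assumes S_stable: "r \<in> S \<Longrightarrow> tmap (degree_op 2) r \<in> S"
begin

abbreviation "CG \<equiv> (\<lambda>i. C \<inter> tensor_grade s G i)"

lemma C_graded: "is_grading tscale C CG"
  by (rule stable_subspace_graded[OF subspace_C _ tmap_C(2)[OF degree_op(1) S_stable]])
    (use C_in_alg in auto)

lemma C_span: "C = T.span (\<Union>i. CG i)"
  using C_graded by (simp add: is_grading_def)

lemma tensor_two_homogeneous: "tensor_two C \<subseteq> TT.homogeneous_span CG 2"
  unfolding tensor_two_def
proof (rule T.span_minimal)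
  show "{pure tscale [a, b] |a b. a \<in> C \<and> b \<in> C} \<subseteq> TT.homogeneous_span CG 2"
    using TT.pure_in_homogeneous_span[of "[_, _]" CG] C_span by (auto simp: eval_nat_numeral)
qed (simp add: TT.homogeneous_span_def)

lemma deconcat_homogeneous: "x \<in> C \<Longrightarrow> deconcat s x \<in> TT.homogeneous_span CG 2"
  using deconcat_C tensor_two_homogeneous by blast

text \<open>Iterating \<open>\<Delta>(C) \<subseteq> C \<otimes> C\<close>.\<close>

lemma deconcat3_homogeneous:
  assumes "x \<in> C"
  shows "deconcat3 s x \<in> TT.homogeneous_span CG 3"
proof -
  obtain L where L: "lin tscale tscale L"
    "\<And>a b. a \<in> tensor_alg s \<Longrightarrow> b \<in> tensor_alg s \<Longrightarrow> L (pure tscale [a, b]) = tmult tscale (deconcat s a) (pure tscale [b])"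
    using deconcat_lift_left by blast
  have "L (deconcat s x) \<in> TT.homogeneous_span CG 3"
  proof (rule lin_span_image[OF L(1) _ _ deconcat_C[OF assms, unfolded tensor_two_def]])
    show "T.subspace (TT.homogeneous_span CG 3)" by (simp add: TT.homogeneous_span_def)
    fix z assume "z \<in> {pure tscale [a, b] |a b. a \<in> C \<and> b \<in> C}"
    then obtain a b where z: "z = pure tscale [a, b]" and ab: "a \<in> C" "b \<in> C" by blast
    have "tmult tscale (deconcat s a) (pure tscale [b]) \<in> TT.homogeneous_span CG 3"
    proof (rule lin_span_image[OF TT.tmult_linear_left _ _ deconcat_C[OF ab(1), unfolded tensor_two_def]])
      show "T.subspace (TT.homogeneous_span CG 3)" by (simp add: TT.homogeneous_span_def)
      fix y assume "y \<in> {pure tscale [a, b] |a b. a \<in> C \<and> b \<in> C}"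
      thus "tmult tscale y (pure tscale [b]) \<in> TT.homogeneous_span CG 3"
        using TT.pure_in_homogeneous_span[of "[_, _, b]" CG] ab(2) C_span
        by (auto simp: TT.tmult_pure eval_nat_numeral)
    qed
    thus "L z \<in> TT.homogeneous_span CG 3"
      unfolding z using L(2)[OF C_in_alg[OF ab(1)] C_in_alg[OF ab(2)]] by simp
  qed
  thus ?thesis by (simp only: deconcat_coassoc_left[OF L C_in_alg[OF assms]])
qed

lemma homog_ext2_C:
  assumes L: "lin tscale s' L"
    and "\<And>i j a b. a \<in> CG i \<Longrightarrow> b \<in> CG j \<Longrightarrow> L (pure tscale [a, b]) = B [i, j] [a, b]" and "x \<in> C"
  shows "homog_ext tscale CG 2 s' B (deconcat s x) = L (deconcat s x)"
proof (rule TT.homog_ext_eq[OF L _ deconcat_homogeneous[OF assms(3)]])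
  fix es and ws :: "('v, 'k) tensor list"
  assume "length ws = 2" and h: "homogeneous_word CG es ws"
  then obtain a b where ws: "ws = [a, b]" by (auto simp: length_Suc_conv numeral_2_eq_2)
  then obtain i j where "es = [i, j]" "a \<in> CG i" "b \<in> CG j"
    using h by (auto simp: homogeneous_word_def list_all2_Cons2)
  thus "L (pure tscale ws) = B es ws" using assms(2) ws by simp
qed

text \<open>The degree operator is compatible with \<open>\<Delta>\<close>, so \<open>\<Delta> x\<close> is an eigenvector for the same eigenvalue
  as \<open>x\<close>.\<close>

lemma deconcat_degree:
  assumes "x \<in> CG i"
  shows "deconcat s x \<in> tpower_grade tscale CG 2 i"
proof (rule TT.tmap_eigen_tpower_grade[OF tmap_linear _ inj_two_powi])
  let ?A = "tmap (degree_op 2)"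
  show "?A v = tscale (2 powi i) v" if "v \<in> CG i" for v i
    using that tensor_grade_iff by blast
  show "deconcat s x \<in> TT.homogeneous_span CG 2" using assms deconcat_homogeneous by blast
  have "TT.tmap ?A (deconcat s y) = deconcat s (?A y)" if "y \<in> tensor_alg s" for y
    by (rule lin_alg_eqI[OF lin_comp[OF deconcat_linear TT.tmap_linear] lin_comp[OF tmap_linear deconcat_linear] _ that])
      (simp add: deconcat_pure lin_sum[OF TT.tmap_linear] TT.tmap_pure[OF tmap_linear] tmap_pure[OF degree_op(1)] take_map drop_map)
  thus "TT.tmap ?A (deconcat s x) = tscale (2 powi i) (deconcat s x)"
    using assms tensor_grade_iff by (simp add: lin_scale[OF deconcat_linear])
qed simp

theorem quadratic_coalgebra_graded: "graded_coalgebra tscale C CG (deconcat s) tcounit"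
proof -
  have eps: "tcounit x = 0" if "x \<in> CG i" "i \<noteq> 0" for x i
  proof -
    have "x \<in> tensor_grade s G i" using that by blast
    hence "tcounit x \<in> {0}"
      unfolding tensor_grade_def
    proof (rule lin_span_image[OF tcounit_linear, rotated 2])
      fix y assume "y \<in> (\<Union>n. tpower_grade s G n i)"
      then obtain n where "y \<in> tpower_grade s G n i" by blast
      thus "tcounit y \<in> {0}" unfolding tpower_grade_def
      proof (rule lin_span_image[OF tcounit_linear, rotated 2])
        fix y assume "y \<in> {pure s ws |ws es. length ws = n \<and> homogeneous_word G es ws \<and> sum_list es = i}"
        thus "tcounit y \<in> {0}" using that(2) by (auto simp: tcounit_pure homogeneous_word_def)
      qed (simp add: subspace_zero_field)
    qed (simp add: subspace_zero_field)
    thus ?thesis by simp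
  qed
  obtain L1 where L1: "lin tscale tscale L1"
    "\<And>a b. a \<in> tensor_alg s \<Longrightarrow> b \<in> tensor_alg s \<Longrightarrow> L1 (pure tscale [a, b]) = tmult tscale (deconcat s a) (pure tscale [b])"
    using deconcat_lift_left by blast
  obtain L2 where L2: "lin tscale tscale L2"
    "\<And>a b. a \<in> tensor_alg s \<Longrightarrow> b \<in> tensor_alg s \<Longrightarrow> L2 (pure tscale [a, b]) = tmult tscale (pure tscale [a]) (deconcat s b)"
    using deconcat_lift_right by blast
  have coassoc: "homog_ext tscale CG 2 tscale (\<lambda>es ws. tmult tscale (deconcat s (ws ! 0)) (pure tscale [ws ! 1])) (deconcat s x)
      = homog_ext tscale CG 2 tscale (\<lambda>es ws. tmult tscale (pure tscale [ws ! 0]) (deconcat s (ws ! 1))) (deconcat s x)"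
    if x: "x \<in> C" for x
  proof -
    have "homog_ext tscale CG 2 tscale (\<lambda>es ws. tmult tscale (deconcat s (ws ! 0)) (pure tscale [ws ! 1])) (deconcat s x)
        = L1 (deconcat s x)"
      by (rule homog_ext2_C[OF L1(1) _ x]) (simp add: L1(2) C_in_alg)
    moreover have "homog_ext tscale CG 2 tscale (\<lambda>es ws. tmult tscale (pure tscale [ws ! 0]) (deconcat s (ws ! 1))) (deconcat s x)
        = L2 (deconcat s x)"
      by (rule homog_ext2_C[OF L2(1) _ x]) (simp add: L2(2) C_in_alg)
    ultimately show ?thesis
      by (simp only: deconcat_coassoc_left[OF L1 C_in_alg[OF x]] deconcat_coassoc_right[OF L2 C_in_alg[OF x]])
  qed
  obtain L3 where L3: "TT.left_slice (tcounit :: ('v, 'k) tensor \<Rightarrow> 'k) L3" using TT.slices_exist(2)[OF tcounit_linear] by blast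
  obtain L4 where L4: "TT.right_slice (tcounit :: ('v, 'k) tensor \<Rightarrow> 'k) L4" using TT.slices_exist(1)[OF tcounit_linear] by blast
  note L34 = L3[unfolded TT.left_slice_def] L4[unfolded TT.right_slice_def]
  have counit1: "homog_ext tscale CG 2 tscale (\<lambda>es ws. tscale (tcounit (ws ! 0)) (ws ! 1)) (deconcat s x) = x"
    if x: "x \<in> C" for x
  proof -
    have "homog_ext tscale CG 2 tscale (\<lambda>es ws. tscale (tcounit (ws ! 0)) (ws ! 1)) (deconcat s x) = L3 (deconcat s x)"
      by (rule homog_ext2_C[OF _ _ x]) (use L34 in auto)
    thus ?thesis using deconcat_counit_left[of L3, OF _ _ C_in_alg[OF x]] L34 by simp
  qed
  have counit2: "homog_ext tscale CG 2 tscale (\<lambda>es ws. tscale (tcounit (ws ! 1)) (ws ! 0)) (deconcat s x) = x"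
    if x: "x \<in> C" for x
  proof -
    have "homog_ext tscale CG 2 tscale (\<lambda>es ws. tscale (tcounit (ws ! 1)) (ws ! 0)) (deconcat s x) = L4 (deconcat s x)"
      by (rule homog_ext2_C[OF _ _ x]) (use L34 in auto)
    thus ?thesis using deconcat_counit_right[of L4, OF _ _ C_in_alg[OF x]] L34 by simp
  qed
  show ?thesis
    unfolding graded_coalgebra_def
    using vector_space_tscale C_graded lin_imp_on[OF deconcat_linear]
      lin_imp_on[OF tcounit_linear] deconcat_degree eps coassoc counit1 counit2 by blast
qed

end


section \<open>Local operators on words\<close>

context tensors
begin

lemma multilinear_tmult_pure:
  assumes "t \<in> tensor_alg s"
  shows "multilinear s tscale (\<lambda>ws. tmult s t (pure s ws))"
proof (rule multilinearI)
  fix us ws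
  have l: "lin s tscale (\<lambda>v. pure s (us @ v # ws))"
    by (rule multilinearD[OF multilinear_pure])
  show "lin s tscale (\<lambda>v. tmult s t (pure s (us @ v # ws)))"
    using assms by (simp add: lin_iff vector_space_axioms vector_space_tscale lin_add[OF l] lin_scale[OF l]
        tmult_add_right tmult_scale_right pure_in_alg)
qed

text \<open>\<open>f \<otimes> id\<close>, with \<open>f\<close> applied to the first \<open>m\<close> letters, and \<open>id \<otimes> f\<close>, with \<open>f\<close> applied to all letters after
  the \<open>m\<close>-th.\<close>

definition head_op :: "nat \<Rightarrow> (('v, 'k) tensor \<Rightarrow> ('v, 'k) tensor) \<Rightarrow> ('v, 'k) tensor \<Rightarrow> ('v, 'k) tensor"
  where "head_op m f = tlift (\<lambda>ws. tmult s (f (pure s (take m ws))) (pure s (drop m ws)))"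

definition tail_op :: "nat \<Rightarrow> (('v, 'k) tensor \<Rightarrow> ('v, 'k) tensor) \<Rightarrow> ('v, 'k) tensor \<Rightarrow> ('v, 'k) tensor"
  where "tail_op m f = tlift (\<lambda>ws. tmult s (pure s (take m ws)) (f (pure s (drop m ws))))"

definition word_op :: "(('v, 'k) tensor \<Rightarrow> ('v, 'k) tensor) \<Rightarrow> bool"
  where "word_op f \<longleftrightarrow> lin tscale tscale f \<and> (\<forall>ws. f (pure s ws) \<in> tensor_alg s)"

lemma word_op_in_alg:
  assumes "word_op f" "x \<in> tensor_alg s"
  shows "f x \<in> tensor_alg s"
  using assms(2)
  by (induction rule: alg_induct)
    (use assms(1) in \<open>auto simp: word_op_def lin_zero lin_add lin_scale alg_zero alg_add alg_scale\<close>)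

lemma head_op_linear: "lin tscale tscale (head_op m f)"
  unfolding head_op_def by (rule tlift_linear)

lemma tail_op_linear: "lin tscale tscale (tail_op m f)"
  unfolding tail_op_def by (rule tlift_linear)

lemma head_op_pure:
  assumes "word_op f"
  shows "head_op m f (pure s ws) = tmult s (f (pure s (take m ws))) (pure s (drop m ws))"
proof -
  have "multilinear s tscale (\<lambda>xs. tmult s (f (pure s xs)) (pure s ys))" for ys
    by (rule multilinear_compose[OF multilinear_pure lin_comp[OF _ tmult_linear_left]])
      (use assms in \<open>simp add: word_op_def\<close>)
  moreover have "multilinear s tscale (\<lambda>ys. tmult s (f (pure s xs)) (pure s ys))" for xs
    by (rule multilinear_tmult_pure) (use assms in \<open>simp add: word_op_def\<close>)
  ultimately show ?thesis unfolding head_op_def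
    by (intro tlift_pure multilinear_split[where B = "\<lambda>xs ys. tmult s (f (pure s xs)) (pure s ys)"])
qed

lemma tail_op_pure:
  assumes "word_op f"
  shows "tail_op m f (pure s ws) = tmult s (pure s (take m ws)) (f (pure s (drop m ws)))"
proof -
  have "multilinear s tscale (\<lambda>xs. tmult s (pure s xs) (f (pure s ys)))" for ys
    by (rule multilinear_compose[OF multilinear_pure tmult_linear_left])
  moreover have "multilinear s tscale (\<lambda>ys. tmult s (pure s xs) (f (pure s ys)))" for xs
  proof (rule multilinearI)
    fix us ws
    have f: "lin tscale tscale f" "\<And>ws. f (pure s ws) \<in> tensor_alg s"
      using assms by (auto simp: word_op_def)
    have l: "lin s tscale (\<lambda>v. pure s (us @ v # ws))"
      by (rule multilinearD[OF multilinear_pure])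
    show "lin s tscale (\<lambda>v. tmult s (pure s xs) (f (pure s (us @ v # ws))))"
      by (simp add: lin_iff vector_space_axioms vector_space_tscale lin_add[OF l] lin_scale[OF l]
          lin_add[OF f(1)] lin_scale[OF f(1)] f(2) tmult_add_right tmult_scale_right pure_in_alg)
  qed
  ultimately show ?thesis unfolding tail_op_def
    by (intro tlift_pure multilinear_split[where B = "\<lambda>xs ys. tmult s (pure s xs) (f (pure s ys))"])
qed

lemma head_op_tmult:
  assumes f: "word_op f" and x: "x \<in> tensor_power s m" and y: "y \<in> tensor_alg s"
  shows "head_op m f (tmult s x y) = tmult s (f x) y"
proof (rule lin_power_eqI[OF lin_comp[OF tmult_linear_left head_op_linear] lin_comp[OF _ tmult_linear_left] _ x])
  show "lin tscale tscale f" using f by (simp add: word_op_def)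
  fix us :: "'v list" assume us: "length us = m"
  have T: "f (pure s us) \<in> tensor_alg s" using f by (simp add: word_op_def)
  show "head_op m f (tmult s (pure s us) y) = tmult s (f (pure s us)) y"
    using y
  proof (induction rule: alg_induct)
    case (pure ws)
    thus ?case using us by (simp add: tmult_pure head_op_pure[OF f])
  qed (simp_all add: T tmult_zero_right tmult_add_right tmult_scale_right pure_in_alg
      lin_zero[OF head_op_linear] lin_add[OF head_op_linear] lin_scale[OF head_op_linear])
qed

lemma tail_op_tmult:
  assumes f: "word_op f" and x: "x \<in> tensor_power s m" and y: "y \<in> tensor_alg s"
  shows "tail_op m f (tmult s x y) = tmult s x (f y)"
proof (rule lin_power_eqI[OF lin_comp[OF tmult_linear_left tail_op_linear] tmult_linear_left _ x])
  have f': "lin tscale tscale f" using f by (simp add: word_op_def)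
  fix us :: "'v list" assume us: "length us = m"
  show "tail_op m f (tmult s (pure s us) y) = tmult s (pure s us) (f y)"
    using y
  proof (induction rule: alg_induct)
    case (pure ws)
    thus ?case using us by (simp add: tmult_pure tail_op_pure[OF f])
  qed (simp_all add: tmult_zero_right tmult_add_right tmult_scale_right pure_in_alg word_op_in_alg[OF f]
      lin_zero[OF tail_op_linear] lin_add[OF tail_op_linear] lin_scale[OF tail_op_linear]
      lin_zero[OF f'] lin_add[OF f'] lin_scale[OF f'])
qed

lemma word_op_vector:
  assumes "lin tscale s f" shows "word_op (\<lambda>x. pure s [f x])"
  unfolding word_op_def using lin_comp[OF assms pure_singleton_linear] pure_in_alg by blast

lemma word_op_scalar:
  assumes "lin tscale (*) f" shows "word_op (\<lambda>x. tscale (f x) (pure s []))"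
  unfolding word_op_def
  using lin_scalar_mult[OF assms vector_space_tscale] pure_in_alg alg_scale by blast

text \<open>\<open>f \<otimes> g\<close> without Koszul sign; signs are put into \<open>f\<close>.\<close>

definition tens where
  "tens f g = (SOME L. lin tscale tscale L \<and> (\<forall>a b. L (pure s [a, b]) = pure s [f a, g b]))"

lemma tens:
  assumes "lin s s f" "lin s s g"
  shows "lin tscale tscale (tens f g)" "tens f g (pure s [a, b]) = pure s [f a, g b]"
proof -
  have "\<exists>L. lin tscale tscale L \<and> (\<forall>a b. L (pure s [a, b]) = pure s [f a, g b])"
    using bilinear_on_lift[OF vector_space_tscale subspace_UNIV, where h = "\<lambda>a b. pure s [f a, g b]"]
      lin_imp_on[OF lin_comp[OF assms(1) pure2_linear(1)]]
      lin_imp_on[OF lin_comp[OF assms(2) pure2_linear(2)]] by (metis UNIV_I)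
  from someI_ex[OF this]
  show "lin tscale tscale (tens f g)" "tens f g (pure s [a, b]) = pure s [f a, g b]"
    by (auto simp: tens_def)
qed

text \<open>Left multiplication by \<open>w\<close> in a form that is linear on the whole type of tensors.\<close>

definition cons :: "'v \<Rightarrow> ('v, 'k) tensor \<Rightarrow> ('v, 'k) tensor"
  where "cons w = tlift (\<lambda>ws. pure s (w # ws))"

lemma cons_linear: "lin tscale tscale (cons w)"
  unfolding cons_def by (rule tlift_linear)

lemma cons_eq: "t \<in> tensor_alg s \<Longrightarrow> cons w t = tmult s (pure s [w]) t"
  by (simp add: cons_def tmult_pure_left)

lemma cons_pure: "cons w (pure s ws) = pure s (w # ws)"
  by (simp add: cons_eq pure_in_alg tmult_pure)

text \<open>The letter \<open>w\<close> goes to the left factor, except for the cut in front of it.\<close>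

lemma deconcat_cons:
  assumes "t \<in> tensor_alg s"
  shows "deconcat s (cons w t) = pure tscale [pure s [], cons w t] + TT.tens (cons w) (\<lambda>x. x) (deconcat s t)"
proof (rule lin_alg_eqI[OF lin_comp[OF cons_linear deconcat_linear] _ _ assms])
  note L = TT.tens[OF cons_linear lin_id]
  show "lin tscale tscale (\<lambda>t. pure tscale [pure s [], cons w t] + TT.tens (cons w) (\<lambda>x. x) (deconcat s t))"
    by (intro lin_plus lin_comp[OF cons_linear TT.pure2_linear(2)] lin_comp[OF deconcat_linear L(1)])
  show "deconcat s (cons w (pure s ws)) =
      pure tscale [pure s [], cons w (pure s ws)] + TT.tens (cons w) (\<lambda>x. x) (deconcat s (pure s ws))" for ws
    by (simp add: cons_pure deconcat_pure sum.atMost_Suc_shift lin_sum[OF L(1)] L(2) del: sum.atMost_Suc)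
qed

lemma lin_deconcat_eqI:
  assumes "lin tscale s' f" "lin tscale s' g"
    and "\<And>us ws. f (pure tscale [pure s us, pure s ws]) = g (pure tscale [pure s us, pure s ws])"
  shows "f (deconcat s (pure s ws)) = g (deconcat s (pure s ws))"
  by (simp add: deconcat_pure lin_sum[OF assms(1)] lin_sum[OF assms(2)] assms(3))

end


section \<open>Coderivations of degree -1 on a quadratic coalgebra\<close>

text \<open>Here \<open>V\<close> is the suspended space, in which \<open>\<Phi>\<close> has degree \<open>-1\<close>. Its degree is prescribed on \<open>S\<close> only:
  \<open>\<Phi>\<close> stands for an arbitrary linear extension of a homogeneous map on \<open>S\<close>, zero outside weight two.\<close>

locale quadratic_coderivation = graded_quadratic s G S
  for s :: "'k::field_char_0 \<Rightarrow> 'v::ab_group_add \<Rightarrow> 'v" and G S +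
  fixes \<Phi> :: "('v, 'k) tensor \<Rightarrow> 'v"
  assumes \<Phi>_linear: "lin tscale s \<Phi>"
    and \<Phi>_weight: "length ws \<noteq> 2 \<Longrightarrow> \<Phi> (pure s ws) = 0"
    and \<Phi>_degree: "r \<in> S \<Longrightarrow> r \<in> tensor_grade s G i \<Longrightarrow> \<Phi> r \<in> G (i - 1)"
begin

abbreviation tmult_infix (infixl "\<cdot>" 70) where "x \<cdot> y \<equiv> tmult s x y"
abbreviation "\<epsilon> \<equiv> degree_op (- 1)"
abbreviation "E \<equiv> tmap (degree_op (- 1))"
abbreviation "T\<^sub>V \<equiv> tensor_alg s"

text \<open>\<open>H\<close> is \<open>\<Phi> \<otimes> id\<close> on the first two letters; \<open>d\<close> is the sum of the \<open>\<epsilon>\<^sup>\<otimes>\<^sup>i \<otimes> \<Phi> \<otimes> id\<close>, the sum over \<open>j\<close>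
  being that in the definition of \<open>coderivation_of\<close>: its terms with \<open>j \<noteq> i + 2\<close> vanish.\<close>

definition "\<Phi>v x = pure s [\<Phi> x]"
definition "H = head_op 2 \<Phi>v"
definition "d = tlift (\<lambda>ws. \<Sum>j\<le>length ws. \<Sum>i\<le>j.
  pure s (map \<epsilon> (take i ws) @ [\<Phi> (pure s (drop i (take j ws)))] @ drop j ws))"

lemma S_graded: "is_grading tscale S (\<lambda>i. S \<inter> tensor_grade s G i)"
  by (rule stable_subspace_graded[OF S_sub _ S_stable]) (use S_in_alg in auto)

lemma S_span: "r \<in> S \<Longrightarrow> r \<in> T.span (\<Union>i. S \<inter> tensor_grade s G i)"
  using S_graded by (simp add: is_grading_def)

lemma tmap_S: "\<mu> \<noteq> 0 \<Longrightarrow> r \<in> S \<Longrightarrow> tmap (degree_op \<mu>) r \<in> S"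
  by (rule lin_span_image[OF tmap_linear _ S_sub S_span])
    (auto simp: tmap_tensor_grade T.subspace_scale S_sub)

lemma \<Phi>_degree_op:
  assumes "\<mu> \<noteq> 0" "r \<in> S"
  shows "degree_op \<mu> (\<Phi> r) = s (inverse \<mu>) (\<Phi> (tmap (degree_op \<mu>) r))"
proof (rule lin_eq_on_span[OF lin_comp[OF \<Phi>_linear degree_op(1)]
      lin_smult[OF lin_comp[OF tmap_linear \<Phi>_linear]] _ S_span[OF assms(2)]])
  fix r assume "r \<in> (\<Union>i. S \<inter> tensor_grade s G i)"
  then obtain i where i: "r \<in> S" "r \<in> tensor_grade s G i" by blast
  have "degree_op \<mu> (\<Phi> r) = s (\<mu> powi (i - 1)) (\<Phi> r)"
    by (rule degree_op(2)[OF \<Phi>_degree[OF i]])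
  also have "\<mu> powi (i - 1) = inverse \<mu> * \<mu> powi i"
    using assms(1) by (simp add: power_int_diff divide_inverse mult.commute)
  also have "s (inverse \<mu> * \<mu> powi i) (\<Phi> r) = s (inverse \<mu>) (\<Phi> (tmap (degree_op \<mu>) r))"
    using assms(1) i(2) by (simp add: tmap_tensor_grade lin_scale[OF \<Phi>_linear])
  finally show "degree_op \<mu> (\<Phi> r) = s (inverse \<mu>) (\<Phi> (tmap (degree_op \<mu>) r))" .
qed

lemma \<epsilon>_linear: "lin s s \<epsilon>"
  by (rule degree_op(1))

lemma \<epsilon>_\<epsilon>: "\<epsilon> (\<epsilon> v) = v"
  by (simp add: degree_op_comp degree_op_one)

lemma \<Phi>v_word_op: "word_op \<Phi>v"
  unfolding \<Phi>v_def by (rule word_op_vector[OF \<Phi>_linear])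

lemma \<Phi>v_linear: "lin tscale tscale \<Phi>v"
  using \<Phi>v_word_op by (simp add: word_op_def)

lemma \<Phi>v_weight: "length ws \<noteq> 2 \<Longrightarrow> \<Phi>v (pure s ws) = 0"
  by (simp add: \<Phi>v_def \<Phi>_weight pure_singleton_zero)

lemma H_linear: "lin tscale tscale H"
  unfolding H_def by (rule head_op_linear)

lemma H_pure: "H (pure s ws) = \<Phi>v (pure s (take 2 ws)) \<cdot> pure s (drop 2 ws)"
  unfolding H_def by (rule head_op_pure[OF \<Phi>v_word_op])

lemma H_tmult: "x \<in> tensor_power s 2 \<Longrightarrow> y \<in> T\<^sub>V \<Longrightarrow> H (x \<cdot> y) = \<Phi>v x \<cdot> y"
  unfolding H_def by (rule head_op_tmult[OF \<Phi>v_word_op])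

lemma H_short: "H (pure s []) = 0" "H (pure s [w]) = 0"
  by (simp_all add: H_pure \<Phi>v_weight tmult_zero_left)

lemma H_cons2: "H (pure s (v # w # ws)) = pure s (\<Phi> (pure s [v, w]) # ws)"
  by (simp add: H_pure \<Phi>v_def tmult_pure)

lemma d_linear: "lin tscale tscale d"
  unfolding d_def by (rule tlift_linear)

lemma d_pure: "d (pure s ws) = (\<Sum>j\<le>length ws. \<Sum>i\<le>j.
  pure s (map \<epsilon> (take i ws) @ [\<Phi> (pure s (drop i (take j ws)))] @ drop j ws))"
proof -
  let ?B = "\<lambda>xs ys zs. pure s (map \<epsilon> xs @ [\<Phi> (pure s ys)] @ zs)"
  have "multilinear s tscale (\<lambda>xs. ?B xs ys zs)" for ys zs
    using multilinear_map[OF multilinear_append_right[OF multilinear_pure] \<epsilon>_linear, of "[\<Phi> (pure s ys)] @ zs"]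
    by simp
  moreover have "multilinear s tscale (\<lambda>ys. ?B xs ys zs)" for xs zs
    using multilinear_compose[OF multilinear_pure lin_comp[OF \<Phi>_linear multilinearD[OF multilinear_pure]], of "map \<epsilon> xs" zs]
    by simp
  moreover have "multilinear s tscale (\<lambda>zs. ?B xs ys zs)" for xs ys
    using multilinear_append_left[OF multilinear_pure, of "map \<epsilon> xs @ [\<Phi> (pure s ys)]"] by simp
  ultimately have m: "multilinear s tscale (\<lambda>ws. ?B (take i (take j ws)) (drop i (take j ws)) (drop j ws))" for i j
    by (intro multilinear_split3[where B = ?B])
  have *: "(\<Sum>i\<le>j. ?B (take i ws) (drop i (take j ws)) (drop j ws))
      = (\<Sum>i\<le>j. ?B (take i (take j ws)) (drop i (take j ws)) (drop j ws))" for j ws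
    by (intro sum.cong refl) (simp add: min_absorb1)
  have "multilinear s tscale (\<lambda>ws. \<Sum>j\<le>length ws. \<Sum>i\<le>j. ?B (take i (take j ws)) (drop i (take j ws)) (drop j ws))"
    by (intro multilinear_length[of s tscale "\<lambda>n ws. \<Sum>j\<le>n. \<Sum>i\<le>j. ?B (take i (take j ws)) (drop i (take j ws)) (drop j ws)"]
        multilinear_sum vector_space_axioms vector_space_tscale m)
  from tlift_pure[OF this, of ws] show ?thesis unfolding d_def * .
qed

lemma d_Nil: "d (pure s []) = 0"
  by (simp add: d_pure \<Phi>_weight pure_singleton_zero)

lemma d_in_alg: "x \<in> T\<^sub>V \<Longrightarrow> d x \<in> T\<^sub>V"
  by (rule word_op_in_alg[of d])
    (auto simp: word_op_def d_linear d_pure intro!: T.subspace_sum subspace_alg pure_in_alg)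

lemma pure_zero_letter: "pure s (us @ 0 # ws) = 0"
  using lin_zero[OF multilinearD[OF multilinear_pure]] .

text \<open>The recursion behind all inductions: either \<open>\<Phi>\<close> eats the first two letters, or it passes the
  first letter at the cost of its sign.\<close>

lemma d_Cons: "d (pure s (w # ws)) = H (pure s (w # ws)) + cons (\<epsilon> w) (d (pure s ws))"
proof -
  let ?n = "length ws"
  let ?F = "\<lambda>vs i j. pure s (map \<epsilon> (take i vs) @ [\<Phi> (pure s (drop i (take j vs)))] @ drop j vs)"
  have "d (pure s (w # ws)) = (\<Sum>j\<le>Suc ?n. \<Sum>i\<le>j. ?F (w # ws) i j)"
    unfolding d_pure by simp
  also have "\<dots> = (\<Sum>j\<le>Suc ?n. ?F (w # ws) 0 j) + (\<Sum>j\<le>?n. \<Sum>i\<le>j. ?F (w # ws) (Suc i) (Suc j))"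
  proof -
    have split: "(\<Sum>j\<le>Suc m. \<Sum>i\<le>j. f i j) = (\<Sum>j\<le>Suc m. f 0 j) + (\<Sum>j\<le>m. \<Sum>i\<le>j. f (Suc i) (Suc j))"
      for f :: "nat \<Rightarrow> nat \<Rightarrow> ('v, 'k) tensor" and m
      by (simp only: sum.atMost_Suc_shift sum.distrib add.assoc) simp
    show ?thesis by (rule split)
  qed
  also have "(\<Sum>j\<le>Suc ?n. ?F (w # ws) 0 j) = H (pure s (w # ws))"
  proof -
    have "(\<Sum>j\<le>Suc ?n. ?F (w # ws) 0 j) = (\<Sum>j\<le>Suc ?n. if j = 2 then H (pure s (w # ws)) else 0)"
    proof (rule sum.cong[OF refl])
      fix j assume "j \<in> {..Suc ?n}"
      hence "length (take j (w # ws)) = j" by simp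
      thus "?F (w # ws) 0 j = (if j = 2 then H (pure s (w # ws)) else 0)"
        using pure_zero_letter[of "[]"] by (simp add: \<Phi>_weight H_pure \<Phi>v_def tmult_pure)
    qed
    also have "\<dots> = H (pure s (w # ws))"
      by (cases ws) (auto simp: H_short neq_Nil_conv)
    finally show ?thesis .
  qed
  also have "(\<Sum>j\<le>?n. \<Sum>i\<le>j. ?F (w # ws) (Suc i) (Suc j)) = cons (\<epsilon> w) (d (pure s ws))"
    unfolding d_pure lin_sum[OF cons_linear] by (simp add: cons_pure)
  finally show ?thesis .
qed

lemma d_cons:
  assumes "t \<in> T\<^sub>V"
  shows "d (cons w t) = H (cons w t) + cons (\<epsilon> w) (d t)"
  by (rule lin_alg_eqI[OF lin_comp[OF cons_linear d_linear]
        lin_plus[OF lin_comp[OF cons_linear H_linear] lin_comp[OF d_linear cons_linear]] _ assms])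
    (simp add: cons_pure d_Cons)

lemma d_short: "d (pure s [w]) = 0"
  by (simp add: d_Cons H_short d_Nil lin_zero[OF cons_linear])

lemma d_two: "d (pure s [v, w]) = \<Phi>v (pure s [v, w])"
  using d_Cons[of v "[w]"] by (simp add: H_cons2 d_short lin_zero[OF cons_linear] \<Phi>v_def)

lemma d_three: "d (pure s [u, v, w]) = pure s [\<Phi> (pure s [u, v]), w] + pure s [\<epsilon> u, \<Phi> (pure s [v, w])]"
  using d_Cons[of u "[v, w]"] by (simp add: H_cons2 d_two \<Phi>v_def cons_pure)

text \<open>Each term replaces two letters by one.\<close>

lemma d_in_power:
  assumes "x \<in> tensor_power s (Suc n)"
  shows "d x \<in> tensor_power s n"
proof (rule lin_power_image[OF d_linear _ subspace_power assms])
  show "d (pure s ws) \<in> tensor_power s n" if "length ws = Suc n" for ws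
    using that
  proof (induction ws arbitrary: n)
    case (Cons w ws)
    have "H (pure s (w # ws)) \<in> tensor_power s n"
    proof (cases ws)
      case Nil
      thus ?thesis by (simp add: H_short T.subspace_0 subspace_power)
    qed (use Cons.prems in \<open>auto simp: H_cons2 intro!: pure_in_power'\<close>)
    moreover have "cons (\<epsilon> w) (d (pure s ws)) \<in> tensor_power s n"
    proof (cases ws)
      case Nil
      thus ?thesis by (simp add: d_Nil lin_zero[OF cons_linear] T.subspace_0 subspace_power)
    next
      case (Cons v vs)
      then obtain m where m: "n = Suc m" "length ws = Suc m" using Cons.prems by auto
      hence "d (pure s ws) \<in> tensor_power s m" using Cons.IH by blast
      thus ?thesis using tmult_in_power[OF pure_in_power'[of "[\<epsilon> w]" 1]] m
        by (simp add: cons_eq power_in_alg)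
    qed
    ultimately show ?case by (simp add: d_Cons T.subspace_add subspace_power)
  qed simp
qed

lemma d_weight_0_1: "x \<in> tensor_power s n \<Longrightarrow> n < 2 \<Longrightarrow> d x = 0"
  by (rule lin_power_eqI[OF d_linear lin_const_zero[OF vector_space_tscale vector_space_tscale]])
    (auto simp: less_Suc_eq numeral_2_eq_2 length_Suc_conv d_Nil d_short)

text \<open>By induction on the word, with \<open>d_Cons\<close> and \<open>deconcat_cons\<close>. What remains is the cut behind the first
  letter: \<open>\<Phi>\<close> applied to two letters that it separates is not a term of either side.\<close>

lemma d_deconcat:
  assumes "x \<in> T\<^sub>V"
  shows "deconcat s (d x) = TT.tens d (\<lambda>x. x) (deconcat s x) + TT.tens E d (deconcat s x)"
proof (rule lin_alg_eqI[OF lin_comp[OF d_linear deconcat_linear] _ _ assms])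
  note id = lin_id
  note M1 = TT.tens[OF d_linear id] and M2 = TT.tens[OF tmap_linear d_linear, of \<epsilon>]
  note lam = TT.tens[OF cons_linear id]
  show "lin tscale tscale (\<lambda>x. TT.tens d (\<lambda>x. x) (deconcat s x) + TT.tens E d (deconcat s x))"
    by (intro lin_plus lin_comp[OF deconcat_linear M1(1)] lin_comp[OF deconcat_linear M2(1)])
  fix ws
  show "deconcat s (d (pure s ws)) =
    TT.tens d (\<lambda>x. x) (deconcat s (pure s ws)) + TT.tens E d (deconcat s (pure s ws))"
  proof (induction ws)
    case Nil
    show ?case
      by (simp add: d_Nil lin_zero[OF deconcat_linear] deconcat_pure M1(2) M2(2)
          lin_zero[OF TT.pure2_linear(1)] lin_zero[OF TT.pure2_linear(2)])
  next
    case (Cons w ws)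
    let ?p = "pure s (w # ws)" and ?one = "pure s [] :: ('v, 'k) tensor"
    let ?\<Delta> = "deconcat s (pure s ws)"
    note Hw = TT.tens[OF lin_comp[OF cons_linear H_linear] id, of w]
    have \<Delta>p: "deconcat s ?p = pure tscale [?one, ?p] + TT.tens (cons w) (\<lambda>x. x) ?\<Delta>"
      using deconcat_cons[OF pure_in_alg, of w ws] by (simp add: cons_pure)
    have 1: "TT.tens d (\<lambda>x. x) (TT.tens (cons w) (\<lambda>x. x) ?\<Delta>)
        = TT.tens (\<lambda>x. H (cons w x)) (\<lambda>x. x) ?\<Delta> + TT.tens (cons (\<epsilon> w)) (\<lambda>x. x) (TT.tens d (\<lambda>x. x) ?\<Delta>)"
      by (rule lin_deconcat_eqI[OF lin_comp[OF lam(1) M1(1)] lin_plus[OF Hw(1) lin_comp[OF M1(1) lam(1)]]])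
        (simp add: lam(2) M1(2) Hw(2) d_cons pure_in_alg lin_add[OF TT.pure2_linear(1)])
    have 2: "TT.tens E d (TT.tens (cons w) (\<lambda>x. x) ?\<Delta>) = TT.tens (cons (\<epsilon> w)) (\<lambda>x. x) (TT.tens E d ?\<Delta>)"
      by (rule lin_deconcat_eqI[OF lin_comp[OF lam(1) M2(1)] lin_comp[OF M2(1) lam(1)]])
        (simp add: lam(2) M2(2) cons_pure tmap_pure[OF \<epsilon>_linear])
    have 3: "deconcat s (H ?p) = pure tscale [?one, H ?p] + TT.tens (\<lambda>x. H (cons w x)) (\<lambda>x. x) ?\<Delta>"
    proof (cases ws)
      case Nil
      thus ?thesis by (simp add: H_short deconcat_pure Hw(2) cons_pure lin_zero[OF deconcat_linear]
            lin_zero[OF TT.pure2_linear(1)] lin_zero[OF TT.pure2_linear(2)])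
    next
      case (Cons v vs)
      let ?u = "\<Phi> (pure s [w, v])"
      have H: "H ?p = cons ?u (pure s vs)" using Cons by (simp add: H_cons2 cons_pure)
      have "TT.tens (\<lambda>x. H (cons w x)) (\<lambda>x. x) (TT.tens (cons v) (\<lambda>x. x) (deconcat s (pure s vs)))
          = TT.tens (cons ?u) (\<lambda>x. x) (deconcat s (pure s vs))"
        by (rule lin_deconcat_eqI[OF lin_comp[OF lam(1) Hw(1)] lam(1)])
          (simp add: lam(2) Hw(2) cons_pure H_cons2)
      moreover have "?\<Delta> = pure tscale [?one, pure s ws] + TT.tens (cons v) (\<lambda>x. x) (deconcat s (pure s vs))"
        using deconcat_cons[OF pure_in_alg, of v vs] Cons by (simp add: cons_pure)
      ultimately show ?thesis
        unfolding H deconcat_cons[OF pure_in_alg]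
        by (simp add: lin_add[OF Hw(1)] Hw(2) cons_pure H_short lin_zero[OF TT.pure2_linear(1)])
    qed
    have "deconcat s (d ?p) = deconcat s (H ?p) + pure tscale [?one, cons (\<epsilon> w) (d (pure s ws))]
        + TT.tens (cons (\<epsilon> w)) (\<lambda>x. x) (deconcat s (d (pure s ws)))"
      by (simp add: d_Cons lin_add[OF deconcat_linear] deconcat_cons d_in_alg pure_in_alg add.assoc)
    also have "\<dots> = TT.tens d (\<lambda>x. x) (deconcat s ?p) + TT.tens E d (deconcat s ?p)"
      unfolding Cons.IH 3 \<Delta>p lin_add[OF M1(1)] lin_add[OF M2(1)] 1 2 lin_add[OF lam(1)]
      by (simp add: M1(2) M2(2) d_Nil tmap_pure[OF \<epsilon>_linear] lin_zero[OF TT.pure2_linear(1)] d_Cons[of w ws]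
          lin_add[OF TT.pure2_linear(2)] algebra_simps)
    finally show ?case .
  qed
qed

text \<open>On homogeneous elements of degree \<open>i\<close> the sign \<open>(-1)\<^sup>-\<^sup>i\<close> is the effect of \<open>E\<close>, so that the trilinear map
  defining the coderivation extends from \<open>C\<close> to \<open>T(V)\<close>, where it can be computed on words.\<close>

lemma coderivation_of_eq:
  assumes f: "\<And>x. x \<in> C \<Longrightarrow> f x = \<Phi> x" and x: "x \<in> C"
  shows "coderivation_of s G C (- 1) f x = d x"
proof -
  obtain L where L: "lin tscale tscale L"
    "\<And>a b c. a \<in> T\<^sub>V \<Longrightarrow> b \<in> T\<^sub>V \<Longrightarrow> c \<in> T\<^sub>V \<Longrightarrow> L (pure tscale [a, b, c]) = E a \<cdot> \<Phi>v b \<cdot> c"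
  proof (rule TT.trilinear_on_lift[OF vector_space_tscale subspace_alg, where h = "\<lambda>a b c. E a \<cdot> \<Phi>v b \<cdot> c"])
    show "linear_on tscale tscale T\<^sub>V (\<lambda>a. E a \<cdot> \<Phi>v b \<cdot> c)" for b c
      by (rule lin_imp_on[OF lin_comp[OF lin_comp[OF tmap_linear tmult_linear_left] tmult_linear_left]])
    show "linear_on tscale tscale T\<^sub>V (\<lambda>b. E a \<cdot> \<Phi>v b \<cdot> c)" if "a \<in> T\<^sub>V" for a c
      using that by (simp add: linear_on_def lin_add[OF \<Phi>v_linear] lin_scale[OF \<Phi>v_linear] tmult_add_right
          tmult_scale_right tmult_add_left tmult_scale_left tmap_in_alg[OF \<epsilon>_linear] word_op_in_alg[OF \<Phi>v_word_op])
    show "linear_on tscale tscale T\<^sub>V (\<lambda>c. E a \<cdot> \<Phi>v b \<cdot> c)" if "a \<in> T\<^sub>V" "b \<in> T\<^sub>V" for a b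
      using that by (intro tmult_linear_right tmult_in_alg tmap_in_alg[OF \<epsilon>_linear] word_op_in_alg[OF \<Phi>v_word_op])
  qed blast
  have "coderivation_of s G C (- 1) f x = L (deconcat3 s x)"
    unfolding coderivation_of_def
  proof (rule TT.homog_ext_eq[OF L(1) _ deconcat3_homogeneous[OF x]])
    fix es and ws :: "('v, 'k) tensor list"
    assume "length ws = 3" and h: "homogeneous_word CG es ws"
    then obtain a b c where ws: "ws = [a, b, c]" by (auto simp: length_Suc_conv numeral_3_eq_3)
    then obtain i j k where es: "es = [i, j, k]" and abc: "a \<in> CG i" "b \<in> CG j" "c \<in> CG k"
      using h by (auto simp: homogeneous_word_def list_all2_Cons2)
    have "E a = tscale ((- 1) powi (- 1 * i)) a"
      using abc(1) tmap_tensor_grade[of "- 1" a i] by (simp add: power_int_minus_one_minus)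
    thus "L (pure tscale ws) = tscale ((- 1) powi (- 1 * es ! 0))
        (ws ! 0 \<cdot> pure s [f (ws ! 1)] \<cdot> ws ! 2)"
      using abc L(2)[of a b c] C_in_alg f unfolding ws es
      by (simp add: tmult_scale_left \<Phi>v_def)
  qed
  also have "L (deconcat3 s x) = d x"
  proof (rule lin_alg_eqI[OF lin_comp[OF deconcat3_linear L(1)] d_linear _ C_in_alg[OF x]])
    show "L (deconcat3 s (pure s ws)) = d (pure s ws)" for ws
      by (simp add: deconcat3_pure d_pure lin_sum[OF L(1)] L(2) pure_in_alg tmap_pure[OF \<epsilon>_linear]
          \<Phi>v_def tmult_pure)
  qed
  finally show ?thesis .
qed

end


context graded_space
begin

lemma tproj_tensor_grade:
  assumes "x \<in> tensor_grade s G i"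
  shows "tproj s n x \<in> tensor_grade s G i"
proof -
  have x: "x \<in> tensor_alg s" using assms tensor_grade_iff by blast
  have "tmap (degree_op 2) (tproj s n x) = tproj s n (tmap (degree_op 2) x)"
    by (rule lin_alg_eqI[OF lin_comp[OF tproj_linear tmap_linear] lin_comp[OF tmap_linear tproj_linear] _ x])
      (simp add: tproj_pure tmap_pure[OF degree_op(1)] lin_zero[OF tmap_linear])
  thus ?thesis
    using assms power_in_alg[OF tproj_in_power[OF x]]
    by (simp add: tensor_grade_iff lin_scale[OF tproj_linear])
qed

end

context quadratic
begin

lemma tproj_C: "x \<in> C \<Longrightarrow> tproj s 2 x \<in> S"
  by (rule lin_C_image[OF tproj_linear _ S_sub])
    (use wt_2 in \<open>auto simp: tproj_power[OF wt_in_power] T.subspace_0[OF S_sub]\<close>)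

end


section \<open>Curved coalgebras from a condition in weight three\<close>

context quadratic_coderivation
begin

lemma d_word_op: "word_op d"
  by (simp add: word_op_def d_linear d_in_alg pure_in_alg)

lemma \<Phi>v_d_word_op: "word_op (\<lambda>x. \<Phi>v (d x))"
  using lin_comp[OF d_linear \<Phi>v_linear] by (simp add: word_op_def \<Phi>v_def pure_in_alg)

text \<open>\<open>K\<close> is the part of \<open>d\<close> inside the first three letters, \<open>P\<close> the part that passes the first letter, and
  \<open>K2\<close> consists of the two overlapping insertions of \<open>\<Phi>\<close> in the first three letters.\<close>

definition "K = head_op 3 d"
definition "K2 = head_op 3 (\<lambda>x. \<Phi>v (d x))"
definition "P x = d x - H x"

lemma K_linear: "lin tscale tscale K"
  unfolding K_def by (rule head_op_linear)

lemma K2_linear: "lin tscale tscale K2"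
  unfolding K2_def by (rule head_op_linear)

lemma K2_pure: "K2 (pure s ws) = \<Phi>v (d (pure s (take 3 ws))) \<cdot> pure s (drop 3 ws)"
  unfolding K2_def by (rule head_op_pure[OF \<Phi>v_d_word_op])

lemma P_linear: "lin tscale tscale P"
  unfolding P_def[abs_def] by (rule lin_minus[OF d_linear H_linear])

lemma P_cons: "t \<in> T\<^sub>V \<Longrightarrow> P (cons w t) = cons (\<epsilon> w) (d t)"
  by (simp add: P_def d_cons)

lemma P_tmult: "t \<in> T\<^sub>V \<Longrightarrow> P (pure s [w] \<cdot> t) = pure s [\<epsilon> w] \<cdot> d t"
  using P_cons[of t w] by (simp add: cons_eq d_in_alg)

text \<open>Both sides are linear in \<open>r\<close> and in \<open>t\<close>, so products of words suffice.\<close>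

lemma tmult_words_eqI:
  assumes "lin tscale s' f" "\<And>t. t \<in> T\<^sub>V \<Longrightarrow> lin tscale s' (\<lambda>r. g r t)"
    and "\<And>us. length us = m \<Longrightarrow> linear_on tscale s' T\<^sub>V (g (pure s us))"
    and "\<And>us ws. length us = m \<Longrightarrow> f (pure s (us @ ws)) = g (pure s us) (pure s ws)"
    and r: "r \<in> tensor_power s m" and t: "t \<in> T\<^sub>V"
  shows "f (r \<cdot> t) = g r t"
proof (rule lin_power_eqI[OF lin_comp[OF tmult_linear_left assms(1)] assms(2)[OF t] _ r])
  fix us :: "'v list" assume us: "length us = m"
  show "f (pure s us \<cdot> t) = g (pure s us) t"
  proof (rule tensor_alg_eqI[where f = "\<lambda>t. f (pure s us \<cdot> t)", OF _ assms(3)[OF us] _ _ t])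
    show "linear_on tscale s' T\<^sub>V (\<lambda>t. f (pure s us \<cdot> t))"
      by (simp add: linear_on_def tmult_add_right tmult_scale_right pure_in_alg
          lin_add[OF assms(1)] lin_scale[OF assms(1)])
    show "vector_space s'" using assms(1) by (simp add: lin_iff)
    show "f (pure s us \<cdot> pure s ws) = g (pure s us) (pure s ws)" for ws
      by (simp add: tmult_pure assms(4)[OF us])
  qed
qed

lemma word2E: "length us = 2 \<Longrightarrow> (\<And>v w. us = [v, w] \<Longrightarrow> thesis) \<Longrightarrow> thesis"
  by (auto simp: length_Suc_conv numeral_2_eq_2)

text \<open>Splitting off two letters: apart from passing both of them, \<open>d\<close> acts within the first three
  letters.\<close>

lemma d_tmult2:
  assumes "r \<in> tensor_power s 2" "t \<in> T\<^sub>V"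
  shows "d (r \<cdot> t) = K (r \<cdot> t) + E r \<cdot> d t"
proof -
  have "d (r \<cdot> t) - K (r \<cdot> t) = E r \<cdot> d t"
  proof (rule tmult_words_eqI[where f = "\<lambda>x. d x - K x", OF lin_minus[OF d_linear K_linear] _ _ _ assms])
    show "lin tscale tscale (\<lambda>r. E r \<cdot> d t)" for t
      by (rule lin_comp[OF tmap_linear tmult_linear_left])
    show "linear_on tscale tscale T\<^sub>V (\<lambda>t. E (pure s us) \<cdot> d t)" for us
      by (simp add: linear_on_def tmap_pure[OF \<epsilon>_linear] lin_add[OF d_linear] lin_scale[OF d_linear]
          tmult_add_right tmult_scale_right d_in_alg pure_in_alg)
    fix us ws :: "'v list" assume "length us = 2"
    then obtain v w where us: "us = [v, w]" by (rule word2E)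
    show "d (pure s (us @ ws)) - K (pure s (us @ ws)) = E (pure s us) \<cdot> d (pure s ws)"
    proof (cases ws)
      case Nil
      thus ?thesis using us
        by (simp add: K_def head_op_pure[OF d_word_op] tmult_unit_right d_in_alg pure_in_alg d_Nil
            tmap_pure[OF \<epsilon>_linear] tmult_zero_right)
    next
      case (Cons x xs)
      have "d (pure s (us @ ws)) = pure s (\<Phi> (pure s [v, w]) # x # xs)
          + pure s (\<epsilon> v # \<Phi> (pure s [w, x]) # xs) + pure s [\<epsilon> v, \<epsilon> w] \<cdot> d (pure s ws)"
        unfolding us Cons append.simps d_Cons[of v] d_Cons[of w]
        by (simp add: H_cons2 lin_add[OF cons_linear] cons_pure cons_eq d_in_alg pure_in_alg
            tmult_in_alg tmult_assoc[symmetric] tmult_pure add.assoc)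
      moreover have "K (pure s (us @ ws)) = pure s (\<Phi> (pure s [v, w]) # x # xs)
          + pure s (\<epsilon> v # \<Phi> (pure s [w, x]) # xs)"
        unfolding us Cons by (simp add: K_def head_op_pure[OF d_word_op] numeral_3_eq_3 d_three tmult_add_left tmult_pure)
      ultimately show ?thesis using us by (simp add: tmap_pure[OF \<epsilon>_linear])
    qed
  qed
  thus ?thesis by (simp add: algebra_simps)
qed

text \<open>The terms of \<open>d\<^sup>2\<close> in which one insertion uses the first two letters. The overlapping ones form \<open>K2\<close>;
  in the others the two insertions are disjoint and occur in both orders.\<close>

lemma dH_HP_tmult2:
  assumes "r \<in> tensor_power s 2" "t \<in> T\<^sub>V"
  shows "d (H (r \<cdot> t)) + H (P (r \<cdot> t)) = K2 (r \<cdot> t) + pure s [\<epsilon> (\<Phi> r) + \<Phi> (E r)] \<cdot> d t"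
proof -
  let ?f = "\<lambda>x. d (H x) + H (P x) - K2 x"
  have lin: "lin tscale tscale ?f"
    by (intro lin_minus lin_plus lin_comp[OF H_linear d_linear] lin_comp[OF P_linear H_linear] K2_linear)
  have "?f (r \<cdot> t) = pure s [\<epsilon> (\<Phi> r) + \<Phi> (E r)] \<cdot> d t"
  proof (rule tmult_words_eqI[where f = ?f, OF lin _ _ _ assms])
    show "lin tscale tscale (\<lambda>r. pure s [\<epsilon> (\<Phi> r) + \<Phi> (E r)] \<cdot> d t)" for t
      by (rule lin_comp[OF lin_comp[OF lin_plus[OF lin_comp[OF \<Phi>_linear \<epsilon>_linear] lin_comp[OF tmap_linear \<Phi>_linear]]
              pure_singleton_linear] tmult_linear_left])
    show "linear_on tscale tscale T\<^sub>V (\<lambda>t. pure s [v] \<cdot> d t)" for v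
      by (simp add: linear_on_def lin_add[OF d_linear] lin_scale[OF d_linear]
          tmult_add_right tmult_scale_right d_in_alg pure_in_alg)
    fix us ws :: "'v list" assume "length us = 2"
    then obtain v w where us: "us = [v, w]" by (rule word2E)
    let ?u = "\<Phi> (pure s [v, w])"
    have P: "P (pure s (us @ ws)) = cons (\<epsilon> v) (H (pure s (w # ws))) + pure s [\<epsilon> v, \<epsilon> w] \<cdot> d (pure s ws)"
      using P_cons[OF pure_in_alg, of v "w # ws"] us
      by (simp add: cons_pure d_Cons lin_add[OF cons_linear] cons_eq d_in_alg pure_in_alg
            tmult_in_alg tmult_assoc[symmetric] tmult_pure)
    have HP: "H (P (pure s (us @ ws))) = H (cons (\<epsilon> v) (H (pure s (w # ws)))) + pure s [\<Phi> (E (pure s us))] \<cdot> d (pure s ws)"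
      unfolding P lin_add[OF H_linear]
      by (simp add: H_tmult pure_in_power' d_in_alg pure_in_alg \<Phi>v_def us tmap_pure[OF \<epsilon>_linear])
    have dH: "d (H (pure s (us @ ws))) = H (pure s (?u # ws)) + pure s [\<epsilon> (\<Phi> (pure s us))] \<cdot> d (pure s ws)"
      by (simp add: us H_cons2 d_Cons cons_eq d_in_alg pure_in_alg)
    have K2: "K2 (pure s (us @ ws)) = H (pure s (?u # ws)) + H (cons (\<epsilon> v) (H (pure s (w # ws))))"
    proof (cases ws)
      case Nil
      thus ?thesis using us
        by (simp add: K2_pure d_two H_short lin_zero[OF cons_linear] lin_zero[OF H_linear])
          (simp add: \<Phi>v_def[of "pure s [v, w]"] \<Phi>v_weight tmult_zero_left)
    next
      case (Cons x xs)
      thus ?thesis using us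
        by (simp add: K2_pure numeral_3_eq_3 d_three H_cons2 cons_pure
            \<Phi>v_def tmult_add_left tmult_pure lin_add[OF \<Phi>_linear]
            lin_add[OF multilinearD[OF multilinear_pure, where us = "[]", simplified]])
    qed
    show "d (H (pure s (us @ ws))) + H (P (pure s (us @ ws))) - K2 (pure s (us @ ws)) =
        pure s [\<epsilon> (\<Phi> (pure s us)) + \<Phi> (E (pure s us))] \<cdot> d (pure s ws)"
      unfolding dH HP K2 by (simp add: pure_singleton_add tmult_add_left)
  qed
  thus ?thesis by (simp add: algebra_simps)
qed

lemma d_d_tmult1:
  assumes "t \<in> T\<^sub>V"
  shows "d (d (cons w t)) - d (H (cons w t)) - H (P (cons w t)) = cons w (d (d t))"
  using assms by (simp add: d_cons P_cons lin_add[OF d_linear] d_in_alg \<epsilon>_\<epsilon>)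

text \<open>\<open>\<Phi>\<close> is odd; this makes the disjoint insertions cancel.\<close>

lemma \<epsilon>_\<Phi>: "r \<in> S \<Longrightarrow> \<epsilon> (\<Phi> r) + \<Phi> (E r) = 0"
  using \<Phi>_degree_op[of "- 1" r] by simp

lemma \<Phi>_in_wt: "\<Phi>v x \<in> tensor_power s 1"
  unfolding \<Phi>v_def by (rule pure_in_power') simp

lemma wt_factor1:
  assumes "x \<in> wt (Suc n)" shows "x \<in> tensor_prod (tensor_power s 1) (wt n)"
  using wt_factor[OF assms, of 1] wt_1 by simp

lemma wt_factor2:
  assumes "x \<in> wt n" "2 \<le> n" shows "x \<in> tensor_prod S (wt (n - 2))"
  using wt_factor[OF assms] wt_2 by simp

text \<open>Membership in \<open>slab p q\<close>. For \<open>p > 0\<close> it suffices that \<open>d x\<close> is a sum of letters followed by elements of \<open>C\<close>: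
  the letter is \<open>\<Phi>\<close> of the first two letters of \<open>x\<close>, or up to sign the first letter of \<open>x\<close>. For \<open>p = 0\<close> the
  first two letters form \<open>d\<close> of an element of weight three, or up to sign they are the first two of \<open>x\<close>.\<close>

lemma d_wt_step:
  assumes key: "\<And>c. c \<in> wt 3 \<Longrightarrow> d c \<in> S"
    and IH: "\<And>y. y \<in> wt (n - 1) \<Longrightarrow> d y \<in> wt (n - 2)" "\<And>y. y \<in> wt (n - 2) \<Longrightarrow> d y \<in> wt (n - 3)"
    and n: "n \<ge> 2" and x: "x \<in> wt n"
  shows "d x \<in> wt (n - 1)"
proof -
  have "d x \<in> slab p q" if pq: "p + 2 + q = n - 1" for p q
  proof (cases "p = 0")
    case False
    then obtain m where p: "p = 1 + m" by (metis Suc_eq_plus1_left not0_implies_Suc)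
    have slab: "v \<cdot> z \<in> slab p q" if "v \<in> tensor_power s 1" "z \<in> wt (n - 2)" for v z
      unfolding p using that pq p by (intro slab_mult_left) (auto simp: wt_iff)
    have "H x \<in> slab p q"
      by (rule lin_prod_image[OF H_linear _ subspace_slab wt_factor2[OF x n]])
        (use S_square in \<open>auto simp: H_tmult wt_in_alg intro!: slab \<Phi>_in_wt\<close>)
    moreover have "P x \<in> slab p q"
    proof (rule lin_prod_image[OF P_linear _ subspace_slab])
      show "x \<in> tensor_prod (tensor_power s 1) (wt (n - 1))"
        using wt_factor1[of x "n - 1"] x n by simp
      fix a b assume "a \<in> tensor_power s 1" and b: "b \<in> wt (n - 1)"
      then obtain w where a: "a = pure s [w]" using power_one by blast
      show "P (a \<cdot> b) \<in> slab p q"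
        using IH(1)[OF b] b by (auto simp: a P_tmult wt_in_alg intro!: slab pure_in_power')
    qed
    ultimately have "H x + P x \<in> slab p q" by (rule T.subspace_add[OF subspace_slab])
    thus ?thesis by (simp add: P_def)
  next
    case True
    have n3: "3 \<le> n" using pq by simp
    have q: "q = n - 3" using pq True by simp
    have slab: "r \<cdot> z \<in> slab p q" if "r \<in> S" "z \<in> tensor_power s q" for r z
      using slab_mult_right[of r 0 0 z q] that True by (simp add: slab_0_0)
    have "K x \<in> slab p q"
      by (rule lin_prod_image[OF K_linear _ subspace_slab wt_factor[OF x n3]])
        (auto simp: K_def head_op_tmult[OF d_word_op] wt_in_power wt_in_alg q intro!: slab[unfolded q] key)
    moreover have "d x - K x \<in> slab p q"
    proof (rule lin_prod_image[OF lin_minus[OF d_linear K_linear] _ subspace_slab wt_factor2[OF x n]])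
      fix r b assume r: "r \<in> S" and b: "b \<in> wt (n - 2)"
      have "d (r \<cdot> b) - K (r \<cdot> b) = E r \<cdot> d b"
        using d_tmult2[of r b] r b S_square by (auto simp: wt_in_alg)
      thus "d (r \<cdot> b) - K (r \<cdot> b) \<in> slab p q"
        using IH(2)[OF b] r slab[of "E r" "d b"] tmap_S[of "- 1" r] by (simp add: wt_in_power q)
    qed
    ultimately have "K x + (d x - K x) \<in> slab p q" by (rule T.subspace_add[OF subspace_slab])
    thus ?thesis by simp
  qed
  moreover have "d x \<in> tensor_power s (n - 1)"
    using d_in_power[of x "n - 1"] wt_in_power[OF x] n by simp
  ultimately show ?thesis by (simp add: wt_iff)
qed

lemma d_wt:
  assumes key: "\<And>c. c \<in> wt 3 \<Longrightarrow> d c \<in> S"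
  shows "x \<in> wt n \<Longrightarrow> d x \<in> wt (n - 1)"
proof (induction n arbitrary: x rule: less_induct)
  case (less n)
  show ?case
  proof (cases "n < 2")
    case True
    thus ?thesis using d_weight_0_1[OF wt_in_power[OF less.prems]] by (simp add: T.subspace_0 subspace_wt)
  next
    case False
    have 1: "d y \<in> wt (n - 2)" if "y \<in> wt (n - 1)" for y
      using less.IH[of "n - 1" y] False that by (simp add: numeral_2_eq_2)
    have 2: "d y \<in> wt (n - 3)" if "y \<in> wt (n - 2)" for y
      using less.IH[of "n - 2" y] False that by (simp add: numeral_2_eq_2 numeral_3_eq_3)
    show ?thesis by (rule d_wt_step[OF key 1 2 _ less.prems]) (use False in simp_all)
  qed
qed

text \<open>On \<open>C\<close> the map \<open>\<Phi>\<close> is applied to elements of \<open>S\<close> only, where it has degree \<open>-1\<close>.\<close>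

lemma d_degree_op:
  assumes \<mu>: "\<mu> \<noteq> 0"
  shows "x \<in> wt n \<Longrightarrow> tmap (degree_op \<mu>) (d x) = tscale (inverse \<mu>) (d (tmap (degree_op \<mu>) x))"
proof (induction n arbitrary: x rule: less_induct)
  case (less n)
  let ?A = "tmap (degree_op \<mu>)"
  note a = degree_op(1)[of \<mu>]
  show ?case
  proof (cases "n < 2")
    case True
    thus ?thesis
      using d_weight_0_1[OF wt_in_power[OF less.prems]] d_weight_0_1[OF tmap_in_power[OF a wt_in_power[OF less.prems]]]
      by (simp add: lin_zero[OF tmap_linear])
  next
    case False
    hence n: "2 \<le> n" by simp
    have "?A (H x) = tscale (inverse \<mu>) (H (?A x))"
    proof (rule lin_prod_eqI[OF lin_comp[OF H_linear tmap_linear]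
          lin_smult[OF lin_comp[OF tmap_linear H_linear]] _ wt_factor2[OF less.prems n]])
      fix r b assume r: "r \<in> S" and b: "b \<in> wt (n - 2)"
      have rT: "r \<in> tensor_power s 2" "r \<in> T\<^sub>V" "?A r \<in> tensor_power s 2" "?A b \<in> T\<^sub>V" "b \<in> T\<^sub>V"
        using r b S_square S_in_alg tmap_in_power[OF a] tmap_in_alg[OF a] wt_in_alg by auto
      have "?A (H (r \<cdot> b)) = pure s [degree_op \<mu> (\<Phi> r)] \<cdot> ?A b"
        using rT by (simp add: H_tmult \<Phi>v_def tmap_tmult[OF a] pure_in_alg tmap_pure[OF a])
      also have "\<dots> = tscale (inverse \<mu>) (\<Phi>v (?A r) \<cdot> ?A b)"
        by (simp add: \<Phi>_degree_op[OF \<mu> r] pure_singleton_scale tmult_scale_left \<Phi>v_def)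
      also have "\<Phi>v (?A r) \<cdot> ?A b = H (?A (r \<cdot> b))"
        using rT by (simp add: H_tmult tmap_tmult[OF a])
      finally show "?A (H (r \<cdot> b)) = tscale (inverse \<mu>) (H (?A (r \<cdot> b)))" .
    qed
    moreover have "?A (P x) = tscale (inverse \<mu>) (P (?A x))"
    proof (rule lin_prod_eqI[OF lin_comp[OF P_linear tmap_linear]
          lin_smult[OF lin_comp[OF tmap_linear P_linear]]])
      show "x \<in> tensor_prod (tensor_power s 1) (wt (n - 1))"
        using wt_factor1[of x "n - 1"] less.prems n by simp
      fix v b assume "v \<in> tensor_power s 1" and b: "b \<in> wt (n - 1)"
      then obtain w where v: "v = pure s [w]" using power_one by blast
      have bT: "b \<in> T\<^sub>V" "?A b \<in> T\<^sub>V" using b wt_in_alg tmap_in_alg[OF a] by auto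
      have "degree_op \<mu> (\<epsilon> w) = \<epsilon> (degree_op \<mu> w)" using \<mu> by (simp add: degree_op_comp)
      moreover have "?A (d b) = tscale (inverse \<mu>) (d (?A b))"
        using less.IH[OF _ b] n by simp
      ultimately show "?A (P (v \<cdot> b)) = tscale (inverse \<mu>) (P (?A (v \<cdot> b)))"
        using bT by (simp add: v P_tmult tmap_tmult[OF a] pure_in_alg d_in_alg tmap_pure[OF a] tmult_scale_right)
    qed
    moreover have "d x = H x + P x" "d (?A x) = H (?A x) + P (?A x)" by (simp_all add: P_def)
    ultimately show ?thesis
      by (simp add: lin_add[OF tmap_linear] T.scale_right_distrib)
  qed
qed

end

text \<open>The last three conditions say that \<open>d(C\<^sub>3) \<subseteq> S\<close> and that \<open>d\<^sup>2 = \<Theta> \<otimes> id - id \<otimes> \<Theta>\<close> and \<open>\<Theta> d = 0\<close> hold in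
  weight three.\<close>

locale curved_quadratic = quadratic_coderivation s G S \<Phi>
  for s :: "'k::field_char_0 \<Rightarrow> 'v::ab_group_add \<Rightarrow> 'v" and G S \<Phi> +
  fixes \<Theta> :: "('v, 'k) tensor \<Rightarrow> 'k"
  assumes \<Theta>_linear: "lin tscale (*) \<Theta>"
    and \<Theta>_weight: "length ws \<noteq> 2 \<Longrightarrow> \<Theta> (pure s ws) = 0"
    and \<Theta>_degree: "r \<in> S \<Longrightarrow> r \<in> tensor_grade s G i \<Longrightarrow> i \<noteq> 2 \<Longrightarrow> \<Theta> r = 0"
    and d_wt_3: "c \<in> wt 3 \<Longrightarrow> d c \<in> S"
    and \<Phi>_d_wt_3: "c \<in> wt 3 \<Longrightarrow> \<Phi>v (d c) =
      head_op 2 (\<lambda>x. tscale (\<Theta> x) (pure s [])) c - tail_op 1 (\<lambda>x. tscale (\<Theta> x) (pure s [])) c"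
    and \<Theta>_d_wt_3: "c \<in> wt 3 \<Longrightarrow> \<Theta> (d c) = 0"
begin

text \<open>\<open>Fl\<close> and \<open>Fr\<close> are \<open>(\<Theta> \<otimes> id) \<Delta>\<close> and \<open>(id \<otimes> \<Theta>) \<Delta>\<close>; words of length below two are sent to zero because
  \<open>\<Theta>\<close> vanishes on them.\<close>

definition "\<Theta>s x = tscale (\<Theta> x) (pure s [])"
definition "Fl = head_op 2 \<Theta>s"
definition "Fr = tlift (\<lambda>ws. tscale (\<Theta> (pure s (drop (length ws - 2) ws))) (pure s (take (length ws - 2) ws)))"
definition "F x = Fl x - Fr x"
definition "K3 = head_op 3 F"

lemma \<Theta>s_word_op: "word_op \<Theta>s"
  unfolding \<Theta>s_def by (rule word_op_scalar[OF \<Theta>_linear])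

lemma Fl_linear: "lin tscale tscale Fl"
  unfolding Fl_def by (rule head_op_linear)

lemma Fl_pure: "Fl (pure s ws) = tscale (\<Theta> (pure s (take 2 ws))) (pure s (drop 2 ws))"
  unfolding Fl_def by (simp add: head_op_pure[OF \<Theta>s_word_op] \<Theta>s_def tmult_scale_left tmult_pure)

lemma Fr_linear: "lin tscale tscale Fr"
  unfolding Fr_def by (rule tlift_linear)

lemma Fr_pure: "Fr (pure s ws) = tscale (\<Theta> (pure s (drop (length ws - 2) ws))) (pure s (take (length ws - 2) ws))"
  unfolding Fr_def
proof (rule tlift_pure, rule multilinear_length[of s tscale "\<lambda>n ws. tscale (\<Theta> (pure s (drop (n - 2) ws))) (pure s (take (n - 2) ws))"])
  have "multilinear s tscale (\<lambda>xs. tscale c (pure s xs))" for c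
    by (rule multilinear_smult[OF multilinear_pure])
  moreover have "multilinear s tscale (\<lambda>ys. tscale (\<Theta> (pure s ys)) t)" for t :: "('v, 'k) tensor"
    by (rule multilinear_compose[OF multilinear_pure lin_scalar_mult[OF \<Theta>_linear vector_space_tscale]])
  ultimately show "multilinear s tscale (\<lambda>ws. tscale (\<Theta> (pure s (drop (n - 2) ws))) (pure s (take (n - 2) ws)))" for n
    by (intro multilinear_split[where B = "\<lambda>xs ys. tscale (\<Theta> (pure s ys)) (pure s xs)"])
qed

lemma F_linear: "lin tscale tscale F"
  unfolding F_def[abs_def] by (rule lin_minus[OF Fl_linear Fr_linear])

lemma F_word_op: "word_op F"
  unfolding word_op_def F_def
  using lin_minus[OF Fl_linear Fr_linear]
  by (auto simp: Fl_pure Fr_pure intro!: T.subspace_diff subspace_alg alg_scale pure_in_alg)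

lemma F_short: "length ws \<le> 2 \<Longrightarrow> F (pure s ws) = 0"
  by (cases "length ws = 2") (simp_all add: F_def Fl_pure Fr_pure \<Theta>_weight)

lemma contract_left:
  assumes L: "TT.left_slice \<Theta> L" and x: "x \<in> T\<^sub>V"
  shows "L (deconcat s x) = Fl x"
proof (rule lin_alg_eqI[OF lin_comp[OF deconcat_linear] Fl_linear _ x])
  show L1: "lin tscale tscale L" using L by (simp add: TT.left_slice_def)
  fix ws
  have "L (deconcat s (pure s ws)) = (\<Sum>i\<le>length ws. if i = 2 then Fl (pure s ws) else 0)"
    unfolding deconcat_pure lin_sum[OF L1]
    by (intro sum.cong refl) (use L in \<open>auto simp: TT.left_slice_def Fl_pure \<Theta>_weight\<close>)
  also have "\<dots> = Fl (pure s ws)" by (auto simp: Fl_pure \<Theta>_weight)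
  finally show "L (deconcat s (pure s ws)) = Fl (pure s ws)" .
qed

lemma contract_right:
  assumes L: "TT.right_slice \<Theta> L" and x: "x \<in> T\<^sub>V"
  shows "L (deconcat s x) = Fr x"
proof (rule lin_alg_eqI[OF lin_comp[OF deconcat_linear] Fr_linear _ x])
  show L1: "lin tscale tscale L" using L by (simp add: TT.right_slice_def)
  fix ws
  have "L (deconcat s (pure s ws)) = (\<Sum>i\<le>length ws. if i = length ws - 2 then Fr (pure s ws) else 0)"
    unfolding deconcat_pure lin_sum[OF L1]
    by (intro sum.cong refl) (use L in \<open>auto simp: TT.right_slice_def Fr_pure \<Theta>_weight\<close>)
  also have "\<dots> = Fr (pure s ws)" by simp
  finally show "L (deconcat s (pure s ws)) = Fr (pure s ws)" .
qed

text \<open>The sum of the insertions \<open>\<theta> \<otimes> id - id \<otimes> \<theta>\<close> at all places telescopes to the difference of the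
  outermost ones.\<close>

lemma F_cons:
  assumes "2 \<le> m" "t \<in> tensor_power s m"
  shows "F (cons w t) - K3 (cons w t) = cons w (F t)"
proof (rule lin_power_eqI[OF _ lin_comp[OF F_linear cons_linear] _ assms(2)])
  show "lin tscale tscale (\<lambda>t. F (cons w t) - K3 (cons w t))"
    unfolding K3_def by (rule lin_minus[OF lin_comp[OF cons_linear F_linear] lin_comp[OF cons_linear head_op_linear]])
  fix ws :: "'v list" assume "length ws = m"
  then obtain u v vs where ws: "ws = u # v # vs" using assms(1)
    by (metis Suc_le_length_iff numeral_2_eq_2)
  have K3: "K3 (pure s (w # ws)) = tscale (\<Theta> (pure s [w, u])) (pure s (v # vs)) - tscale (\<Theta> (pure s [u, v])) (pure s (w # vs))"
    by (simp add: ws K3_def head_op_pure[OF F_word_op] numeral_3_eq_3 F_def Fl_pure Fr_pure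
        lin_diff[OF tmult_linear_left] tmult_scale_left tmult_pure)
  have "Fr (pure s (w # ws)) = cons w (Fr (pure s ws))"
    by (simp add: Fr_pure ws Suc_diff_le lin_scale[OF cons_linear] cons_pure)
  thus "F (cons w (pure s ws)) - K3 (cons w (pure s ws)) = cons w (F (pure s ws))"
    unfolding cons_pure K3 by (simp add: F_def Fl_pure ws lin_diff[OF cons_linear] lin_scale[OF cons_linear] cons_pure)
qed

lemma \<Phi>_d_F: "c \<in> wt 3 \<Longrightarrow> \<Phi>v (d c) = F c"
proof -
  assume c: "c \<in> wt 3"
  have "head_op 2 \<Theta>s c - tail_op 1 \<Theta>s c = F c"
  proof (rule lin_power_eqI[OF lin_minus[OF head_op_linear tail_op_linear] F_linear _ wt_in_power[OF c]])
    fix ws :: "'v list" assume "length ws = 3"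
    then obtain u v w where ws: "ws = [u, v, w]" by (auto simp: length_Suc_conv numeral_3_eq_3)
    show "head_op 2 \<Theta>s (pure s ws) - tail_op 1 \<Theta>s (pure s ws) = F (pure s ws)"
      by (simp add: ws F_def Fl_def Fr_pure tail_op_pure[OF \<Theta>s_word_op] \<Theta>s_def tmult_scale_right pure_in_alg tmult_pure)
  qed
  thus ?thesis using \<Phi>_d_wt_3[OF c] by (simp add: \<Theta>s_def[abs_def])
qed

text \<open>Two insertions of \<open>\<Phi>\<close> at disjoint places cancel by the sign rule; the overlapping ones act on three
  consecutive letters, where they agree with \<open>\<theta> \<otimes> id - id \<otimes> \<theta>\<close>.\<close>

lemma d_d_wt: "x \<in> wt n \<Longrightarrow> d (d x) = F x"
proof (induction n arbitrary: x rule: less_induct)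
  case (less n)
  show ?case
  proof (cases "n \<le> 2")
    case True
    have "F x = 0"
      by (rule lin_power_eqI[OF F_linear lin_const_zero[OF vector_space_tscale vector_space_tscale] _ wt_in_power[OF less.prems]])
        (use True F_short in auto)
    moreover have "d (d x) = 0"
    proof (cases n)
      case 0
      thus ?thesis using d_weight_0_1[OF wt_in_power[OF less.prems]] by (simp add: lin_zero[OF d_linear])
    next
      case (Suc m)
      thus ?thesis using d_weight_0_1[OF d_in_power[of x m]] wt_in_power[OF less.prems] True by simp
    qed
    ultimately show ?thesis by simp
  next
    case False
    hence n: "3 \<le> n" "2 \<le> n" by simp_all
    (* Insertions involving the first two letters reduce to K2, and K2 to K3 by the weight three condition. *)
    have "d (H x) + H (P x) = K2 x"
    proof (rule lin_prod_eqI[OF lin_plus[OF lin_comp[OF H_linear d_linear] lin_comp[OF P_linear H_linear]]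
          K2_linear _ wt_factor2[OF less.prems n(2)]])
      fix r b assume r: "r \<in> S" and b: "b \<in> wt (n - 2)"
      thus "d (H (r \<cdot> b)) + H (P (r \<cdot> b)) = K2 (r \<cdot> b)"
        using dH_HP_tmult2[of r b] S_square \<epsilon>_\<Phi>[OF r] wt_in_alg[OF b]
        by (auto simp: pure_singleton_zero tmult_zero_left)
    qed
    also have "K2 x = K3 x"
      by (rule lin_prod_eqI[OF K2_linear _ _ wt_factor[OF less.prems n(1)]])
        (simp_all add: K2_def K3_def head_op_linear head_op_tmult[OF \<Phi>v_d_word_op] head_op_tmult[OF F_word_op]
          wt_in_power wt_in_alg \<Phi>_d_F)
    finally have 1: "d (H x) + H (P x) = K3 x" .
    (* The remaining insertions pass the first letter twice, without sign. *)
    have "d (d x) - d (H x) - H (P x) = F x - K3 x"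
    proof (rule lin_prod_eqI[where f = "\<lambda>x. d (d x) - d (H x) - H (P x)" and g = "\<lambda>x. F x - K3 x"])
      show "lin tscale tscale (\<lambda>x. d (d x) - d (H x) - H (P x))"
        by (intro lin_minus lin_comp[OF d_linear d_linear] lin_comp[OF H_linear d_linear] lin_comp[OF P_linear H_linear])
      show "lin tscale tscale (\<lambda>x. F x - K3 x)"
        unfolding K3_def by (rule lin_minus[OF F_linear head_op_linear])
      show "x \<in> tensor_prod (tensor_power s 1) (wt (n - 1))"
        using wt_factor1[of x "n - 1"] less.prems n by simp
      fix v t assume "v \<in> tensor_power s 1" and t: "t \<in> wt (n - 1)"
      then obtain w where v: "v = pure s [w]" using power_one by blast
      have "v \<cdot> t = cons w t" using v wt_in_alg[OF t] by (simp add: cons_eq)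
      moreover have "d (d t) = F t" using less.IH[OF _ t] n by simp
      ultimately show "d (d (v \<cdot> t)) - d (H (v \<cdot> t)) - H (P (v \<cdot> t)) = F (v \<cdot> t) - K3 (v \<cdot> t)"
        using d_d_tmult1[OF wt_in_alg[OF t]] F_cons[OF _ wt_in_power[OF t]] n by simp
    qed
    with 1 show ?thesis by (simp add: algebra_simps)
  qed
qed

lemma \<Theta>_tproj: "x \<in> T\<^sub>V \<Longrightarrow> \<Theta> x = \<Theta> (tproj s 2 x)"
  by (rule lin_alg_eqI[OF \<Theta>_linear lin_comp[OF tproj_linear \<Theta>_linear]])
    (simp_all add: tproj_pure \<Theta>_weight lin_zero[OF \<Theta>_linear])

lemma \<Theta>_d_wt:
  assumes x: "x \<in> wt n"
  shows "\<Theta> (d x) = 0"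
proof (cases "n = 3")
  case True
  thus ?thesis using \<Theta>_d_wt_3 x by simp
next
  case False
  have "tproj s 2 (d x) = 0"
  proof (cases n)
    case 0
    thus ?thesis using d_weight_0_1[OF wt_in_power[OF x]] by (simp add: lin_zero[OF tproj_linear])
  next
    case (Suc m)
    thus ?thesis using tproj_power[OF d_in_power[of x m], of 2] wt_in_power[OF x] False by simp
  qed
  thus ?thesis using \<Theta>_tproj[OF d_in_alg[OF wt_in_alg[OF x]]] by (simp add: lin_zero[OF \<Theta>_linear])
qed

theorem curved_quadratic_coalgebra:
  assumes D: "\<And>x. x \<in> C \<Longrightarrow> D x = d x" and h: "\<And>x. x \<in> C \<Longrightarrow> h x = \<Theta> x"
  shows "curved_dg_coalgebra tscale C CG (deconcat s) tcounit D h"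
proof -
  note id = lin_id
  have dC: "d x \<in> C" if "x \<in> C" for x
    by (rule lin_C_image[OF d_linear _ subspace_C that]) (use d_wt[OF d_wt_3] wt_subset_C in blast)
  have D_degree: "D x \<in> CG (i + - 1)" if x: "x \<in> CG i" for x i
  proof -
    have xC: "x \<in> C" and "tmap (degree_op 2) x = tscale (2 powi i) x"
      using x tensor_grade_iff by auto
    moreover have "tmap (degree_op 2) (d x) = tscale (inverse 2) (d (tmap (degree_op 2) x))"
      by (rule lin_C_eqI[OF lin_comp[OF d_linear tmap_linear] lin_smult[OF lin_comp[OF tmap_linear d_linear]] d_degree_op xC]) simp_all
    moreover have "(2::'k) powi (i - 1) = inverse 2 * 2 powi i" by (simp add: power_int_diff)
    ultimately have "tmap (degree_op 2) (d x) = tscale (2 powi (i - 1)) (d x)"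
      by (simp add: lin_scale[OF d_linear])
    thus ?thesis using dC[OF xC] C_in_alg D[OF xC] by (simp add: tensor_grade_iff)
  qed
  have "coderivation tscale C CG (deconcat s) (- 1) D"
    unfolding coderivation_def
  proof (intro conjI allI ballI)
    show "linear_on tscale tscale C D"
      using D by (simp add: linear_on_def T.subspace_add[OF subspace_C] T.subspace_scale[OF subspace_C]
          lin_add[OF d_linear] lin_scale[OF d_linear])
    show "D x \<in> C" if "x \<in> C" for x using that D dC by simp
    show "D x \<in> CG (i + - 1)" if "x \<in> CG i" for x i by (rule D_degree[OF that])
    fix x assume x: "x \<in> C"
    have "homog_ext tscale CG 2 tscale (\<lambda>es ws. pure tscale [D (ws ! 0), ws ! 1]) (deconcat s x)
        = TT.tens d (\<lambda>x. x) (deconcat s x)"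
      by (rule homog_ext2_C[OF TT.tens(1)[OF d_linear id] _ x]) (simp add: TT.tens(2)[OF d_linear id] D)
    moreover have "homog_ext tscale CG 2 tscale
        (\<lambda>es ws. tscale ((- 1) powi (- 1 * es ! 0)) (pure tscale [ws ! 0, D (ws ! 1)])) (deconcat s x)
        = TT.tens E d (deconcat s x)"
    proof (rule homog_ext2_C[OF TT.tens(1)[OF tmap_linear d_linear] _ x])
      fix i j a b assume a: "a \<in> CG i" and b: "b \<in> CG j"
      have "E a = tscale ((- 1) powi (- 1 * i)) a"
        using a tmap_tensor_grade[of "- 1" a i] by (simp add: power_int_minus_one_minus)
      thus "TT.tens E d (pure tscale [a, b]) = tscale ((- 1) powi (- 1 * [i, j] ! 0)) (pure tscale [[a, b] ! 0, D ([a, b] ! 1)])"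
        using b by (simp add: TT.tens(2)[OF tmap_linear d_linear] D lin_scale[OF TT.pure2_linear(1)])
    qed
    ultimately show "deconcat s (D x) =
        homog_ext tscale CG 2 tscale (\<lambda>es ws. pure tscale [D (ws ! 0), ws ! 1]) (deconcat s x) +
        homog_ext tscale CG 2 tscale
          (\<lambda>es ws. tscale ((- 1) powi (- 1 * es ! 0)) (pure tscale [ws ! 0, D (ws ! 1)])) (deconcat s x)"
      using d_deconcat[OF C_in_alg[OF x]] D[OF x] by simp
  qed
  moreover have "D (D x) =
      homog_ext tscale CG 2 tscale (\<lambda>es ws. tscale (h (ws ! 0)) (ws ! 1)) (deconcat s x) -
      homog_ext tscale CG 2 tscale (\<lambda>es ws. tscale (h (ws ! 1)) (ws ! 0)) (deconcat s x)" if x: "x \<in> C" for x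
  proof -
    obtain L where L: "TT.left_slice \<Theta> L" using TT.slices_exist(2)[OF \<Theta>_linear] by blast
    obtain L' where L': "TT.right_slice \<Theta> L'" using TT.slices_exist(1)[OF \<Theta>_linear] by blast
    have "homog_ext tscale CG 2 tscale (\<lambda>es ws. tscale (h (ws ! 0)) (ws ! 1)) (deconcat s x) = L (deconcat s x)"
      by (rule homog_ext2_C[OF _ _ x]) (use L h in \<open>auto simp: TT.left_slice_def\<close>)
    moreover have "homog_ext tscale CG 2 tscale (\<lambda>es ws. tscale (h (ws ! 1)) (ws ! 0)) (deconcat s x) = L' (deconcat s x)"
      by (rule homog_ext2_C[OF _ _ x]) (use L' h in \<open>auto simp: TT.right_slice_def\<close>)
    moreover have "d (d x) = F x"
      by (rule lin_C_eqI[OF lin_comp[OF d_linear d_linear] F_linear d_d_wt x])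
    ultimately show ?thesis
      using contract_left[OF L C_in_alg[OF x]] contract_right[OF L' C_in_alg[OF x]] x D dC
      by (simp add: F_def)
  qed
  moreover have "h (D x) = 0" if x: "x \<in> C" for x
  proof -
    have "\<Theta> (d x) = 0"
      by (rule lin_C_eqI[OF lin_comp[OF d_linear \<Theta>_linear] lin_const_zero[OF vector_space_tscale vector_space_mult] \<Theta>_d_wt x])
    thus ?thesis using x D h dC by simp
  qed
  moreover have "linear_on tscale (*) C h"
    using h by (simp add: linear_on_def T.subspace_add[OF subspace_C] T.subspace_scale[OF subspace_C]
        lin_add[OF \<Theta>_linear] lin_scale[OF \<Theta>_linear])
  moreover have "h x = 0" if "x \<in> CG i" "i \<noteq> 2" for x i
    using that h \<Theta>_tproj[of x] \<Theta>_degree[OF tproj_C tproj_tensor_grade] C_in_alg by force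
  ultimately show ?thesis
    unfolding curved_dg_coalgebra_def using quadratic_coalgebra_graded by blast
qed

end


section \<open>Quadratic-linear-constant algebras\<close>

lemma is_grading_susp:
  assumes "is_grading s UNIV V"
  shows "is_grading s UNIV (susp V)"
proof -
  have "V i = susp V (i + 1)" for i by (simp add: susp_def)
  hence U: "(\<Union>i. susp V i) = (\<Union>i. V i)" by (fastforce simp: susp_def)
  have direct: "\<forall>i\<in>I. f i = 0" if "finite I" "\<forall>i\<in>I. f i \<in> V i" "sum f I = 0" for I f
    using assms that unfolding is_grading_def by blast
  have "\<forall>i\<in>I. f i = 0" if *: "finite I" "\<forall>i\<in>I. f i \<in> susp V i" "sum f I = 0" for I f
  proof -
    let ?J = "(\<lambda>i. i - 1) ` I" and ?g = "\<lambda>j. f (j + 1)"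
    have "sum ?g ?J = sum f I" by (subst sum.reindex) (auto simp: inj_on_def)
    hence 0: "sum ?g ?J = 0" using *(3) by (rule trans)
    have V: "\<forall>j\<in>?J. ?g j \<in> V j" using *(2) by (auto simp: susp_def)
    have fin: "finite ?J" by (rule finite_imageI[OF *(1)])
    have J: "\<forall>j\<in>?J. ?g j = 0" by (rule direct[OF fin V 0])
    show ?thesis
    proof
      fix i assume "i \<in> I"
      hence "?g (i - 1) = 0" using J by blast
      thus "f i = 0" by simp
    qed
  qed
  thus ?thesis using assms unfolding is_grading_def U by (simp add: susp_def)
qed

lemma lin_subspace_image:
  assumes "lin s s' f" "module.subspace s U"
  shows "module.subspace s' (f ` U)"
proof -
  interpret f: Vector_Spaces.linear s s' f by fact
  show ?thesis by (rule f.subspace_image[OF assms(2)])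
qed

locale qlc =
  fixes s :: "'k::field_char_0 \<Rightarrow> 'v::ab_group_add \<Rightarrow> 'v" and V :: "int \<Rightarrow> 'v set"
    and R :: "('v, 'k) tensor set" and \<phi> :: "('v, 'k) tensor \<Rightarrow> 'v" and \<theta> :: "('v, 'k) tensor \<Rightarrow> 'k"
  assumes datum: "qlc_datum s V R" and maps: "qlc_maps s V R \<phi> \<theta>"
begin

lemma vector_space_s: "vector_space s" and graded_V: "is_grading s UNIV V"
  using datum by (auto simp: qlc_datum_def)

end

sublocale qlc \<subseteq> graded_space s "susp V"
  by (intro graded_space.intro tensors.intro graded_space_axioms.intro vector_space_s
      is_grading_susp graded_V)

sublocale qlc \<subseteq> V: graded_space s V
  by (intro graded_space.intro tensors.intro graded_space_axioms.intro vector_space_s graded_V)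

context qlc
begin

abbreviation "qR \<equiv> quadratic_part s R"
abbreviation "S \<equiv> susp2 s V ` qR"
abbreviation "\<eta> \<equiv> V.degree_op (- 1)"

lemma R_sub: "T.subspace R" and R_upto: "R \<subseteq> tensor_upto s 2"
  and R_graded: "R = T.span (\<Union>i. R \<inter> tensor_grade s V i)"
  and R_ideal: "two_sided_ideal s R \<inter> tensor_upto s 2 = R"
  using datum by (auto simp: qlc_datum_def)

lemma \<phi>_linear: "linear_on tscale s qR \<phi>" and \<theta>_linear: "linear_on tscale (*) qR \<theta>"
  and \<phi>_grade: "x \<in> qR \<Longrightarrow> x \<in> tensor_grade s V i \<Longrightarrow> \<phi> x \<in> V i"
  and \<theta>_grade: "x \<in> qR \<Longrightarrow> x \<in> tensor_grade s V i \<Longrightarrow> i \<noteq> 0 \<Longrightarrow> \<theta> x = 0"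
  and R_graph: "R = {x - pure s [\<phi> x] + tscale (\<theta> x) (pure s []) | x. x \<in> qR}"
  using maps unfolding qlc_maps_def by blast+

lemma upto_in_alg: "x \<in> tensor_upto s n \<Longrightarrow> x \<in> tensor_alg s"
  unfolding tensor_upto_def
  by (rule T.span_minimal[THEN subsetD, OF _ subspace_alg]) (use power_in_alg in auto)

lemma qR_sub: "T.subspace qR"
  unfolding quadratic_part_def by (rule lin_subspace_image[OF tproj_linear R_sub])

lemma qR_square: "x \<in> qR \<Longrightarrow> x \<in> tensor_power s 2"
  unfolding quadratic_part_def using R_upto upto_in_alg tproj_in_power by blast

lemma qR_span: "x \<in> qR \<Longrightarrow> x \<in> T.span (\<Union>i. qR \<inter> tensor_grade s V i)"
proof -
  assume "x \<in> qR"
  then obtain r where x: "x = tproj s 2 r" and r: "r \<in> R" unfolding quadratic_part_def by blast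
  have "tproj s 2 r \<in> T.span (\<Union>i. qR \<inter> tensor_grade s V i)"
  proof (rule lin_span_image[OF tproj_linear _ T.subspace_span])
    show "r \<in> T.span (\<Union>i. R \<inter> tensor_grade s V i)" using r R_graded by simp
    fix y assume "y \<in> (\<Union>i. R \<inter> tensor_grade s V i)"
    then obtain i where "y \<in> R" "y \<in> tensor_grade s V i" by blast
    thus "tproj s 2 y \<in> T.span (\<Union>i. qR \<inter> tensor_grade s V i)"
      using V.tproj_tensor_grade[of y i 2] unfolding quadratic_part_def by (intro T.span_base) blast
  qed
  thus ?thesis using x by simp
qed

lemma qR_span_eq: "T.span (\<Union>i. qR \<inter> tensor_grade s V i) = qR"
proof
  show "T.span (\<Union>i. qR \<inter> tensor_grade s V i) \<subseteq> qR" by (rule T.span_minimal[OF _ qR_sub]) blast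
qed (use qR_span in blast)

lemma tmap_qR: "\<mu> \<noteq> 0 \<Longrightarrow> x \<in> qR \<Longrightarrow> tmap (V.degree_op \<mu>) x \<in> qR"
  by (rule lin_span_image[OF tmap_linear _ qR_sub qR_span])
    (auto simp: V.tmap_tensor_grade T.subspace_scale qR_sub)

text \<open>\<open>\<phi>\<close> has degree zero, and \<open>\<theta>\<close> vanishes outside degree zero.\<close>

lemma \<phi>_\<eta>: "x \<in> qR \<Longrightarrow> \<phi> (tmap \<eta> x) = \<eta> (\<phi> x)"
proof (rule linear_eq_on_span[OF vector_space_tscale vector_space_s, of "\<Union>i. qR \<inter> tensor_grade s V i" "\<lambda>x. \<phi> (tmap \<eta> x)"])
  show "linear_on tscale s (T.span (\<Union>i. qR \<inter> tensor_grade s V i)) (\<lambda>x. \<phi> (tmap \<eta> x))"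
    unfolding qR_span_eq using \<phi>_linear tmap_qR[of "- 1"]
    by (simp add: linear_on_def lin_add[OF tmap_linear] lin_scale[OF tmap_linear])
  show "linear_on tscale s (T.span (\<Union>i. qR \<inter> tensor_grade s V i)) (\<lambda>x. \<eta> (\<phi> x))"
    unfolding qR_span_eq using \<phi>_linear
    by (simp add: linear_on_def lin_add[OF V.degree_op(1)] lin_scale[OF V.degree_op(1)])
  fix x assume "x \<in> (\<Union>i. qR \<inter> tensor_grade s V i)"
  then obtain i where x: "x \<in> qR" "x \<in> tensor_grade s V i" by blast
  show "\<phi> (tmap \<eta> x) = \<eta> (\<phi> x)"
    using x \<phi>_linear V.degree_op(2)[OF \<phi>_grade[OF x]] by (simp add: V.tmap_tensor_grade linear_on_def)
qed (rule qR_span)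

lemma \<theta>_\<eta>: "x \<in> qR \<Longrightarrow> \<theta> (tmap \<eta> x) = \<theta> x"
proof (rule linear_eq_on_span[OF vector_space_tscale vector_space_mult, of "\<Union>i. qR \<inter> tensor_grade s V i" "\<lambda>x. \<theta> (tmap \<eta> x)"])
  show "linear_on tscale (*) (T.span (\<Union>i. qR \<inter> tensor_grade s V i)) (\<lambda>x. \<theta> (tmap \<eta> x))"
    unfolding qR_span_eq using \<theta>_linear tmap_qR[of "- 1"]
    by (simp add: linear_on_def lin_add[OF tmap_linear] lin_scale[OF tmap_linear])
  show "linear_on tscale (*) (T.span (\<Union>i. qR \<inter> tensor_grade s V i)) \<theta>"
    unfolding qR_span_eq by (rule \<theta>_linear)
  fix x assume "x \<in> (\<Union>i. qR \<inter> tensor_grade s V i)"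
  then obtain i where x: "x \<in> qR" "x \<in> tensor_grade s V i" by blast
  show "\<theta> (tmap \<eta> x) = \<theta> x"
    using x \<theta>_linear \<theta>_grade[OF x] by (cases "i = 0") (simp_all add: V.tmap_tensor_grade linear_on_def)
qed (rule qR_span)

text \<open>Suspension raises all degrees by one.\<close>

lemma degree_op_susp: "\<mu> \<noteq> 0 \<Longrightarrow> degree_op \<mu> v = s \<mu> (V.degree_op \<mu> v)"
proof (rule lin_eq_on_span[OF degree_op(1) lin_smult[OF V.degree_op(1)] _ span_G])
  fix v assume \<mu>: "\<mu> \<noteq> 0" and "v \<in> (\<Union>i. susp V i)"
  then obtain i where v: "v \<in> susp V i" by blast
  hence "v \<in> V (i - 1)" by (simp add: susp_def)
  thus "degree_op \<mu> v = s \<mu> (V.degree_op \<mu> v)"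
    using v \<mu> by (simp add: degree_op(2) V.degree_op(2) power_int_diff)
qed

lemma \<eta>_\<eta>: "\<eta> (\<eta> v) = v"
  by (simp add: V.degree_op_comp V.degree_op_one)

lemma \<eta>_linear: "lin s s \<eta>"
  by (rule V.degree_op(1))

lemma susp2_facts: "lin tscale tscale (susp2 s V)" "susp2 s V (pure s [v, w]) = pure s [\<eta> v, w]"
proof -
  obtain L where L: "lin tscale tscale L" "\<And>a b. L (pure s [a, b]) = pure s [\<eta> a, b]"
    using tens[OF \<eta>_linear linear_id[unfolded id_def]] by blast
  have hom: "L (pure s ws) = tscale ((- 1) powi (es ! 0)) (pure s [ws ! 0, ws ! 1])"
    if "length ws = 2" and h: "homogeneous_word V es ws" for es ws
  proof -
    obtain a b where ws: "ws = [a, b]" using \<open>length ws = 2\<close> by (auto simp: length_Suc_conv numeral_2_eq_2)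
    then obtain i j where "es = [i, j]" "a \<in> V i"
      using h by (auto simp: homogeneous_word_def list_all2_Cons2)
    thus ?thesis by (simp add: ws L(2) V.degree_op(2) lin_scale[OF pure2_linear(1)])
  qed
  show "lin tscale tscale (susp2 s V)"
    unfolding susp2_def by (rule homog_ext_linear[OF L(1) hom])
  have "pure s [v, w] \<in> homogeneous_span V (length [v, w])"
    by (rule pure_in_homogeneous_span) (use V.span_G in auto)
  hence "pure s [v, w] \<in> homogeneous_span V 2" by (simp add: numeral_2_eq_2)
  thus "susp2 s V (pure s [v, w]) = pure s [\<eta> v, w]"
    unfolding susp2_def using homog_ext_eq[OF L(1) hom] L(2) by simp
qed

text \<open>\<open>s\<^sup>2\<close>, extended by zero to all weights. Since \<open>v \<otimes> w \<mapsto> (-1)\<^sup>|\<^sup>v\<^sup>| v \<otimes> w\<close> is an involution, \<open>sus\<close> is its own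
  inverse on \<open>V \<otimes> V\<close> and computes \<open>desusp2\<close> as well.\<close>

definition "sus x = susp2 s V (tproj s 2 x)"

lemma sus_linear: "lin tscale tscale sus"
  unfolding sus_def[abs_def] by (rule lin_comp[OF tproj_linear susp2_facts(1)])

lemma sus_weight: "length ws \<noteq> 2 \<Longrightarrow> sus (pure s ws) = 0"
  by (simp add: sus_def tproj_pure lin_zero[OF susp2_facts(1)])

lemma sus_pure: "sus (pure s [v, w]) = pure s [\<eta> v, w]"
  by (simp add: sus_def tproj_pure susp2_facts)

lemma sus_word_op: "word_op sus"
  unfolding word_op_def
proof (intro conjI allI sus_linear)
  show "sus (pure s ws) \<in> tensor_alg s" for ws
    by (cases "length ws = 2")
      (auto simp: sus_weight alg_zero length_Suc_conv numeral_2_eq_2 sus_pure pure_in_alg)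
qed

lemma sus_susp2: "x \<in> tensor_power s 2 \<Longrightarrow> sus x = susp2 s V x"
  by (simp add: sus_def tproj_power)

lemma sus_in_power: "x \<in> tensor_power s 2 \<Longrightarrow> sus x \<in> tensor_power s 2"
  by (rule lin_power_image[OF sus_linear _ subspace_power])
    (auto simp: length_Suc_conv numeral_2_eq_2 sus_pure intro!: pure_in_power')

lemma sus_sus: "x \<in> tensor_power s 2 \<Longrightarrow> sus (sus x) = x"
  by (rule lin_square_eqI[OF lin_comp[OF sus_linear sus_linear] lin_id])
    (simp_all add: sus_pure \<eta>_\<eta>)

lemma sus_S: "x \<in> qR \<Longrightarrow> sus x \<in> S"
  using sus_susp2[OF qR_square] by simp

lemma S_cases:
  assumes "r \<in> S" obtains x where "x \<in> qR" "r = sus x"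
proof -
  from assms obtain x where x: "r = susp2 s V x" "x \<in> qR" by (rule imageE)
  show thesis by (rule that[OF x(2)]) (simp add: x(1) sus_susp2[OF qR_square[OF x(2)]])
qed

lemma sus_S_qR: "r \<in> S \<Longrightarrow> sus r \<in> qR"
  by (erule S_cases) (simp add: sus_sus qR_square)

lemma desusp2_eq: "r \<in> S \<Longrightarrow> desusp2 s V R r = sus r"
proof (erule S_cases)
  fix x assume x: "x \<in> qR" and r: "r = sus x"
  have "inj_on (susp2 s V) qR"
    by (rule inj_on_inverseI[of _ sus]) (simp add: sus_susp2[symmetric] sus_sus qR_square)
  thus "desusp2 s V R r = sus r"
    using x r sus_susp2[OF qR_square[OF x]] sus_sus[OF qR_square[OF x]] by (simp add: desusp2_def)
qed

lemma tmap_sus: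
  assumes "\<mu> \<noteq> 0" "x \<in> tensor_power s 2"
  shows "tmap (degree_op \<mu>) (sus x) = tscale (\<mu> * \<mu>) (sus (tmap (V.degree_op \<mu>) x))"
proof (rule lin_square_eqI[OF lin_comp[OF sus_linear tmap_linear] lin_smult[OF lin_comp[OF tmap_linear sus_linear]] _ assms(2)])
  fix v w
  have "V.degree_op \<mu> (\<eta> v) = \<eta> (V.degree_op \<mu> v)" using assms(1) by (simp add: V.degree_op_comp)
  thus "tmap (degree_op \<mu>) (sus (pure s [v, w])) = tscale (\<mu> * \<mu>) (sus (tmap (V.degree_op \<mu>) (pure s [v, w])))"
    using assms(1) by (simp add: sus_pure tmap_pure[OF degree_op(1)] tmap_pure[OF V.degree_op(1)] degree_op_susp
        lin_scale[OF pure2_linear(1)] lin_scale[OF pure2_linear(2)])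
qed

lemma sus_grade:
  assumes "r \<in> S" "r \<in> tensor_grade s (susp V) i"
  shows "sus r \<in> tensor_grade s V (i - 2)"
proof -
  have r: "r \<in> tensor_power s 2" "sus r \<in> tensor_power s 2"
  proof -
    from assms(1) obtain x where x: "x \<in> qR" "r = sus x" by (rule S_cases)
    show "r \<in> tensor_power s 2" "sus r \<in> tensor_power s 2"
      using x sus_in_power[OF qR_square[OF x(1)]] sus_in_power by auto
  qed
  have "tscale 4 (tmap (V.degree_op 2) (sus r)) = sus (tmap (degree_op 2) r)"
  proof -
    have "tmap (degree_op 2) r = tscale (2 * 2) (sus (tmap (V.degree_op 2) (sus r)))"
      using tmap_sus[of 2 "sus r"] r by (simp add: sus_sus)
    thus ?thesis
      using r by (simp add: lin_scale[OF sus_linear] sus_sus tmap_in_power[OF V.degree_op(1)])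
  qed
  also have "\<dots> = tscale (2 powi i) (sus r)"
    using assms(2) by (simp add: tensor_grade_iff lin_scale[OF sus_linear])
  finally have "tscale (1 / 4) (tscale 4 (tmap (V.degree_op 2) (sus r))) = tscale (1 / 4) (tscale (2 powi i) (sus r))"
    by simp
  hence "tmap (V.degree_op 2) (sus r) = tscale (2 powi (i - 2)) (sus r)"
    by (simp add: power_int_diff)
  thus ?thesis using power_in_alg[OF r(2)] by (simp add: V.tensor_grade_iff)
qed

definition "\<phi>_ext = (SOME g. lin tscale s g \<and> (\<forall>x\<in>qR. g x = \<phi> x))"
definition "\<theta>_ext = (SOME g. lin tscale (*) g \<and> (\<forall>x\<in>qR. g x = \<theta> x))"
definition "\<Phi> x = \<phi>_ext (sus x)"
definition "\<Theta> x = \<theta>_ext (sus x)"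

lemma \<phi>_ext: "lin tscale s \<phi>_ext" "x \<in> qR \<Longrightarrow> \<phi>_ext x = \<phi> x"
proof -
  have "\<exists>g. lin tscale s g \<and> (\<forall>x\<in>qR. g x = \<phi> x)"
    by (rule linear_on_extend[OF vector_space_tscale vector_space_s qR_sub \<phi>_linear]) blast
  from someI_ex[OF this] show "lin tscale s \<phi>_ext" "x \<in> qR \<Longrightarrow> \<phi>_ext x = \<phi> x"
    by (auto simp: \<phi>_ext_def)
qed

lemma \<theta>_ext: "lin tscale (*) \<theta>_ext" "x \<in> qR \<Longrightarrow> \<theta>_ext x = \<theta> x"
proof -
  have "\<exists>g. lin tscale (*) g \<and> (\<forall>x\<in>qR. g x = \<theta> x)"
    by (rule linear_on_extend[OF vector_space_tscale vector_space_mult qR_sub \<theta>_linear]) blast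
  from someI_ex[OF this] show "lin tscale (*) \<theta>_ext" "x \<in> qR \<Longrightarrow> \<theta>_ext x = \<theta> x"
    by (auto simp: \<theta>_ext_def)
qed

lemma \<Phi>_sus: "x \<in> qR \<Longrightarrow> \<Phi> (sus x) = \<phi> x" and \<Theta>_sus: "x \<in> qR \<Longrightarrow> \<Theta> (sus x) = \<theta> x"
  by (simp_all add: \<Phi>_def \<Theta>_def sus_sus qR_square \<phi>_ext \<theta>_ext)

lemma qlc_coderivation: "quadratic_coderivation s (susp V) S \<Phi>"
proof (intro quadratic_coderivation.intro graded_quadratic.intro quadratic.intro quadratic_axioms.intro
    graded_quadratic_axioms.intro quadratic_coderivation_axioms.intro graded_space_axioms tensors_axioms)
  show "T.subspace S" by (rule lin_subspace_image[OF susp2_facts(1) qR_sub])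
  show "S \<subseteq> tensor_power s 2"
    using sus_susp2[OF qR_square] sus_in_power[OF qR_square] by auto
  show "tmap (degree_op 2) r \<in> S" if "r \<in> S" for r
    using that
  proof (rule S_cases)
    fix x assume x: "x \<in> qR" and r: "r = sus x"
    have "tmap (degree_op 2) r = sus (tscale (2 * 2) (tmap (V.degree_op 2) x))"
      unfolding r lin_scale[OF sus_linear] by (rule tmap_sus) (simp_all add: qR_square x)
    also have "\<dots> \<in> S"
      using tmap_qR[of 2 x] x by (intro sus_S T.subspace_scale qR_sub) simp
    finally show "tmap (degree_op 2) r \<in> S" .
  qed
  show "lin tscale s \<Phi>"
    unfolding \<Phi>_def[abs_def] by (rule lin_comp[OF sus_linear \<phi>_ext(1)])
  show "\<Phi> (pure s ws) = 0" if "length ws \<noteq> 2" for ws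
    using that by (simp add: \<Phi>_def sus_weight lin_zero[OF \<phi>_ext(1)])
  show "\<Phi> r \<in> susp V (i - 1)" if "r \<in> S" "r \<in> tensor_grade s (susp V) i" for r i
    using \<phi>_grade[OF sus_S_qR sus_grade, OF that(1) that] sus_S_qR[OF that(1)]
    by (simp add: \<Phi>_def \<phi>_ext susp_def)
qed

end

sublocale qlc \<subseteq> quadratic_coderivation s "susp V" "susp2 s V ` quadratic_part s R" \<Phi>
  by (rule qlc_coderivation)

context qlc
begin

text \<open>On three letters, \<open>\<phi>h\<close> and \<open>\<phi>t\<close> are \<open>\<phi> \<otimes> id\<close> and \<open>id \<otimes> \<phi>\<close>, similarly for \<open>\<theta>\<close>, and \<open>\<sigma>\<close> undoes the
  suspension of \<open>V\<^sup>\<otimes>\<^sup>3\<close>: it multiplies \<open>u \<otimes> v \<otimes> w\<close> by \<open>(-1)\<^sup>|\<^sup>v\<^sup>|\<close>.\<close>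

definition "\<phi>h = head_op 2 (\<lambda>x. pure s [\<phi>_ext x])"
definition "\<phi>t = tail_op 1 (\<lambda>x. pure s [\<phi>_ext x])"
definition "\<theta>h = head_op 2 (\<lambda>x. tscale (\<theta>_ext x) (pure s []))"
definition "\<theta>t = tail_op 1 (\<lambda>x. tscale (\<theta>_ext x) (pure s []))"
definition "\<sigma> = tail_op 1 sus"

lemma ops_linear: "lin tscale tscale \<phi>h" "lin tscale tscale \<phi>t"
  "lin tscale tscale \<theta>h" "lin tscale tscale \<theta>t"
  "lin tscale tscale \<sigma>"
  unfolding \<phi>h_def \<phi>t_def \<theta>h_def \<theta>t_def \<sigma>_def by (rule head_op_linear tail_op_linear)+

lemma word_ops: "word_op (\<lambda>x. pure s [\<phi>_ext x])" "word_op (\<lambda>x. tscale (\<theta>_ext x) (pure s []))"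
  by (rule word_op_vector[OF \<phi>_ext(1)] word_op_scalar[OF \<theta>_ext(1)])+

lemma word3E: "length ws = 3 \<Longrightarrow> (\<And>u v w. ws = [u, v, w] \<Longrightarrow> thesis) \<Longrightarrow> thesis"
  by (auto simp: length_Suc_conv numeral_3_eq_3)

lemma \<sigma>_pure: "\<sigma> (pure s [u, v, w]) = pure s [u, \<eta> v, w]"
  by (simp add: \<sigma>_def tail_op_pure[OF sus_word_op] sus_pure tmult_pure)

lemma \<phi>t_pure: "\<phi>t (pure s [u, v, w]) = pure s [u, \<phi>_ext (pure s [v, w])]"
  by (simp add: \<phi>t_def tail_op_pure[OF word_ops(1)] tmult_pure)

lemma \<theta>t_pure: "\<theta>t (pure s [u, v, w]) = tscale (\<theta>_ext (pure s [v, w])) (pure s [u])"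
  by (simp add: \<theta>t_def tail_op_pure[OF word_ops(2)] tmult_pure tmult_scale_right pure_in_alg)

lemma ops_in_power:
  assumes "x \<in> tensor_power s 3"
  shows "\<sigma> x \<in> tensor_power s 3" "\<phi>h x \<in> tensor_power s 2" "\<phi>t x \<in> tensor_power s 2"
    "\<theta>h x \<in> tensor_power s 1" "\<theta>t x \<in> tensor_power s 1"
proof -
  note image = lin_power_image[OF _ _ subspace_power assms]
  show "\<sigma> x \<in> tensor_power s 3"
    by (rule image[OF ops_linear(5)]) (auto elim!: word3E simp: \<sigma>_pure intro!: pure_in_power')
  show "\<phi>h x \<in> tensor_power s 2"
    by (rule image[OF ops_linear(1)])
      (auto elim!: word3E simp: \<phi>h_def head_op_pure[OF word_ops(1)] tmult_pure intro!: pure_in_power')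
  show "\<phi>t x \<in> tensor_power s 2"
    by (rule image[OF ops_linear(2)]) (auto elim!: word3E simp: \<phi>t_pure intro!: pure_in_power')
  show "\<theta>h x \<in> tensor_power s 1"
    by (rule image[OF ops_linear(3)])
      (auto elim!: word3E simp: \<theta>h_def head_op_pure[OF word_ops(2)] tmult_pure tmult_scale_left
        intro!: pure_in_power' T.subspace_scale subspace_power)
  show "\<theta>t x \<in> tensor_power s 1"
    by (rule image[OF ops_linear(4)])
      (auto elim!: word3E simp: \<theta>t_pure intro!: pure_in_power' T.subspace_scale subspace_power)
qed

text \<open>The sign in \<open>s\<^sup>2\<close> comes from the first letter, that of \<open>\<sigma>\<close> from the middle one. Together they
  identify \<open>s\<^sup>2 x \<otimes> v\<close> with \<open>(-1)\<^sup>|\<^sup>x\<^sup>| x \<otimes> v\<close> and \<open>v \<otimes> s\<^sup>2 x\<close> with \<open>v \<otimes> x\<close>.\<close>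

lemma \<sigma>_left:
  assumes "x \<in> tensor_power s 2" "v \<in> tensor_power s 1"
  shows "\<sigma> (sus x \<cdot> v) = tmap \<eta> x \<cdot> v"
proof -
  obtain e where v: "v = pure s [e]" using assms(2) power_one by blast
  show ?thesis
    by (rule lin_square_eqI[OF lin_comp[OF lin_comp[OF sus_linear tmult_linear_left] ops_linear(5)]
          lin_comp[OF tmap_linear tmult_linear_left] _ assms(1)])
      (simp add: sus_pure v tmult_pure \<sigma>_pure tmap_pure[OF \<eta>_linear])
qed

lemma \<sigma>_right:
  assumes "x \<in> tensor_power s 2" "v \<in> tensor_power s 1"
  shows "\<sigma> (v \<cdot> sus x) = v \<cdot> x"
  unfolding \<sigma>_def
  using tail_op_tmult[OF sus_word_op assms(2) power_in_alg[OF sus_in_power[OF assms(1)]]]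
  by (simp only: sus_sus[OF assms(1)])

lemma relation_in_R: "x \<in> qR \<Longrightarrow> x - pure s [\<phi>_ext x] + tscale (\<theta>_ext x) (pure s []) \<in> R"
  using R_graph \<phi>_ext(2) \<theta>_ext(2) by auto

lemma ideal_sub: "T.subspace (two_sided_ideal s R)"
  by (simp add: two_sided_ideal_def)

lemma ideal_right: "r \<in> R \<Longrightarrow> v \<in> tensor_alg s \<Longrightarrow> r \<cdot> v \<in> two_sided_ideal s R"
  and ideal_left: "r \<in> R \<Longrightarrow> v \<in> tensor_alg s \<Longrightarrow> v \<cdot> r \<in> two_sided_ideal s R"
proof -
  assume r: "r \<in> R" and v: "v \<in> tensor_alg s"
  have rT: "r \<in> tensor_alg s" using r R_upto upto_in_alg by blast
  have "pure s [] \<cdot> r \<cdot> v \<in> two_sided_ideal s R" "v \<cdot> r \<cdot> pure s [] \<in> two_sided_ideal s R"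
    unfolding two_sided_ideal_def using r v pure_in_alg[of "[]"] by (blast intro: T.span_base)+
  thus "r \<cdot> v \<in> two_sided_ideal s R" "v \<cdot> r \<in> two_sided_ideal s R"
    using rT v by (simp_all add: tmult_unit_left tmult_unit_right tmult_in_alg)
qed

lemma wt_3_left: "c \<in> wt 3 \<Longrightarrow> c \<in> tensor_prod S (tensor_power s 1)"
  using wt_factor[of c 3 2] wt_2 wt_1 by (simp add: numeral_3_eq_3 numeral_2_eq_2)

lemma wt_3_right: "c \<in> wt 3 \<Longrightarrow> c \<in> tensor_prod (tensor_power s 1) S"
  using wt_factor[of c 3 1] wt_2 wt_1 by (simp add: numeral_3_eq_3 numeral_2_eq_2)

text \<open>An element of \<open>qR \<otimes> V \<inter> V \<otimes> qR\<close> is rewritten modulo \<open>R\<close> at its first two and at its last two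
  letters. The difference of the results has length at most two, so it is a relation.\<close>

lemma overlap_relation:
  assumes c: "c \<in> wt 3"
  defines "Z \<equiv> \<phi>h (\<sigma> c) - \<phi>t (\<sigma> c)"
  shows "Z \<in> qR" "pure s [\<phi> Z] = \<theta>h (\<sigma> c) - \<theta>t (\<sigma> c)" "\<theta> Z = 0"
proof -
  let ?y = "\<sigma> c" and ?I = "two_sided_ideal s R"
  have cT: "c \<in> tensor_power s 3" by (rule wt_in_power[OF c])
  (* y rewritten at its first two letters, which requires y \<in> qR \<otimes> V, then at its last two. *)
  have 1: "?y - \<phi>h ?y + \<theta>h ?y \<in> ?I"
  proof (rule lin_prod_image[where f = "\<lambda>c. \<sigma> c - \<phi>h (\<sigma> c) + \<theta>h (\<sigma> c)", OF _ _ ideal_sub wt_3_left[OF c]])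
    show "lin tscale tscale (\<lambda>c. \<sigma> c - \<phi>h (\<sigma> c) + \<theta>h (\<sigma> c))"
      by (intro lin_plus lin_minus lin_comp[OF ops_linear(5) ops_linear(1)] lin_comp[OF ops_linear(5) ops_linear(3)] ops_linear(5))
    fix r v assume r: "r \<in> S" and v: "v \<in> tensor_power s 1"
    from r obtain x where x: "x \<in> qR" "r = sus x" by (rule S_cases)
    let ?x = "tmap \<eta> x"
    have xq: "?x \<in> qR" using tmap_qR x(1) by simp
    have vT: "v \<in> tensor_alg s" using v power_in_alg by blast
    have "\<sigma> (r \<cdot> v) - \<phi>h (\<sigma> (r \<cdot> v)) + \<theta>h (\<sigma> (r \<cdot> v)) = (?x - pure s [\<phi>_ext ?x] + tscale (\<theta>_ext ?x) (pure s [])) \<cdot> v"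
      unfolding x(2) \<sigma>_left[OF qR_square[OF x(1)] v]
      by (simp add: \<phi>h_def \<theta>h_def head_op_tmult[OF word_ops(1) qR_square[OF xq] vT]
          head_op_tmult[OF word_ops(2) qR_square[OF xq] vT] tmult_add_left lin_diff[OF tmult_linear_left])
    also have "\<dots> \<in> ?I" by (rule ideal_right[OF relation_in_R[OF xq] vT])
    finally show "\<sigma> (r \<cdot> v) - \<phi>h (\<sigma> (r \<cdot> v)) + \<theta>h (\<sigma> (r \<cdot> v)) \<in> ?I" .
  qed
  have 2: "?y - \<phi>t ?y + \<theta>t ?y \<in> ?I"
  proof (rule lin_prod_image[where f = "\<lambda>c. \<sigma> c - \<phi>t (\<sigma> c) + \<theta>t (\<sigma> c)", OF _ _ ideal_sub wt_3_right[OF c]])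
    show "lin tscale tscale (\<lambda>c. \<sigma> c - \<phi>t (\<sigma> c) + \<theta>t (\<sigma> c))"
      by (intro lin_plus lin_minus lin_comp[OF ops_linear(5) ops_linear(2)] lin_comp[OF ops_linear(5) ops_linear(4)] ops_linear(5))
    fix v r assume r: "r \<in> S" and v: "v \<in> tensor_power s 1"
    from r obtain x where x: "x \<in> qR" "r = sus x" by (rule S_cases)
    have T: "v \<in> tensor_alg s" "x \<in> tensor_alg s" using v qR_square[OF x(1)] power_in_alg by blast+
    let ?\<rho> = "x - pure s [\<phi>_ext x] + tscale (\<theta>_ext x) (pure s [])"
    have sub: "v \<cdot> (a - b) = v \<cdot> a - v \<cdot> b" if "a \<in> tensor_alg s" "b \<in> tensor_alg s" for a b
      using tmult_add_right[OF T(1), of "a - b" b] that T.subspace_diff[OF subspace_alg that] by simp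
    have "\<sigma> (v \<cdot> r) - \<phi>t (\<sigma> (v \<cdot> r)) + \<theta>t (\<sigma> (v \<cdot> r)) = v \<cdot> ?\<rho>"
      unfolding x(2) \<sigma>_right[OF qR_square[OF x(1)] v]
      by (simp add: \<phi>t_def \<theta>t_def tail_op_tmult[OF word_ops(1) v T(2)] tail_op_tmult[OF word_ops(2) v T(2)]
          tmult_add_right sub T alg_scale pure_in_alg T.subspace_diff[OF subspace_alg]
          del: One_nat_def)
    also have "\<dots> \<in> ?I" by (rule ideal_left[OF relation_in_R[OF x(1)] T(1)])
    finally show "\<sigma> (v \<cdot> r) - \<phi>t (\<sigma> (v \<cdot> r)) + \<theta>t (\<sigma> (v \<cdot> r)) \<in> ?I" .
  qed
  let ?u = "\<theta>h ?y - \<theta>t ?y"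
  note y = ops_in_power[OF ops_in_power(1)[OF cT]]
  have Z: "Z \<in> tensor_power s 2" unfolding Z_def using y by (simp add: T.subspace_diff subspace_power)
  have u: "?u \<in> tensor_power s 1" using y by (simp add: T.subspace_diff subspace_power)
  have "(?y - \<phi>h ?y + \<theta>h ?y) - (?y - \<phi>t ?y + \<theta>t ?y) \<in> ?I"
    by (rule T.subspace_diff[OF ideal_sub 1 2])
  hence "?u - Z \<in> ?I" by (simp add: Z_def algebra_simps)
  moreover have "?u - Z \<in> tensor_upto s 2"
    unfolding tensor_upto_def
  proof (rule T.span_diff)
    show "?u \<in> T.span (\<Union>m\<le>2. tensor_power s m)" by (rule T.span_base) (use u in force)
    show "Z \<in> T.span (\<Union>m\<le>2. tensor_power s m)" by (rule T.span_base) (use Z in force)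
  qed
  ultimately have "?u - Z \<in> R" using R_ideal by blast
  then obtain x where x: "x \<in> qR" and eq: "?u - Z = x - pure s [\<phi> x] + tscale (\<theta> x) (pure s [])"
    using R_graph by blast
  (* The components of weight 2, 1 and 0 of this equation give the three claims. *)
  have proj: "tproj s n (?u - Z) = tproj s n x - tproj s n (pure s [\<phi> x]) + tscale (\<theta> x) (tproj s n (pure s []))" for n
    unfolding eq by (simp add: lin_add[OF tproj_linear] lin_diff[OF tproj_linear] lin_scale[OF tproj_linear])
  have "- Z = x" using proj[of 2] tproj_power[OF Z] tproj_power[OF u] tproj_power[OF qR_square[OF x]]
    by (simp add: lin_diff[OF tproj_linear] tproj_pure)
  hence Zx: "Z = - x" by (metis minus_minus)
  have u1: "?u = - pure s [\<phi> x]"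
    using proj[of 1] tproj_power[OF Z] tproj_power[OF u] tproj_power[OF qR_square[OF x]]
    by (simp add: lin_diff[OF tproj_linear] tproj_pure)
  have "tscale (\<theta> x) (pure s []) = 0"
    using proj[of 0] tproj_power[OF Z] tproj_power[OF u] tproj_power[OF qR_square[OF x]]
    by (simp add: lin_diff[OF tproj_linear] tproj_pure)
  hence "tcounit (tscale (\<theta> x) (pure s [])) = tcounit (0 :: ('v, 'k) tensor)" by (rule arg_cong)
  hence \<theta>x: "\<theta> x = 0" by (simp add: lin_scale[OF tcounit_linear] lin_zero[OF tcounit_linear] tcounit_pure)
  show "Z \<in> qR" unfolding Zx by (rule T.subspace_neg[OF qR_sub x])
  have "\<phi> (tscale (- 1) x) = s (- 1) (\<phi> x)" using \<phi>_linear x unfolding linear_on_def by blast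
  hence "\<phi> Z = - \<phi> x" unfolding Zx by simp
  thus "pure s [\<phi> Z] = ?u" using u1 lin_diff[OF pure_singleton_linear, of 0 "\<phi> x"]
    by (simp add: pure_singleton_zero)
  have "\<theta> (tscale (- 1) x) = (- 1) * \<theta> x" using \<theta>_linear x unfolding linear_on_def by blast
  thus "\<theta> Z = 0" unfolding Zx using \<theta>x by simp
qed

text \<open>For \<open>\<phi> \<otimes> id\<close> the sign \<open>(-1)\<^sup>|\<^sup>x\<^sup>|\<close> from \<open>\<sigma>_left\<close> is absorbed by the one in \<open>s\<^sup>2\<close>, as \<open>\<phi>\<close> preserves degrees. For
  \<open>id \<otimes> \<phi>\<close> the Koszul sign refers to the degree of the suspended first letter, hence the minus sign.\<close>

lemma d_overlap:
  assumes c: "c \<in> wt 3"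
  shows "d c = sus (\<phi>h (\<sigma> c) - \<phi>t (\<sigma> c))"
proof -
  have "H c = sus (\<phi>h (\<sigma> c))"
  proof (rule lin_prod_eqI[OF H_linear lin_comp[OF lin_comp[OF ops_linear(5) ops_linear(1)] sus_linear] _ wt_3_left[OF c]])
    fix r v assume r: "r \<in> S" and v: "v \<in> tensor_power s 1"
    from r obtain x where x: "x \<in> qR" "r = sus x" by (rule S_cases)
    have xq: "tmap \<eta> x \<in> qR" using tmap_qR x(1) by simp
    obtain e where e: "v = pure s [e]" using v power_one by blast
    have "sus (\<phi>h (\<sigma> (r \<cdot> v))) = sus (pure s [\<phi> (tmap \<eta> x)] \<cdot> v)"
      unfolding x(2) \<sigma>_left[OF qR_square[OF x(1)] v] \<phi>h_def
      using head_op_tmult[OF word_ops(1) qR_square[OF xq] power_in_alg[OF v]] by (simp add: \<phi>_ext(2)[OF xq])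
    also have "\<dots> = pure s [\<phi> x] \<cdot> v"
      by (simp add: e tmult_pure sus_pure \<phi>_\<eta>[OF x(1)] \<eta>_\<eta>)
    also have "\<dots> = H (r \<cdot> v)"
      using H_tmult[OF sus_in_power[OF qR_square[OF x(1)]] power_in_alg[OF v]] x by (simp add: \<Phi>v_def \<Phi>_sus)
    finally show "H (r \<cdot> v) = sus (\<phi>h (\<sigma> (r \<cdot> v)))" by simp
  qed
  moreover have "P c = - sus (\<phi>t (\<sigma> c))"
  proof -
    have "P c + sus (\<phi>t (\<sigma> c)) = 0"
    proof (rule lin_power_eqI[OF lin_plus[OF P_linear lin_comp[OF lin_comp[OF ops_linear(5) ops_linear(2)] sus_linear]]
          lin_const_zero[OF vector_space_tscale vector_space_tscale] _ wt_in_power[OF c]])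
      fix ws :: "'v list" assume "length ws = 3"
      then obtain u v w where ws: "ws = [u, v, w]" by (rule word3E)
      have "P (pure s ws) = pure s [\<epsilon> u, \<Phi> (pure s [v, w])]"
        using P_cons[OF pure_in_alg, of u "[v, w]"] by (simp add: ws cons_pure d_two \<Phi>v_def)
      moreover have \<Phi>: "\<Phi> (pure s [v, w]) = \<phi>_ext (pure s [\<eta> v, w])" by (simp add: \<Phi>_def sus_pure)
      moreover have "\<epsilon> u = s (- 1) (\<eta> u)" by (rule degree_op_susp) simp
      ultimately show "P (pure s ws) + sus (\<phi>t (\<sigma> (pure s ws))) = 0"
        using lin_diff[OF pure2_linear(1), of 0 "\<eta> u" "\<Phi> (pure s [v, w])"]
        by (simp only: ws \<sigma>_pure \<phi>t_pure sus_pure) (simp add: lin_zero[OF pure2_linear(1)])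
    qed
    thus ?thesis by (rule eq_neg_iff_add_eq_0[THEN iffD2])
  qed
  moreover have "d c = H c + P c" by (simp add: P_def)
  ultimately show ?thesis by (simp add: lin_diff[OF sus_linear])
qed

lemma qlc_curved: "curved_quadratic s (susp V) S \<Phi> \<Theta>"
proof (intro curved_quadratic.intro curved_quadratic_axioms.intro quadratic_coderivation_axioms)
  show lin: "lin tscale (*) \<Theta>"
    unfolding \<Theta>_def[abs_def] by (rule lin_comp[OF sus_linear \<theta>_ext(1)])
  show "\<Theta> (pure s ws) = 0" if "length ws \<noteq> 2" for ws
    using that by (simp add: \<Theta>_def sus_weight lin_zero[OF \<theta>_ext(1)])
  show "\<Theta> r = 0" if "r \<in> S" "r \<in> tensor_grade s (susp V) i" "i \<noteq> 2" for r i
    using \<theta>_grade[OF sus_S_qR sus_grade, OF that(1) that(1,2)] sus_S_qR[OF that(1)] that(3)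
    by (simp add: \<Theta>_def \<theta>_ext)
  fix c assume c: "c \<in> wt 3"
  let ?Z = "\<phi>h (\<sigma> c) - \<phi>t (\<sigma> c)"
  note Z = overlap_relation[OF c]
  show "d c \<in> S" using d_overlap[OF c] sus_S[OF Z(1)] by simp
  show "\<Theta> (d c) = 0" using d_overlap[OF c] \<Theta>_sus[OF Z(1)] Z(3) by simp
  have "head_op 2 (\<lambda>x. tscale (\<Theta> x) (pure s [])) c = \<theta>h (\<sigma> c)"
  proof (rule lin_prod_eqI[OF head_op_linear lin_comp[OF ops_linear(5) ops_linear(3)] _ wt_3_left[OF c]])
    fix r v assume r: "r \<in> S" and v: "v \<in> tensor_power s 1"
    from r obtain x where x: "x \<in> qR" "r = sus x" by (rule S_cases)
    have xq: "tmap \<eta> x \<in> qR" using tmap_qR x(1) by simp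
    have vT: "v \<in> tensor_alg s" by (rule power_in_alg[OF v])
    have "\<theta>h (\<sigma> (r \<cdot> v)) = tscale (\<theta> x) v"
      unfolding x(2) \<sigma>_left[OF qR_square[OF x(1)] v] \<theta>h_def head_op_tmult[OF word_ops(2) qR_square[OF xq] vT]
      by (simp add: \<theta>_ext(2)[OF xq] \<theta>_\<eta>[OF x(1)] tmult_scale_left tmult_unit_left[OF vT])
    moreover have "head_op 2 (\<lambda>x. tscale (\<Theta> x) (pure s [])) (r \<cdot> v) = tscale (\<theta> x) v"
      unfolding x(2) head_op_tmult[OF word_op_scalar[OF lin] sus_in_power[OF qR_square[OF x(1)]] vT]
      by (simp add: \<Theta>_sus[OF x(1)] tmult_scale_left tmult_unit_left[OF vT])
    ultimately show "head_op 2 (\<lambda>x. tscale (\<Theta> x) (pure s [])) (r \<cdot> v) = \<theta>h (\<sigma> (r \<cdot> v))" by simp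
  qed
  moreover have "tail_op 1 (\<lambda>x. tscale (\<Theta> x) (pure s [])) c = \<theta>t (\<sigma> c)"
  proof (rule lin_power_eqI[OF tail_op_linear lin_comp[OF ops_linear(5) ops_linear(4)] _ wt_in_power[OF c]])
    fix ws :: "'v list" assume "length ws = 3"
    then obtain u v w where ws: "ws = [u, v, w]" by (rule word3E)
    show "tail_op 1 (\<lambda>x. tscale (\<Theta> x) (pure s [])) (pure s ws) = \<theta>t (\<sigma> (pure s ws))"
      by (simp only: ws tail_op_pure[OF word_op_scalar[OF lin]])
        (simp add: \<sigma>_pure \<theta>t_pure \<Theta>_def sus_pure
          tmult_scale_right pure_in_alg tmult_pure)
  qed
  ultimately show "\<Phi>v (d c) = head_op 2 (\<lambda>x. tscale (\<Theta> x) (pure s [])) c - tail_op 1 (\<lambda>x. tscale (\<Theta> x) (pure s [])) c"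
    using d_overlap[OF c] \<Phi>_sus[OF Z(1)] Z(2) by (simp add: \<Phi>v_def)
qed

end

sublocale qlc \<subseteq> curved_quadratic s "susp V" "susp2 s V ` quadratic_part s R" \<Phi> \<Theta>
  by (rule qlc_curved)

context qlc
begin

lemma corestr_eq: "x \<in> C \<Longrightarrow> \<phi>_corestr s V R \<phi> x = \<Phi> x"
  and \<theta>_tilde_eq: "x \<in> C \<Longrightarrow> \<theta>_tilde s V R \<theta> x = \<Theta> x"
proof -
  assume x: "x \<in> C"
  have r: "tproj s 2 x \<in> S" by (rule tproj_C[OF x])
  have "sus (tproj s 2 x) = sus x"
    using tproj_power[OF tproj_in_power[OF C_in_alg[OF x]], of 2] by (simp add: sus_def)
  thus "\<phi>_corestr s V R \<phi> x = \<Phi> x" "\<theta>_tilde s V R \<theta> x = \<Theta> x"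
    using desusp2_eq[OF r] \<phi>_ext(2)[OF sus_S_qR[OF r]] \<theta>_ext(2)[OF sus_S_qR[OF r]]
    by (simp_all add: \<phi>_corestr_def \<theta>_tilde_def \<Phi>_def \<Theta>_def)
qed

theorem koszul_dual_curved:
  "curved_dg_coalgebra tscale (koszul_dual s V R) (koszul_dual_grade s V R)
    (deconcat s) tcounit (\<phi>_tilde s V R \<phi>) (\<theta>_tilde s V R \<theta>)"
proof -
  have C: "koszul_dual s V R = C" by (simp add: koszul_dual_def)
  have CG: "koszul_dual_grade s V R = CG" by (simp add: koszul_dual_grade_def C fun_eq_iff)
  show ?thesis
    unfolding C CG
    by (rule curved_quadratic_coalgebra)
      (simp_all add: \<phi>_tilde_def C coderivation_of_eq[OF corestr_eq] \<theta>_tilde_eq)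
qed

end

theorem proposition3p1:
  fixes s :: "'k::field_char_0 \<Rightarrow> 'v::ab_group_add \<Rightarrow> 'v"
    and G :: "int \<Rightarrow> 'v set"
    and R :: "('v, 'k) tensor set"
    and \<phi> :: "('v, 'k) tensor \<Rightarrow> 'v"
    and \<theta> :: "('v, 'k) tensor \<Rightarrow> 'k"
  assumes "qlc_datum s G R"
    and "qlc_maps s G R \<phi> \<theta>"
  shows "curved_dg_coalgebra tscale (koszul_dual s G R) (koszul_dual_grade s G R)
    (deconcat s) tcounit (\<phi>_tilde s G R \<phi>) (\<theta>_tilde s G R \<theta>)"
proof -
  interpret qlc s G R \<phi> \<theta> by (rule qlc.intro[OF assms])
  show ?thesis by (rule koszul_dual_curved)
qed

end
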